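(* For each $r\ge 0$, $(r+c(r),c(r))\in\Sigma_L$, where $$c(r)=\inf_{\gamma\in\Gamma}\ \max_{u\in\gamma[-1,1]}E_r(u).$$
   Context: Let $N\ge 1$ be an integer and let $\Omega\subset\mathbb{R}^N$ be a bounded domain (open and connected) with $C^{1,1}$ boundary. $\|\cdot\|_2$ is the $L^2(\Omega)$ norm; $u^\pm=\max\{\pm u,0\}$, so $u=u^+-u^-$. Put $c_N=\pi^{-N/2}\Gamma(N/2)$ and $\rho_N=2\ln 2+\psi(N/2)-\gamma$, with $\psi=\Gamma'/\Gamma$ the digamma function and $\gamma=-\Gamma'(1)$; $B_1$ is the unit ball centred at $0$, $k(z)=\mathbf 1_{B_1}(z)|z|^{-N}$, $j(z)=\mathbf 1_{\mathbb{R}^N\setminus B_1}(z)|z|^{-N}$ for $z\neq 0$. $\mathbb{H}(\Omega)$ is the Hilbert space of all $u\in L^2(\Omega)$, extended by $u=0$ in $\mathbb{R}^N\setminus\Omega$, with $\iint_{\mathbb{R}^{2N}}|u(x)-u(y)|^2k(x-y)\,dx\,dy<\infty$, with inner product $\mathcal{E}(u,v)=\frac{c_N}{2}\iint_{\mathbb{R}^{2N}}(u(x)-u(y))(v(x)-v(y))k(x-y)\,dx\,dy$ and norm $\|u\|=\mathcal{E}(u,u)^{1/2}$. The quadratic form of the logarithmic Laplacian $L_\Delta$ (the operator with Fourier symbol $2\ln|\xi|$) is $$\mathcal{E}_L(u,v)=\mathcal{E}(u,v)-c_N\iint_{\mathbb{R}^{2N}}u(x)v(y)j(x-y)\,dx\,dy+\rho_N\int_{\mathbb{R}^N}uv\,dx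 .$$ The Fučík spectrum $\Sigma_L$ is the set of $(\alpha,\beta)\in\mathbb{R}^2$ for which there is a nontrivial $u\in\mathbb{H}(\Omega)$ with $\mathcal{E}_L(u,v)=\int_\Omega(\alpha u^+-\beta u^-)v\,dx$ for all $v\in\mathbb{H}(\Omega)$ (i.e. a nontrivial weak solution of $L_\Delta u=\alpha u^+-\beta u^-$ in $\Omega$, $u=0$ in $\mathbb{R}^N\setminus\Omega$). The first eigenvalue is $\lambda_1^L=\min\{\mathcal{E}_L(u,u):u\in\mathbb{H}(\Omega),\|u\|_2=1\}$; it is simple, and $\varphi_1>0$ denotes the associated eigenfunction with $\|\varphi_1\|_2=1$. Let $\mathcal{P}=\{u\in\mathbb{H}(\Omega): \int_\Omega u^2\,dx=1\}$ (with the topology of $\mathbb{H}(\Omega)$), $E_r(u)=\mathcal{E}_L(u,u)-r\int_\Omega(u^+)^2\,dx$, and $\Gamma=\{\gamma\in C([-1,1],\mathcal{P}):\gamma(-1)=-\varphi_1,\ \gamma(1)=\varphi_1\}$. *)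

theory Defs
  imports "HOL-Analysis.Analysis"
begin

text \<open>
  The ambient space \<open>\<real>\<^sup>N\<close> is an arbitrary Euclidean space \<open>'a\<close> with \<open>N = DIM('a)\<close>.
  Elements of \<open>L\<^sup>2\<close> and of \<open>\<bbbH>(\<Omega>)\<close> are represented by Borel functions on the whole space
  that vanish outside \<open>\<Omega>\<close>; identities between them are meant almost everywhere.
\<close>

text \<open>
  The domain is locally the region strictly above the graph of a \<open>C\<^sup>1\<^sup>,\<^sup>1\<close> function, in
  coordinates whose last axis is \<open>e\<close>. The vector \<open>x - (x \<bullet> e) *\<^sub>R e\<close> is the orthogonal
  projection of \<open>x\<close> to the hyperplane \<open>e\<^sup>\<bottom>\<close>, so only the restriction of \<open>g\<close> to this
  hyperplane matters; a function on the hyperplane extends to the whole space, constantly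
  in the direction \<open>e\<close>, with the same regularity. For \<open>N = 1\<close> the hyperplane is a point.
\<close>

definition C11_function :: "('a::euclidean_space \<Rightarrow> real) \<Rightarrow> bool" where
  "C11_function g \<longleftrightarrow>
     (\<exists>G L. (\<forall>x. GDERIV g x :> G x) \<and> L-lipschitz_on UNIV G)"

definition C11_boundary :: "'a::euclidean_space set \<Rightarrow> bool" where
  "C11_boundary \<Omega> \<longleftrightarrow>
     (\<forall>x0 \<in> frontier \<Omega>. \<exists>\<delta> > 0. \<exists>e g. norm e = 1 \<and> C11_function g \<and>
        \<Omega> \<inter> ball x0 \<delta> = {x \<in> ball x0 \<delta>. x \<bullet> e > g (x - (x \<bullet> e) *\<^sub>R e)})"

definition bounded_C11_domain :: "'a::euclidean_space set \<Rightarrow> bool" where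
  "bounded_C11_domain \<Omega> \<longleftrightarrow>
     \<Omega> \<noteq> {} \<and> open \<Omega> \<and> connected \<Omega> \<and> bounded \<Omega> \<and> C11_boundary \<Omega>"

definition c_const :: "nat \<Rightarrow> real" where
  "c_const N = pi powr (- (real N / 2)) * Gamma (real N / 2)"

definition rho_const :: "nat \<Rightarrow> real" where
  "rho_const N = 2 * ln 2 + Digamma (real N / 2) - euler_mascheroni"

lemma Digamma_eq_deriv_Gamma:
  fixes x :: real
  assumes "x > 0"
  shows "Digamma x = deriv Gamma x / Gamma x"
proof -
  have "x \<notin> \<int>\<^sub>\<le>\<^sub>0"
    using assms by (auto elim!: nonpos_Ints_cases)
  then have "deriv Gamma x = Gamma x * Digamma x"
    by (intro DERIV_imp_deriv has_field_derivative_Gamma)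
  then show ?thesis
    using Gamma_real_pos[OF assms] by simp
qed

lemma euler_mascheroni_eq_deriv_Gamma: "euler_mascheroni = - deriv Gamma (1::real)"
  using Digamma_eq_deriv_Gamma[of 1] by (simp add: Digamma_1)

text \<open>Both kernels take the irrelevant value \<open>0\<close> at the origin, since \<open>0 powr a = 0\<close>.\<close>

definition kernel_k :: "'a::euclidean_space \<Rightarrow> real" where
  "kernel_k z = indicator (ball 0 1) z * norm z powr (- real DIM('a))"

definition kernel_j :: "'a::euclidean_space \<Rightarrow> real" where
  "kernel_j z = indicator (- ball 0 1) z * norm z powr (- real DIM('a))"

definition H_space :: "'a::euclidean_space set \<Rightarrow> ('a \<Rightarrow> real) set" where
  "H_space \<Omega> =
     {u. u \<in> borel_measurable lborel \<and> (\<forall>x. x \<notin> \<Omega> \<longrightarrow> u x = 0) \<and>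
         integrable lborel (\<lambda>x. (u x)\<^sup>2) \<and>
         integrable (lborel \<Otimes>\<^sub>M lborel) (\<lambda>(x, y). (u x - u y)\<^sup>2 * kernel_k (x - y))}"

definition energy :: "('a::euclidean_space \<Rightarrow> real) \<Rightarrow> ('a \<Rightarrow> real) \<Rightarrow> real" where
  "energy u v = c_const DIM('a) / 2 *
     (LINT (x, y)|(lborel \<Otimes>\<^sub>M lborel). (u x - u y) * (v x - v y) * kernel_k (x - y))"

definition H_norm :: "('a::euclidean_space \<Rightarrow> real) \<Rightarrow> real" where
  "H_norm u = sqrt (energy u u)"

definition energy_L :: "('a::euclidean_space \<Rightarrow> real) \<Rightarrow> ('a \<Rightarrow> real) \<Rightarrow> real" where
  "energy_L u v = energy u v
     - c_const DIM('a) * (LINT (x, y)|(lborel \<Otimes>\<^sub>M lborel). u x * v y * kernel_j (x - y))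
     + rho_const DIM('a) * (LINT x|lborel. u x * v x)"

definition fucik_spectrum :: "'a::euclidean_space set \<Rightarrow> (real \<times> real) set" where
  "fucik_spectrum \<Omega> =
     {(\<alpha>, \<beta>). \<exists>u \<in> H_space \<Omega>. \<not> (AE x in lborel. u x = 0) \<and>
        (\<forall>v \<in> H_space \<Omega>. energy_L u v =
           (LINT x:\<Omega>|lborel. (\<alpha> * max (u x) 0 - \<beta> * max (- u x) 0) * v x))}"

definition L2_sphere :: "'a::euclidean_space set \<Rightarrow> ('a \<Rightarrow> real) set" where
  "L2_sphere \<Omega> = {u \<in> H_space \<Omega>. (LINT x:\<Omega>|lborel. (u x)\<^sup>2) = 1}"

definition first_eigenvalue :: "'a::euclidean_space set \<Rightarrow> real" where
  "first_eigenvalue \<Omega> = (INF u \<in> L2_sphere \<Omega>. energy_L u u)"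

definition first_eigenfunction :: "'a::euclidean_space set \<Rightarrow> ('a \<Rightarrow> real) \<Rightarrow> bool" where
  "first_eigenfunction \<Omega> \<phi> \<longleftrightarrow>
     \<phi> \<in> L2_sphere \<Omega> \<and> (AE x in lborel. x \<in> \<Omega> \<longrightarrow> \<phi> x > 0) \<and>
     (\<forall>v \<in> H_space \<Omega>. energy_L \<phi> v =
        first_eigenvalue \<Omega> * (LINT x:\<Omega>|lborel. \<phi> x * v x))"

definition E_functional :: "'a::euclidean_space set \<Rightarrow> real \<Rightarrow> ('a \<Rightarrow> real) \<Rightarrow> real" where
  "E_functional \<Omega> r u = energy_L u u - r * (LINT x:\<Omega>|lborel. (max (u x) 0)\<^sup>2)"

text \<open>
  Continuity of a path refers to the norm of \<open>\<bbbH>(\<Omega>)\<close>; it is spelled out because on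
  representatives this norm is only a seminorm.
\<close>

definition admissible_paths ::
    "'a::euclidean_space set \<Rightarrow> ('a \<Rightarrow> real) \<Rightarrow> (real \<Rightarrow> 'a \<Rightarrow> real) set" where
  "admissible_paths \<Omega> \<phi> =
     {p. (\<forall>t \<in> {-1..1}. p t \<in> L2_sphere \<Omega>) \<and>
         (\<forall>s \<in> {-1..1}. ((\<lambda>t. H_norm (\<lambda>x. p t x - p s x)) \<longlongrightarrow> 0) (at s within {-1..1})) \<and>
         (AE x in lborel. p (-1) x = - \<phi> x) \<and>
         (AE x in lborel. p 1 x = \<phi> x)}"

text \<open>
  The inner supremum is a maximum, as \<open>E_functional \<Omega> r\<close> is continuous along a path.
\<close>

definition minimax_level :: "'a::euclidean_space set \<Rightarrow> ('a \<Rightarrow> real) \<Rightarrow> real \<Rightarrow> real" where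
  "minimax_level \<Omega> \<phi> r =
     (INF p \<in> admissible_paths \<Omega> \<phi>. SUP u \<in> p ` {-1..1}. E_functional \<Omega> r u)"

end

theory Submission imports Defs "HOL-Complex_Analysis.Great_Picard" begin

text \<open>
  Write \<open>J\<close> for the functional \<open>E_functional \<Omega> r\<close>, \<open>c\<close> for its minimax level and \<open>\<phi>\<close> for the
  positive eigenfunction. A point \<open>u\<close> of the \<open>L\<^sup>2\<close> sphere is a constrained critical point of \<open>J\<close> at
  level \<open>c\<close> exactly if \<open>\<E>\<^sub>L(u, v) = r \<integral> u\<^sup>+ v + c \<integral> u v\<close> for all \<open>v\<close>, and as
  \<open>u = u\<^sup>+ - u\<^sup>-\<close> this is the Fucik equation with parameters \<open>(r + c, c)\<close>. So the task is to find a critical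
  point at level \<open>c\<close>.

  The deformation along a pseudo-gradient flow can be replaced by one explicit gradient step. The
  quadratic part of \<open>J\<close> is the square of the norm of \<open>\<bbbH>(\<Omega>)\<close> plus an \<open>L\<^sup>2\<close>-bounded form, and
  \<open>- r \<integral> (u\<^sup>+)\<^sup>2\<close> is concave because \<open>r \<ge> 0\<close>. Hence for a fixed step length \<open>s\<close> the map \<open>\<eta>\<close> that
  subtracts \<open>s\<close> times the gradient and projects back to the sphere decreases \<open>J\<close> by at least \<open>s\<close>
  times the squared norm of the gradient, divided by the square of the \<open>L\<^sup>2\<close> norm that the projection
  scales to \<open>1\<close> (\<open>J_descent_map\<close>). The map is continuous and it fixes
  critical points. Both \<open>\<phi>\<close> and \<open>- \<phi>\<close> are critical (\<open>eigenfunction_critical\<close>), so \<open>\<eta>\<close> maps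
  admissible paths to admissible paths (\<open>descent_map_path\<close>): the descent need not be switched off near
  the endpoints, even if \<open>c\<close> equals the value of \<open>J\<close> at one of them.

  If the maximum of \<open>J\<close> along a path \<open>p\<close> is less than \<open>c + \<epsilon>\<close>, then \<open>J\<close> exceeds \<open>c - \<epsilon>\<close> somewhere on
  the path \<open>\<eta> \<circ> p\<close>. At the corresponding point \<open>u\<close> of \<open>p\<close>, \<open>J(u)\<close> is within \<open>\<epsilon>\<close> of \<open>c\<close> and the step gained less than
  \<open>2 \<epsilon>\<close>, so that the gradient is small (\<open>almost_critical_point\<close>). A sequence of such points is bounded
  in \<open>\<bbbH>(\<Omega>)\<close>; a weak limit is a limit in \<open>L\<^sup>2\<close> by compactness and solves the equation
  (\<open>critical_point_at_level\<close>).

  This rests on the following facts about \<open>\<bbbH>(\<Omega>)\<close>. It is complete (\<open>H_complete\<close>), so that Riesz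
  representation provides gradients, and bounded sequences have weakly convergent subsequences. The
  \<open>L\<^sup>2\<close> norm is controlled by the energy (\<open>Poincare\<close>), because the kernel is at least \<open>1\<close> on the
  punctured unit ball and a fixed number of equal translations of length at least \<open>1/2\<close> moves \<open>\<Omega>\<close> off itself. The embedding into
  \<open>L\<^sup>2\<close> is compact (\<open>compact_embedding\<close>), because \<open>|z|\<^sup>-\<^sup>N\<close> is not integrable at the origin: truncating
  the kernel near the origin gives bounded kernels of arbitrarily large mass. Finally there is an
  element of \<open>\<bbbH>(\<Omega>)\<close> linearly independent of \<open>\<phi>\<close>, around which \<open>- \<phi>\<close> can be joined to \<open>\<phi>\<close>; without it
  the infimum defining \<open>c\<close> would be over the empty set.
\<close>

section \<open>Semi-inner product spaces of functions\<close>

text \<open>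
  Functions that agree almost everywhere are not identified, so the forms at hand are only
  positive semidefinite. Everything below is about values of the form, never about
  equality of vectors, and therefore holds without passing to a quotient.
\<close>

locale semi_inner_space =
  fixes S :: "('b \<Rightarrow> real) set" and B :: "('b \<Rightarrow> real) \<Rightarrow> ('b \<Rightarrow> real) \<Rightarrow> real"
  assumes zero_mem: "(\<lambda>x. 0) \<in> S"
    and lincomb_mem: "\<And>u v a b. u \<in> S \<Longrightarrow> v \<in> S \<Longrightarrow> (\<lambda>x. a * u x + b * v x) \<in> S"
    and sym: "\<And>u v. u \<in> S \<Longrightarrow> v \<in> S \<Longrightarrow> B u v = B v u"
    and lincomb_left: "\<And>u v w a b. u \<in> S \<Longrightarrow> v \<in> S \<Longrightarrow> w \<in> S \<Longrightarrow>
      B (\<lambda>x. a * u x + b * v x) w = a * B u w + b * B v w"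
    and nonneg: "\<And>u. u \<in> S \<Longrightarrow> 0 \<le> B u u"
begin

definition nrm :: "('b \<Rightarrow> real) \<Rightarrow> real" where
  "nrm u = sqrt (B u u)"

lemma diff_mem: "u \<in> S \<Longrightarrow> v \<in> S \<Longrightarrow> (\<lambda>x. u x - v x) \<in> S"
  using lincomb_mem[of u v 1 "-1"] by simp

lemma scale_mem: "u \<in> S \<Longrightarrow> (\<lambda>x. a * u x) \<in> S"
  using lincomb_mem[of u u a 0] by simp

lemma lincomb_right:
  "u \<in> S \<Longrightarrow> v \<in> S \<Longrightarrow> w \<in> S \<Longrightarrow> B w (\<lambda>x. a * u x + b * v x) = a * B w u + b * B w v"
  using lincomb_left[of u v w a b] sym lincomb_mem[of u v a b] by simp

lemma diff_left: "u \<in> S \<Longrightarrow> v \<in> S \<Longrightarrow> w \<in> S \<Longrightarrow> B (\<lambda>x. u x - v x) w = B u w - B v w"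
  using lincomb_left[of u v w 1 "-1"] by simp

lemma diff_right: "u \<in> S \<Longrightarrow> v \<in> S \<Longrightarrow> w \<in> S \<Longrightarrow> B w (\<lambda>x. u x - v x) = B w u - B w v"
  using lincomb_right[of u v w 1 "-1"] by simp

lemma scale_left: "u \<in> S \<Longrightarrow> w \<in> S \<Longrightarrow> B (\<lambda>x. a * u x) w = a * B u w"
  using lincomb_left[of u u w a 0] by simp

lemma lincomb_square:
  assumes "u \<in> S" "v \<in> S"
  shows "B (\<lambda>x. a * u x + b * v x) (\<lambda>x. a * u x + b * v x)
    = a\<^sup>2 * B u u + 2 * a * b * B u v + b\<^sup>2 * B v v"
  using assms lincomb_mem[OF assms, of a b] sym[OF assms]
  by (simp add: lincomb_left lincomb_right power2_eq_square algebra_simps)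

lemma diff_square:
  "u \<in> S \<Longrightarrow> v \<in> S \<Longrightarrow> B (\<lambda>x. u x - v x) (\<lambda>x. u x - v x) = B u u - 2 * B u v + B v v"
  using lincomb_square[of u v 1 "-1"] by simp

lemma nrm_nonneg: "u \<in> S \<Longrightarrow> 0 \<le> nrm u"
  by (simp add: nrm_def nonneg)

lemma nrm_square: "u \<in> S \<Longrightarrow> (nrm u)\<^sup>2 = B u u"
  by (simp add: nrm_def nonneg)

text \<open>
  As \<open>B v v\<close> may vanish for nonzero \<open>v\<close>, this degenerate case is separate: there the polynomial
  \<open>t \<mapsto> B (u + t v) (u + t v)\<close> is affine and bounded below, hence constant.
\<close>

lemma Cauchy_Schwarz:
  assumes "u \<in> S" "v \<in> S"
  shows "\<bar>B u v\<bar> \<le> nrm u * nrm v"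
proof -
  have q: "0 \<le> B u u + 2 * t * B u v + t\<^sup>2 * B v v" for t
    using nonneg[OF lincomb_mem[OF assms, of 1 t]] lincomb_square[OF assms, of 1 t] by simp
  have "(B u v)\<^sup>2 \<le> B u u * B v v"
  proof (cases "B v v = 0")
    case True
    have "B u v = 0"
    proof (rule ccontr)
      assume "B u v \<noteq> 0"
      then show False
        using q[of "- (B u u + 1) / (2 * B u v)"] True nonneg[OF assms(1)] by (simp add: field_simps)
    qed
    then show ?thesis using True by simp
  next
    case False
    then have "B v v > 0" using nonneg[OF assms(2)] by simp
    moreover have "0 \<le> B v v * (B u u + 2 * (- B u v / B v v) * B u v + (- B u v / B v v)\<^sup>2 * B v v)"
      using q[of "- B u v / B v v"] nonneg[OF assms(2)] by simp
    ultimately show ?thesis by (simp add: field_simps power2_eq_square)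
  qed
  then have "sqrt ((B u v)\<^sup>2) \<le> sqrt (B u u * B v v)" by (rule real_sqrt_le_mono)
  then show ?thesis by (simp add: nrm_def real_sqrt_mult)
qed

lemma nrm_lincomb_le:
  assumes "u \<in> S" "v \<in> S"
  shows "nrm (\<lambda>x. a * u x + b * v x) \<le> \<bar>a\<bar> * nrm u + \<bar>b\<bar> * nrm v"
proof -
  have "a * b * B u v \<le> \<bar>a\<bar> * \<bar>b\<bar> * (nrm u * nrm v)"
  proof -
    have "a * b * B u v \<le> \<bar>a * b\<bar> * \<bar>B u v\<bar>" by (simp add: abs_mult[symmetric])
    also have "\<dots> \<le> \<bar>a * b\<bar> * (nrm u * nrm v)"
      using Cauchy_Schwarz[OF assms] by (intro mult_left_mono) auto
    finally show ?thesis by (simp add: abs_mult)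
  qed
  then have "(nrm (\<lambda>x. a * u x + b * v x))\<^sup>2 \<le> (\<bar>a\<bar> * nrm u + \<bar>b\<bar> * nrm v)\<^sup>2"
    using assms lincomb_mem[OF assms, of a b]
    by (simp add: nrm_square lincomb_square power2_sum power_mult_distrib algebra_simps)
  then show ?thesis
    by (rule power2_le_imp_le) (simp add: nrm_nonneg assms)
qed

lemma nrm_scale: "u \<in> S \<Longrightarrow> nrm (\<lambda>x. a * u x) = \<bar>a\<bar> * nrm u"
  using lincomb_square[of u u a 0] by (simp add: nrm_def real_sqrt_mult)

lemma nrm_commute: "u \<in> S \<Longrightarrow> v \<in> S \<Longrightarrow> nrm (\<lambda>x. u x - v x) = nrm (\<lambda>x. v x - u x)"
  using nrm_scale[OF diff_mem, of u v "-1"] by simp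

lemma nrm_diff_le:
  assumes "u \<in> S" "v \<in> S"
  shows "\<bar>nrm u - nrm v\<bar> \<le> nrm (\<lambda>x. u x - v x)"
proof -
  have "nrm u \<le> nrm (\<lambda>x. u x - v x) + nrm v"
    using nrm_lincomb_le[OF diff_mem[OF assms] assms(2), of 1 1] by simp
  moreover have "nrm v \<le> nrm (\<lambda>x. v x - u x) + nrm u"
    using nrm_lincomb_le[OF diff_mem[OF assms(2,1)] assms(1), of 1 1] by simp
  ultimately show ?thesis using nrm_commute[OF assms] by linarith
qed

lemma tendsto_left:
  assumes "\<And>n. X n \<in> S" "u \<in> S" "v \<in> S" "((\<lambda>n. nrm (\<lambda>x. X n x - u x)) \<longlongrightarrow> 0) F"
  shows "((\<lambda>n. B (X n) v) \<longlongrightarrow> B u v) F"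
proof -
  have "((\<lambda>n. nrm (\<lambda>x. X n x - u x) * nrm v) \<longlongrightarrow> 0) F"
    using tendsto_mult_right[OF assms(4), of "nrm v"] by simp
  moreover have "norm (B (X n) v - B u v) \<le> nrm (\<lambda>x. X n x - u x) * nrm v" for n
    using Cauchy_Schwarz[OF diff_mem[OF assms(1)[of n] assms(2)] assms(3)]
      diff_left[OF assms(1)[of n] assms(2,3)] by simp
  ultimately have "((\<lambda>n. B (X n) v - B u v) \<longlongrightarrow> 0) F"
    by (intro Lim_null_comparison[of "\<lambda>n. B (X n) v - B u v" "\<lambda>n. nrm (\<lambda>x. X n x - u x) * nrm v"])
      auto
  then show ?thesis by (simp add: LIM_zero_iff)
qed

definition complete_space :: bool where
  "complete_space \<longleftrightarrow> (\<forall>X. (\<forall>n. X n \<in> S) \<longrightarrow>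
     (\<forall>e>0. \<exists>M. \<forall>m\<ge>M. \<forall>n\<ge>M. nrm (\<lambda>x. X m x - X n x) < e) \<longrightarrow>
     (\<exists>u\<in>S. (\<lambda>n. nrm (\<lambda>x. X n x - u x)) \<longlonglongrightarrow> 0))"

text \<open>
  The representing vector minimises \<open>B v v - 2 * l v\<close>. By the parallelogram law a minimising
  sequence is Cauchy; the equation is the vanishing of the first variation at the limit.
\<close>

lemma Riesz_representation:
  assumes "complete_space"
    and lin: "\<And>u v a b. u \<in> S \<Longrightarrow> v \<in> S \<Longrightarrow> l (\<lambda>x. a * u x + b * v x) = a * l u + b * l v"
    and bound: "\<And>u. u \<in> S \<Longrightarrow> \<bar>l u\<bar> \<le> K * nrm u"
  shows "\<exists>g\<in>S. \<forall>v\<in>S. B g v = l v"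
proof -
  define F where "F v = B v v - 2 * l v" for v
  define m where "m = (INF v\<in>S. F v)"
  have bdd: "bdd_below (F ` S)"
  proof (rule bdd_belowI2[of _ "- K\<^sup>2"])
    fix v assume v: "v \<in> S"
    have "0 \<le> (nrm v - K)\<^sup>2" by simp
    then show "- K\<^sup>2 \<le> F v"
      using bound[OF v] nrm_square[OF v] by (simp add: F_def power2_diff algebra_simps)
  qed
  have mF: "m \<le> F v" if "v \<in> S" for v
    unfolding m_def using bdd that by (rule cINF_lower)
  have "\<exists>v\<in>S. F v < m + inverse (real (Suc n))" for n
  proof -
    have "Inf (F ` S) < m + inverse (real (Suc n))" unfolding m_def by simp
    then show ?thesis using zero_mem cInf_lessD[of "F ` S"] by blast
  qed
  then obtain V where V: "\<And>n. V n \<in> S" "\<And>n. F (V n) < m + inverse (real (Suc n))"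
    by metis
  have par: "(nrm (\<lambda>x. V i x - V k x))\<^sup>2 \<le> 2 * inverse (real (Suc i)) + 2 * inverse (real (Suc k))" for i k
  proof -
    have mid: "(\<lambda>x. 1/2 * V i x + 1/2 * V k x) \<in> S" using V by (intro lincomb_mem)
    have "4 * F (\<lambda>x. 1/2 * V i x + 1/2 * V k x)
        = B (V i) (V i) + 2 * B (V i) (V k) + B (V k) (V k) - 4 * l (V i) - 4 * l (V k)"
      unfolding F_def lincomb_square[OF V(1) V(1)] lin[OF V(1) V(1)] by (simp add: power2_eq_square)
    moreover have "(nrm (\<lambda>x. V i x - V k x))\<^sup>2
        = B (V i) (V i) - 2 * B (V i) (V k) + B (V k) (V k)"
      using nrm_square[OF diff_mem[OF V(1) V(1)]] diff_square[OF V(1) V(1)] by simp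
    \<comment> \<open>the parallelogram law: the linear parts cancel, as the midpoint is affine in both vectors\<close>
    ultimately have "(nrm (\<lambda>x. V i x - V k x))\<^sup>2
        = 2 * F (V i) + 2 * F (V k) - 4 * F (\<lambda>x. 1/2 * V i x + 1/2 * V k x)"
      by (simp add: F_def)
    then show ?thesis using V(2)[of i] V(2)[of k] mF[OF mid] by linarith
  qed
  have "\<exists>g\<in>S. (\<lambda>n. nrm (\<lambda>x. V n x - g x)) \<longlonglongrightarrow> 0"
  proof (rule assms(1)[unfolded complete_space_def, rule_format])
    fix e :: real assume e: "e > 0"
    obtain M where M: "inverse (real (Suc M)) < e\<^sup>2 / 4"
      using reals_Archimedean[of "e\<^sup>2 / 4"] e by auto
    have "nrm (\<lambda>x. V i x - V k x) < e" if "i \<ge> M" "k \<ge> M" for i k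
    proof -
      have "inverse (real (Suc i)) \<le> inverse (real (Suc M))"
        "inverse (real (Suc k)) \<le> inverse (real (Suc M))" using that by (auto intro!: le_imp_inverse_le)
      then have "(nrm (\<lambda>x. V i x - V k x))\<^sup>2 < e\<^sup>2" using par[of i k] M by linarith
      then show ?thesis by (rule power2_less_imp_less) (use e in simp)
    qed
    then show "\<exists>M. \<forall>m\<ge>M. \<forall>n\<ge>M. nrm (\<lambda>x. V m x - V n x) < e" by blast
  qed (use V in auto)
  then obtain g where g: "g \<in> S" "(\<lambda>n. nrm (\<lambda>x. V n x - g x)) \<longlonglongrightarrow> 0" by blast
  have "B g v = l v" if v: "v \<in> S" for v
  proof -
    \<comment> \<open>passing to the limit in the almost minimality of \<open>V n\<close>, so that no continuity of \<open>F\<close> is needed\<close>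
    have q: "0 \<le> 2 * t * (B g v - l v) + t\<^sup>2 * B v v" for t
    proof -
      have "- inverse (real (Suc n)) \<le> 2 * t * (B (V n) v - l v) + t\<^sup>2 * B v v" for n
      proof -
        have "F (\<lambda>x. 1 * V n x + t * v x) = F (V n) + 2 * t * (B (V n) v - l v) + t\<^sup>2 * B v v"
          unfolding F_def lincomb_square[OF V(1) v] lin[OF V(1) v] by (simp add: algebra_simps)
        then show ?thesis using mF[OF lincomb_mem[OF V(1)[of n] v, of 1 t]] V(2)[of n] by linarith
      qed
      moreover have "(\<lambda>n. - inverse (real (Suc n))) \<longlonglongrightarrow> - 0"
        by (intro tendsto_minus LIMSEQ_inverse_real_of_nat)
      moreover have "(\<lambda>n. 2 * t * (B (V n) v - l v) + t\<^sup>2 * B v v)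
          \<longlonglongrightarrow> 2 * t * (B g v - l v) + t\<^sup>2 * B v v"
        by (intro tendsto_intros tendsto_left V g v)
      ultimately show ?thesis using LIMSEQ_le[of "\<lambda>n. - inverse (real (Suc n))" "- 0"] by auto
    qed
    show ?thesis
    proof (rule ccontr)
      define d where "d = B g v - l v"
      assume "B g v \<noteq> l v"
      then have "d\<^sup>2 > 0" by (simp add: d_def)
      \<comment> \<open>the choice \<open>t = - d / s\<close> makes the linear term dominate, and \<open>s > 0\<close> even if \<open>B v v = 0\<close>\<close>
      define s where "s = B v v + 1"
      have s: "s > 0" using nonneg[OF v] by (simp add: s_def)
      have "0 \<le> 2 * (- d / s) * d + (- d / s)\<^sup>2 * (s - 1)"
        using q[of "- d / s"] by (simp add: d_def s_def)
      then have "0 \<le> s\<^sup>2 * (2 * (- d / s) * d + (- d / s)\<^sup>2 * (s - 1))" by simp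
      also have "\<dots> = - (d\<^sup>2 * (s + 1))" using s by (simp add: field_simps power2_eq_square)
      finally have "d\<^sup>2 * (s + 1) \<le> 0" by simp
      moreover have "0 < d\<^sup>2 * (s + 1)" using s \<open>d\<^sup>2 > 0\<close> by simp
      ultimately show False by simp
    qed
  qed
  then show ?thesis using g(1) by blast
qed

lemma subspace:
  assumes "V \<subseteq> S" "(\<lambda>x. 0) \<in> V"
    and "\<And>u v a b. u \<in> V \<Longrightarrow> v \<in> V \<Longrightarrow> (\<lambda>x. a * u x + b * v x) \<in> V"
  shows "semi_inner_space V B"
proof
  show "B u v = B v u" if "u \<in> V" "v \<in> V" for u v
    using that assms(1) by (intro sym) auto
  show "B (\<lambda>x. a * u x + b * v x) w = a * B u w + b * B v w" if "u \<in> V" "v \<in> V" "w \<in> V" for u v w a b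
    using that assms(1) by (intro lincomb_left) auto
  show "0 \<le> B u u" if "u \<in> V" for u
    using that assms(1) by (intro nonneg) auto
qed (fact assms)+

text \<open>
  A diagonal subsequence makes the products with all members of the sequence converge. The vectors
  whose products converge form a closed subspace \<open>V\<close> that contains the sequence; a general vector
  differs from its representative in \<open>V\<close> by a vector orthogonal to the sequence, so the products with
  it converge as well. The limit functional is bounded and is represented by the weak limit.
\<close>

lemma weak_compactness:
  assumes "complete_space" and X: "\<And>n. X n \<in> S" and bound: "\<And>n. nrm (X n) \<le> C"
  shows "\<exists>k u. strict_mono (k :: nat \<Rightarrow> nat) \<and> u \<in> S \<and> (\<forall>v\<in>S. (\<lambda>n. B (X (k n)) v) \<longlonglongrightarrow> B u v)"
proof -
  have C0: "0 \<le> C" using nrm_nonneg[OF X] bound order_trans by blast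
  have XB: "\<bar>B (X n) v\<bar> \<le> C * nrm v" if "v \<in> S" for n v
    using Cauchy_Schwarz[OF X that] mult_right_mono[OF bound nrm_nonneg[OF that]] order_trans by blast
  have XX: "\<bar>B (X n) (X i)\<bar> \<le> C * C" for n i
    using XB[OF X] mult_left_mono[OF bound C0] order_trans by blast
  have rX: "countable (range X)" by (rule countable_image[OF countableI_type])
  obtain k where k: "strict_mono (k :: nat \<Rightarrow> nat)"
    and kl: "\<And>x. x \<in> range X \<Longrightarrow> \<exists>l. (\<lambda>n. B (X (k n)) x) \<longlonglongrightarrow> l"
    by (rule function_convergent_subsequence[of "range X" "\<lambda>n x. B (X n) x" "C * C", OF rX])
      (use XX in auto)
  have kX: "convergent (\<lambda>n. B (X (k n)) (X m))" for m
    using kl[of "X m"] by (simp add: convergent_def)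
  define V where "V = {v\<in>S. convergent (\<lambda>n. B (X (k n)) v)}"
  interpret V: semi_inner_space V B
  proof (rule subspace)
    have "(\<lambda>n. B (X (k n)) (\<lambda>x. 0)) = (\<lambda>n. 0)"
      using lincomb_right[OF zero_mem zero_mem X, of _ 0 0] by (auto simp: fun_eq_iff)
    then show "(\<lambda>x. 0) \<in> V" by (simp add: V_def zero_mem convergent_const)
    fix u v a b assume "u \<in> V" "v \<in> V"
    then have uv: "u \<in> S" "v \<in> S"
      and "convergent (\<lambda>n. B (X (k n)) u)" "convergent (\<lambda>n. B (X (k n)) v)"
      by (simp_all add: V_def)
    then have "convergent (\<lambda>n. a * B (X (k n)) u + b * B (X (k n)) v)"
      by (intro convergent_add convergent_mult convergent_const)
    then show "(\<lambda>x. a * u x + b * v x) \<in> V"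
      by (simp add: V_def lincomb_right uv X lincomb_mem)
  qed (auto simp: V_def)
  have "V.complete_space" unfolding V.complete_space_def
  proof (intro allI impI)
    fix Y :: "nat \<Rightarrow> 'b \<Rightarrow> real" assume Y: "\<forall>n. Y n \<in> V"
      and Cau: "\<forall>e>0. \<exists>M. \<forall>m\<ge>M. \<forall>n\<ge>M. nrm (\<lambda>x. Y m x - Y n x) < e"
    have YS: "Y n \<in> S" for n using Y by (auto simp: V_def)
    then obtain u where u: "u \<in> S" "(\<lambda>n. nrm (\<lambda>x. Y n x - u x)) \<longlonglongrightarrow> 0"
      using assms(1) Cau unfolding complete_space_def by blast
    have "Cauchy (\<lambda>n. B (X (k n)) u)"
    proof (rule metric_CauchyI)
      fix e :: real assume e: "e > 0"
      define e' where "e' = e / (3 * (C + 1))"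
      have e': "e' > 0" using e C0 by (simp add: e'_def)
      have Ce': "C * e' \<le> e / 3"
      proof -
        have "C * e' \<le> (C + 1) * e'" using e' by simp
        also have "\<dots> = e / 3" using C0 by (simp add: e'_def divide_simps)
        finally show ?thesis .
      qed
      obtain m where "nrm (\<lambda>x. Y m x - u x) < e'"
        using LIMSEQ_D[OF u(2) e'] by (metis abs_le_iff order_refl real_norm_def diff_zero order_le_less_trans abs_ge_self)
      then have m: "C * nrm (\<lambda>x. Y m x - u x) \<le> e / 3"
        using Ce' mult_left_mono[OF less_imp_le C0] order_trans by blast
      have "Cauchy (\<lambda>n. B (X (k n)) (Y m))" using Y by (auto simp: V_def Cauchy_convergent_iff)
      then obtain M where M: "\<forall>i\<ge>M. \<forall>j\<ge>M. dist (B (X (k i)) (Y m)) (B (X (k j)) (Y m)) < e / 3"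
        using e unfolding Cauchy_def by (metis divide_pos_pos zero_less_numeral)
      have "dist (B (X (k i)) u) (B (X (k j)) u) < e" if "i \<ge> M" "j \<ge> M" for i j
      proof -
        have "\<bar>B (X (k i)) (Y m) - B (X (k i)) u\<bar> \<le> e / 3" for i
          using XB[OF diff_mem[OF YS[of m] u(1)], of "k i"] m
            diff_right[OF YS[of m] u(1) X[of "k i"]] by simp
        from this[of i] this[of j] M[rule_format, OF that] show ?thesis
          unfolding dist_real_def by linarith
      qed
      then show "\<exists>M. \<forall>m\<ge>M. \<forall>n\<ge>M. dist (B (X (k m)) u) (B (X (k n)) u) < e" by blast
    qed
    then have "u \<in> V" using u(1) by (auto simp: V_def Cauchy_convergent_iff)
    then show "\<exists>u\<in>V. (\<lambda>n. nrm (\<lambda>x. Y n x - u x)) \<longlonglongrightarrow> 0" using u(2) by blast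
  qed
  have conv: "convergent (\<lambda>n. B (X (k n)) v)" if v: "v \<in> S" for v
  proof -
    have "\<exists>p\<in>V. \<forall>w\<in>V. B p w = B v w"
      by (rule V.Riesz_representation[OF \<open>V.complete_space\<close>, of "B v" "nrm v"])
        (use v Cauchy_Schwarz lincomb_right in \<open>simp_all add: V_def\<close>)
    then obtain p where p: "p \<in> V" "\<forall>w\<in>V. B p w = B v w" by blast
    have "X m \<in> V" for m using X kX by (auto simp: V_def)
    then have "B (X (k n)) v = B (X (k n)) p" for n
      using p(2) sym X v p(1) by (metis (no_types, lifting) V_def mem_Collect_eq)
    then show ?thesis using p(1) by (auto simp: V_def)
  qed
  define l where "l v = lim (\<lambda>n. B (X (k n)) v)" for v
  have l: "(\<lambda>n. B (X (k n)) v) \<longlonglongrightarrow> l v" if "v \<in> S" for v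
    using conv[OF that] by (simp add: l_def convergent_LIMSEQ_iff)
  have "\<exists>u\<in>S. \<forall>v\<in>S. B u v = l v"
  proof (rule Riesz_representation[OF assms(1)])
    show "l (\<lambda>x. a * u x + b * v x) = a * l u + b * l v" if uv: "u \<in> S" "v \<in> S" for u v a b
    proof (rule LIMSEQ_unique[OF l[OF lincomb_mem[OF uv]]])
      show "(\<lambda>n. B (X (k n)) (\<lambda>x. a * u x + b * v x)) \<longlonglongrightarrow> a * l u + b * l v"
        unfolding lincomb_right[OF uv X] by (intro tendsto_intros l uv)
    qed
    show "\<bar>l u\<bar> \<le> C * nrm u" if "u \<in> S" for u
      using tendsto_rabs[OF l[OF that]] XB[OF that] by (intro LIMSEQ_le_const2[of _ "\<bar>l u\<bar>"]) auto
  qed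
  then show ?thesis using k l by metis
qed

end

section \<open>The energy space and the Lebesgue space\<close>

lemma integrable_mult_of_squares:
  fixes f g :: "'b \<Rightarrow> real"
  assumes [measurable]: "f \<in> borel_measurable M" "g \<in> borel_measurable M"
    and "integrable M (\<lambda>x. (f x)\<^sup>2)" "integrable M (\<lambda>x. (g x)\<^sup>2)"
  shows "integrable M (\<lambda>x. f x * g x)"
proof (rule Bochner_Integration.integrable_bound)
  show "integrable M (\<lambda>x. (f x)\<^sup>2 + (g x)\<^sup>2)" using assms by simp
  have "\<bar>a * b\<bar> \<le> a\<^sup>2 + b\<^sup>2" for a b :: real
  proof -
    have "2 * (\<bar>a\<bar> * \<bar>b\<bar>) \<le> a\<^sup>2 + b\<^sup>2" using sum_squares_bound[of "\<bar>a\<bar>" "\<bar>b\<bar>"] by (simp add: mult.assoc)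
    moreover have "0 \<le> \<bar>a\<bar> * \<bar>b\<bar>" by simp
    ultimately show ?thesis unfolding abs_mult by linarith
  qed
  then show "AE x in M. norm (f x * g x) \<le> norm ((f x)\<^sup>2 + (g x)\<^sup>2)" by simp
qed measurable

lemma integrable_square_lincomb:
  fixes f g :: "'b \<Rightarrow> real"
  assumes [measurable]: "f \<in> borel_measurable M" "g \<in> borel_measurable M"
    and "integrable M (\<lambda>x. (f x)\<^sup>2)" "integrable M (\<lambda>x. (g x)\<^sup>2)"
  shows "integrable M (\<lambda>x. (a * f x + b * g x)\<^sup>2)"
proof -
  have "(\<lambda>x. (a * f x + b * g x)\<^sup>2)
      = (\<lambda>x. a\<^sup>2 * (f x)\<^sup>2 + 2 * a * b * (f x * g x) + b\<^sup>2 * (g x)\<^sup>2)"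
    by (simp add: fun_eq_iff power2_eq_square algebra_simps)
  moreover have "integrable M \<dots>"
    using assms integrable_mult_of_squares[OF assms] by simp
  ultimately show ?thesis by simp
qed

lemma nn_integral_lborel_shift:
  fixes f :: "'a::euclidean_space \<Rightarrow> ennreal"
  assumes [measurable]: "f \<in> borel_measurable borel"
  shows "(\<integral>\<^sup>+x. f (a + x) \<partial>lborel) = (\<integral>\<^sup>+x. f x \<partial>lborel)"
proof -
  have "(\<integral>\<^sup>+x. f x \<partial>lborel) = (\<integral>\<^sup>+x. f x \<partial>distr lborel borel ((+) a))"
    by (simp add: lborel_distr_plus)
  also have "\<dots> = (\<integral>\<^sup>+x. f (a + x) \<partial>lborel)"
    by (rule nn_integral_distr) auto
  finally show ?thesis by simp
qed

lemma AE_lborel_pair: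
  fixes P :: "'a::euclidean_space \<Rightarrow> bool"
  assumes "AE x in lborel. P x"
  shows "AE (x, y) in lborel \<Otimes>\<^sub>M lborel. P x \<and> P y"
proof -
  obtain N where N': "{x \<in> space lborel. \<not> P x} \<subseteq> N" "emeasure lborel N = 0" "N \<in> sets lborel"
    using assms by (rule AE_E)
  then have N: "N \<in> null_sets lborel" "{x. \<not> P x} \<subseteq> N" by (auto intro: null_setsI)
  then have [measurable]: "N \<in> sets borel" by auto
  have "AE z in lborel \<Otimes>\<^sub>M lborel. fst z \<notin> N \<and> snd z \<notin> N"
  proof (rule lborel_pair.AE_pair_measure)
    show "AE x in lborel. AE y in lborel. fst (x, y) \<notin> N \<and> snd (x, y) \<notin> N"
      using AE_not_in[OF N(1)]
    proof eventually_elim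
      case (elim x)
      show ?case using AE_not_in[OF N(1)] by eventually_elim (use elim in simp)
    qed
  qed measurable
  then show ?thesis by eventually_elim (use N(2) in auto)
qed

text \<open>
  With the square root of the kernel as a weight, the energy of \<open>u\<close> and \<open>v\<close> becomes an \<open>L\<^sup>2\<close> product on
  the product space, of functions that depend linearly on \<open>u\<close> and \<open>v\<close>.
\<close>

definition weighted_diff :: "('a::euclidean_space \<Rightarrow> real) \<Rightarrow> 'a \<times> 'a \<Rightarrow> real" where
  "weighted_diff u = (\<lambda>(x, y). (u x - u y) * sqrt (kernel_k (x - y)))"

lemma kernel_measurable [measurable]:
  "(kernel_k :: 'a::euclidean_space \<Rightarrow> real) \<in> borel_measurable borel"
  "(kernel_j :: 'a \<Rightarrow> real) \<in> borel_measurable borel"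
proof -
  have [measurable]: "(\<lambda>x :: 'a. norm x powr - real DIM('a)) \<in> borel_measurable borel"
    by (intro powr_real_measurable borel_measurable_norm) auto
  have [measurable]: "ball (0::'a) 1 \<in> sets borel" by simp
  show "(kernel_k :: 'a \<Rightarrow> real) \<in> borel_measurable borel"
    "(kernel_j :: 'a \<Rightarrow> real) \<in> borel_measurable borel"
    unfolding kernel_k_def[abs_def] kernel_j_def[abs_def]
    by (intro borel_measurable_times borel_measurable_indicator; measurable)+
qed

lemma kernel_k_nonneg: "0 \<le> kernel_k z" by (simp add: kernel_k_def)

lemma weighted_diff_measurable [measurable]:
  assumes [measurable]: "u \<in> borel_measurable borel"
  shows "weighted_diff u \<in> borel_measurable (lborel \<Otimes>\<^sub>M lborel)"
  unfolding weighted_diff_def by measurable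

lemma weighted_diff_lincomb: "weighted_diff (\<lambda>x. a * u x + b * v x) = (\<lambda>z. a * weighted_diff u z + b * weighted_diff v z)"
  by (auto simp: weighted_diff_def algebra_simps fun_eq_iff)

lemma weighted_diff_square: "(\<lambda>z. (weighted_diff u z)\<^sup>2) = (\<lambda>(x, y). (u x - u y)\<^sup>2 * kernel_k (x - y))"
  by (auto simp: weighted_diff_def power_mult_distrib kernel_k_nonneg fun_eq_iff)

lemma H_space_iff:
  "u \<in> H_space \<Omega> \<longleftrightarrow> u \<in> borel_measurable borel \<and> (\<forall>x. x \<notin> \<Omega> \<longrightarrow> u x = 0) \<and>
     integrable lborel (\<lambda>x. (u x)\<^sup>2) \<and> integrable (lborel \<Otimes>\<^sub>M lborel) (\<lambda>z. (weighted_diff u z)\<^sup>2)"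
  unfolding H_space_def weighted_diff_square by auto

lemma energy_weighted_diff:
  fixes u v :: "'a::euclidean_space \<Rightarrow> real"
  shows "energy u v
    = c_const DIM('a) / 2 * (LINT z|(lborel \<Otimes>\<^sub>M lborel). weighted_diff u z * weighted_diff v z)"
proof -
  have "(\<lambda>z. weighted_diff u z * weighted_diff v z) = (\<lambda>(x, y). (u x - u y) * (v x - v y) * kernel_k (x - y))"
    by (auto simp: weighted_diff_def fun_eq_iff kernel_k_nonneg)
  then show ?thesis by (simp add: energy_def)
qed

lemma c_const_pos: "0 < c_const DIM('a::euclidean_space)"
  by (simp add: c_const_def Gamma_real_pos)

definition L2_space :: "'a::euclidean_space set \<Rightarrow> ('a \<Rightarrow> real) set" where
  "L2_space \<Omega> = {u. u \<in> borel_measurable borel \<and> (\<forall>x. x \<notin> \<Omega> \<longrightarrow> u x = 0) \<and>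
     integrable lborel (\<lambda>x. (u x)\<^sup>2)}"

definition ip :: "('a::euclidean_space \<Rightarrow> real) \<Rightarrow> ('a \<Rightarrow> real) \<Rightarrow> real" where
  "ip u v = (LINT x|lborel. u x * v x)"

lemma L2_spaceD:
  assumes "u \<in> L2_space \<Omega>"
  shows "u \<in> borel_measurable borel" "u \<in> borel_measurable lborel" "\<And>x. x \<notin> \<Omega> \<Longrightarrow> u x = 0"
    "integrable lborel (\<lambda>x. (u x)\<^sup>2)"
  using assms by (auto simp: L2_space_def)

lemma H_space_L2: "u \<in> H_space \<Omega> \<Longrightarrow> u \<in> L2_space \<Omega>"
  by (simp add: H_space_iff L2_space_def)

lemma H_spaceD:
  assumes "u \<in> H_space \<Omega>"
  shows "u \<in> borel_measurable borel" "\<And>x. x \<notin> \<Omega> \<Longrightarrow> u x = 0"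
    "integrable lborel (\<lambda>x. (u x)\<^sup>2)" "integrable (lborel \<Otimes>\<^sub>M lborel) (\<lambda>z. (weighted_diff u z)\<^sup>2)"
    "weighted_diff u \<in> borel_measurable (lborel \<Otimes>\<^sub>M lborel)"
  using assms by (auto simp: H_space_iff)

lemma L2_integrable_mult:
  "u \<in> L2_space \<Omega> \<Longrightarrow> v \<in> L2_space \<Omega> \<Longrightarrow> integrable lborel (\<lambda>x. u x * v x)"
  by (intro integrable_mult_of_squares) (auto dest: L2_spaceD)

lemma weighted_diff_integrable_mult:
  "u \<in> H_space \<Omega> \<Longrightarrow> v \<in> H_space \<Omega> \<Longrightarrow>
    integrable (lborel \<Otimes>\<^sub>M lborel) (\<lambda>z. weighted_diff u z * weighted_diff v z)"
  by (intro integrable_mult_of_squares) (auto dest: H_spaceD)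

interpretation L2: semi_inner_space "L2_space \<Omega>" ip for \<Omega> :: "'a::euclidean_space set"
proof
  show "(\<lambda>x. a * u x + b * v x) \<in> L2_space \<Omega>" if "u \<in> L2_space \<Omega>" "v \<in> L2_space \<Omega>"
    for u v :: "'a \<Rightarrow> real" and a b
    using that by (auto simp: L2_space_def intro!: integrable_square_lincomb)
  show "ip (\<lambda>x. a * u x + b * v x) w = a * ip u w + b * ip v w"
    if "u \<in> L2_space \<Omega>" "v \<in> L2_space \<Omega>" "w \<in> L2_space \<Omega>" for u v w :: "'a \<Rightarrow> real" and a b
  proof -
    have "ip (\<lambda>x. a * u x + b * v x) w = (LINT x|lborel. a * (u x * w x) + b * (v x * w x))"
      by (simp add: ip_def algebra_simps)
    also have "\<dots> = a * ip u w + b * ip v w"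
      using that by (simp add: ip_def L2_integrable_mult)
    finally show ?thesis .
  qed
qed (auto simp: L2_space_def ip_def mult.commute)

interpretation H: semi_inner_space "H_space \<Omega>" energy for \<Omega> :: "'a::euclidean_space set"
proof
  show "(\<lambda>x. a * u x + b * v x) \<in> H_space \<Omega>" if "u \<in> H_space \<Omega>" "v \<in> H_space \<Omega>"
    for u v :: "'a \<Rightarrow> real" and a b
    using that unfolding H_space_iff weighted_diff_lincomb by (auto intro!: integrable_square_lincomb)
  show "energy (\<lambda>x. a * u x + b * v x) w = a * energy u w + b * energy v w"
    if "u \<in> H_space \<Omega>" "v \<in> H_space \<Omega>" "w \<in> H_space \<Omega>" for u v w :: "'a \<Rightarrow> real" and a b
  proof -
    have "(LINT z|(lborel \<Otimes>\<^sub>M lborel). weighted_diff (\<lambda>x. a * u x + b * v x) z * weighted_diff w z)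
      = (LINT z|(lborel \<Otimes>\<^sub>M lborel). a * (weighted_diff u z * weighted_diff w z) + b * (weighted_diff v z * weighted_diff w z))"
      by (simp add: weighted_diff_lincomb algebra_simps)
    also have "\<dots> = a * (LINT z|(lborel \<Otimes>\<^sub>M lborel). weighted_diff u z * weighted_diff w z)
        + b * (LINT z|(lborel \<Otimes>\<^sub>M lborel). weighted_diff v z * weighted_diff w z)"
      using weighted_diff_integrable_mult[OF that(1,3)] weighted_diff_integrable_mult[OF that(2,3)] by simp
    finally show ?thesis by (simp add: energy_weighted_diff algebra_simps)
  qed
  show "energy u v = energy v u" for u v :: "'a \<Rightarrow> real"
    by (simp add: energy_weighted_diff mult.commute)
  show "0 \<le> energy u u" for u :: "'a \<Rightarrow> real"
    using c_const_pos[where 'a='a] by (auto simp: energy_weighted_diff)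
qed (auto simp: H_space_iff weighted_diff_def)

lemma H_norm_eq_nrm: "H_norm = H.nrm"
  by (simp add: H_norm_def H.nrm_def fun_eq_iff)

lemma nn_integral_weighted_diff:
  fixes u :: "'a::euclidean_space \<Rightarrow> real"
  assumes "u \<in> H_space \<Omega>"
  shows "(\<integral>\<^sup>+z. ennreal ((weighted_diff u z)\<^sup>2) \<partial>(lborel \<Otimes>\<^sub>M lborel))
    = ennreal (2 / c_const DIM('a) * energy u u)"
proof -
  have "2 / c_const DIM('a) * energy u u = (LINT z|(lborel \<Otimes>\<^sub>M lborel). (weighted_diff u z)\<^sup>2)"
    using c_const_pos[where 'a='a] by (simp add: energy_weighted_diff power2_eq_square)
  then show ?thesis using H_spaceD(4)[OF assms] by (simp add: nn_integral_eq_integral)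
qed

lemma nn_integral_square:
  assumes "u \<in> L2_space \<Omega>"
  shows "(\<integral>\<^sup>+x. ennreal ((u x)\<^sup>2) \<partial>lborel) = ennreal (ip u u)"
  using L2_spaceD(4)[OF assms] by (simp add: nn_integral_eq_integral ip_def power2_eq_square)

lemma H_spaceI:
  assumes "u \<in> borel_measurable borel" "\<And>x. x \<notin> \<Omega> \<Longrightarrow> u x = 0"
    and "(\<integral>\<^sup>+x. ennreal ((u x)\<^sup>2) \<partial>lborel) < \<infinity>"
    and "(\<integral>\<^sup>+z. ennreal ((weighted_diff u z)\<^sup>2) \<partial>(lborel \<Otimes>\<^sub>M lborel)) < \<infinity>"
  shows "u \<in> H_space \<Omega>"
  unfolding H_space_iff using assms by (auto intro!: integrableI_bounded)

section \<open>The Poincare inequality\<close>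

lemma nn_integral_difference_coordinates:
  fixes F :: "'a::euclidean_space \<times> 'a \<Rightarrow> ennreal"
  assumes [measurable]: "F \<in> borel_measurable (lborel \<Otimes>\<^sub>M lborel)"
  shows "(\<integral>\<^sup>+h. (\<integral>\<^sup>+x. F (x, x + h) \<partial>lborel) \<partial>lborel) = (\<integral>\<^sup>+z. F z \<partial>(lborel \<Otimes>\<^sub>M lborel))"
proof -
  have [measurable]: "F \<in> borel_measurable (borel \<Otimes>\<^sub>M borel)"
    using assms by (simp cong: measurable_cong_sets)
  have "(\<integral>\<^sup>+h. (\<integral>\<^sup>+x. F (x, x + h) \<partial>lborel) \<partial>lborel)
      = (\<integral>\<^sup>+x. (\<integral>\<^sup>+h. F (x, x + h) \<partial>lborel) \<partial>lborel)"
    using lborel_pair.Fubini[of "\<lambda>(x, h). F (x, x + h)"] by simp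
  also have "\<dots> = (\<integral>\<^sup>+x. (\<integral>\<^sup>+y. F (x, y) \<partial>lborel) \<partial>lborel)"
    by (intro nn_integral_cong nn_integral_lborel_shift) measurable
  also have "\<dots> = (\<integral>\<^sup>+z. F z \<partial>(lborel \<Otimes>\<^sub>M lborel))"
    by (rule lborel.nn_integral_fst) (rule assms)
  finally show ?thesis .
qed

lemma kernel_k_even: "kernel_k (- z) = kernel_k z"
  by (simp add: kernel_k_def indicator_def)

lemma kernel_j_even: "kernel_j (- z) = kernel_j z"
  by (simp add: kernel_j_def indicator_def)

text \<open>
  The kernel \<open>|z|\<^sup>-\<^sup>N\<close> is scale invariant: up to a factor \<open>2\<^sup>N\<close> it is constant on each dyadic shell, and
  its mass there is bounded below by a constant that does not depend on the shell. This
  replaces polar coordinates.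
\<close>

definition shell :: "nat \<Rightarrow> 'a::euclidean_space set" where
  "shell k = ball 0 ((1/2) ^ k) - ball 0 ((1/2) ^ Suc k)"

lemma shell_measurable [measurable]: "shell k \<in> sets borel"
  by (simp add: shell_def)

lemma emeasure_shell:
  "emeasure lborel (shell k :: 'a::euclidean_space set)
    = ennreal (unit_ball_vol (real DIM('a)) * (1 - (1/2) ^ DIM('a)) * ((1/2) ^ k) ^ DIM('a))"
proof -
  have "emeasure lborel (shell k :: 'a set)
      = emeasure lborel (ball (0::'a) ((1/2) ^ k)) - emeasure lborel (ball (0::'a) ((1/2) ^ Suc k))"
    unfolding shell_def 
    by (rule emeasure_Diff) (simp_all add: emeasure_ball subset_ball)
  also have "\<dots> = ennreal (unit_ball_vol (real DIM('a)) * ((1/2) ^ k) ^ DIM('a)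
      - unit_ball_vol (real DIM('a)) * ((1/2) ^ Suc k) ^ DIM('a))"
    by (subst (1 2) emeasure_ball) (auto intro!: ennreal_minus)
  also have "unit_ball_vol (real DIM('a)) * ((1/2) ^ k) ^ DIM('a)
      - unit_ball_vol (real DIM('a)) * ((1/2) ^ Suc k) ^ DIM('a)
      = unit_ball_vol (real DIM('a)) * (1 - (1/2) ^ DIM('a)) * ((1/2) ^ k) ^ DIM('a)"
    by (simp add: power_mult_distrib field_simps)
  finally show ?thesis .
qed

lemma shell_constant_pos: "0 < unit_ball_vol (real DIM('a::euclidean_space)) * (1 - (1/2) ^ DIM('a))"
proof -
  have "(1/2 :: real) ^ DIM('a) < 1" by (simp add: power_less_one_iff)
  then show ?thesis by simp
qed

lemma kernel_k_eq:
  fixes z :: "'a::euclidean_space"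
  assumes "z \<noteq> 0" "norm z < 1"
  shows "kernel_k z = (1 / norm z) ^ DIM('a)"
  using assms by (simp add: kernel_k_def powr_minus powr_realpow power_divide inverse_eq_divide)

lemma kernel_k_shell:
  fixes z :: "'a::euclidean_space"
  assumes "z \<in> shell k"
  shows "2 ^ (k * DIM('a)) \<le> kernel_k z" "kernel_k z \<le> 2 ^ (Suc k * DIM('a))"
proof -
  have z: "(1/2) ^ Suc k \<le> norm z" "norm z < (1/2) ^ k" using assms by (auto simp: shell_def)
  then have z0: "0 < norm z" using zero_less_power[of "1/2::real" "Suc k"] by linarith
  have "(1/2 :: real) ^ k \<le> 1" by (simp add: power_le_one)
  then have k: "kernel_k z = (1 / norm z) ^ DIM('a)" using z z0 by (intro kernel_k_eq) auto
  have "2 ^ k \<le> 1 / norm z" "1 / norm z \<le> 2 ^ Suc k"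
    using z z0 by (auto simp: field_simps power_divide)
  then show "2 ^ (k * DIM('a)) \<le> kernel_k z" "kernel_k z \<le> 2 ^ (Suc k * DIM('a))"
    unfolding k power_mult by (auto intro!: power_mono simp del: power_Suc)
qed

lemma translation_energy:
  fixes u :: "'a::euclidean_space \<Rightarrow> real"
  assumes [measurable]: "u \<in> borel_measurable borel"
  shows "(\<integral>\<^sup>+h. ennreal (kernel_k h) * (\<integral>\<^sup>+x. ennreal ((u x - u (x + h))\<^sup>2) \<partial>lborel) \<partial>lborel)
    = (\<integral>\<^sup>+z. ennreal ((weighted_diff u z)\<^sup>2) \<partial>(lborel \<Otimes>\<^sub>M lborel))"
proof -
  have "(\<integral>\<^sup>+h. ennreal (kernel_k h) * (\<integral>\<^sup>+x. ennreal ((u x - u (x + h))\<^sup>2) \<partial>lborel) \<partial>lborel)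
      = (\<integral>\<^sup>+h. (\<integral>\<^sup>+x. ennreal ((weighted_diff u (x, x + h))\<^sup>2) \<partial>lborel) \<partial>lborel)"
  proof (rule nn_integral_cong)
    fix h :: 'a
    have "ennreal (kernel_k h) * (\<integral>\<^sup>+x. ennreal ((u x - u (x + h))\<^sup>2) \<partial>lborel)
        = (\<integral>\<^sup>+x. ennreal (kernel_k h) * ennreal ((u x - u (x + h))\<^sup>2) \<partial>lborel)"
      by (rule nn_integral_cmult[symmetric]) measurable
    also have "\<dots> = (\<integral>\<^sup>+x. ennreal ((weighted_diff u (x, x + h))\<^sup>2) \<partial>lborel)"
      by (intro nn_integral_cong)
        (simp add: weighted_diff_def power_mult_distrib kernel_k_nonneg kernel_k_even ennreal_mult[symmetric] mult.commute)
    finally show "ennreal (kernel_k h) * (\<integral>\<^sup>+x. ennreal ((u x - u (x + h))\<^sup>2) \<partial>lborel)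
        = (\<integral>\<^sup>+x. ennreal ((weighted_diff u (x, x + h))\<^sup>2) \<partial>lborel)" .
  qed
  also have "\<dots> = (\<integral>\<^sup>+z. ennreal ((weighted_diff u z)\<^sup>2) \<partial>(lborel \<Otimes>\<^sub>M lborel))"
    using nn_integral_difference_coordinates[of "\<lambda>z. ennreal ((weighted_diff u z)\<^sup>2)"] by measurable
  finally show ?thesis .
qed

text \<open>
  Where \<open>u x\<close> is not zero, it is the sum of \<open>m\<close> increments along the segment from \<open>x\<close> to
  \<open>x + m h\<close>, where \<open>u\<close> vanishes. Each increment has the same \<open>L\<^sup>2\<close> norm by translation invariance.
\<close>

lemma nn_square_le_telescope:
  fixes u :: "'a::euclidean_space \<Rightarrow> real"
  assumes [measurable]: "u \<in> borel_measurable borel"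
    and zero: "\<And>x. u x = 0 \<or> u (x + real m *\<^sub>R h) = 0"
  shows "(\<integral>\<^sup>+x. ennreal ((u x)\<^sup>2) \<partial>lborel)
    \<le> ennreal ((real m)\<^sup>2) * (\<integral>\<^sup>+x. ennreal ((u x - u (x + h))\<^sup>2) \<partial>lborel)"
proof -
  define d where "d i x = u (x + real i *\<^sub>R h) - u (x + real (Suc i) *\<^sub>R h)" for i x
  have [measurable]: "d i \<in> borel_measurable borel" for i unfolding d_def by measurable
  have pt: "(u x)\<^sup>2 \<le> real m * (\<Sum>i<m. (d i x)\<^sup>2)" for x
  proof (cases "u x = 0")
    case True
    then show ?thesis by (auto intro!: mult_nonneg_nonneg sum_nonneg)
  next
    case False
    then have "u x = (\<Sum>i<m. d i x)"
      using zero[of x] unfolding d_def by (subst sum_lessThan_telescope'[of "\<lambda>i. u (x + real i *\<^sub>R h)"]) simp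
    then show ?thesis
      using sum_squared_le_sum_of_squares[of "\<lambda>i. d i x" "{..<m}"] by (simp add: mult.commute)
  qed
  have "(\<integral>\<^sup>+x. ennreal ((d i x)\<^sup>2) \<partial>lborel) = (\<integral>\<^sup>+x. ennreal ((u x - u (x + h))\<^sup>2) \<partial>lborel)" for i
  proof -
    have "(d i x)\<^sup>2 = (u (real i *\<^sub>R h + x) - u (real i *\<^sub>R h + x + h))\<^sup>2" for x
      by (simp add: d_def algebra_simps)
    then show ?thesis
      using nn_integral_lborel_shift[of "\<lambda>x. ennreal ((u x - u (x + h))\<^sup>2)" "real i *\<^sub>R h"] by simp
  qed
  note di = this
  have "(\<integral>\<^sup>+x. ennreal ((u x)\<^sup>2) \<partial>lborel) \<le> (\<integral>\<^sup>+x. ennreal (real m) * (\<Sum>i<m. ennreal ((d i x)\<^sup>2)) \<partial>lborel)"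
    using pt by (intro nn_integral_mono) (simp add: ennreal_mult[symmetric] sum_nonneg ennreal_leI)
  also have "\<dots> = ennreal (real m) * (\<Sum>i<m. \<integral>\<^sup>+x. ennreal ((d i x)\<^sup>2) \<partial>lborel)"
    by (subst nn_integral_cmult) (simp_all add: nn_integral_sum del: sum_ennreal)
  also have "\<dots> = ennreal ((real m)\<^sup>2) * (\<integral>\<^sup>+x. ennreal ((u x - u (x + h))\<^sup>2) \<partial>lborel)"
  proof -
    have "ennreal ((real m)\<^sup>2) = ennreal (real m) * ennreal (real m)"
      by (simp add: power2_eq_square ennreal_mult)
    then show ?thesis by (simp add: di mult.assoc ennreal_of_nat_eq_real_of_nat)
  qed
  finally show ?thesis .
qed

text \<open>
  Integrating the telescoping bound over all \<open>h\<close> with \<open>1/2 \<le> |h| < 1\<close>, where the kernel is at least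
  \<open>1\<close>, bounds the \<open>L\<^sup>2\<close> norm by the energy.
\<close>

lemma Poincare_nn:
  fixes \<Omega> :: "'a::euclidean_space set"
  assumes "bounded \<Omega>"
  shows "\<exists>C\<ge>0. \<forall>u. u \<in> borel_measurable borel \<longrightarrow> (\<forall>x. x \<notin> \<Omega> \<longrightarrow> u x = 0) \<longrightarrow>
    (\<integral>\<^sup>+x. ennreal ((u x)\<^sup>2) \<partial>lborel)
      \<le> ennreal C * (\<integral>\<^sup>+z. ennreal ((weighted_diff u z)\<^sup>2) \<partial>(lborel \<Otimes>\<^sub>M lborel))"
proof -
  obtain R where R: "\<And>x. x \<in> \<Omega> \<Longrightarrow> norm x < R"
    using assms by (meson bounded_pos_less)
  \<comment> \<open>\<open>m\<close> steps of length at least \<open>1/2\<close> cover the diameter \<open>2 R\<close> of a ball around \<open>\<Omega>\<close>\<close>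
  define m where "m = nat \<lceil>4 * R\<rceil>"
  have m: "4 * R \<le> real m" by (simp add: m_def) linarith
  define \<theta> where "\<theta> = unit_ball_vol (real DIM('a)) * (1 - (1/2) ^ DIM('a))"
  have \<theta>: "0 < \<theta>" "emeasure lborel (shell 0 :: 'a set) = ennreal \<theta>"
    using shell_constant_pos[where 'a='a] emeasure_shell[of 0, where 'a='a] by (simp_all add: \<theta>_def)
  have "(\<integral>\<^sup>+x. ennreal ((u x)\<^sup>2) \<partial>lborel)
      \<le> ennreal ((real m)\<^sup>2 / \<theta>) * (\<integral>\<^sup>+z. ennreal ((weighted_diff u z)\<^sup>2) \<partial>(lborel \<Otimes>\<^sub>M lborel))"
    if [measurable]: "u \<in> borel_measurable borel" and u0: "\<And>x. x \<notin> \<Omega> \<Longrightarrow> u x = 0" for u :: "'a \<Rightarrow> real"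
  proof -
    let ?N = "\<integral>\<^sup>+x. ennreal ((u x)\<^sup>2) \<partial>lborel"
    let ?D = "\<lambda>h. \<integral>\<^sup>+x. ennreal ((u x - u (x + h))\<^sup>2) \<partial>lborel"
    have [measurable]: "?D \<in> borel_measurable borel"
      using lborel.borel_measurable_nn_integral[of "\<lambda>h x. ennreal ((u x - u (x + h))\<^sup>2)" borel] by measurable
    have *: "?N \<le> ennreal ((real m)\<^sup>2) * ?D h" if h: "h \<in> shell 0" for h
    proof (rule nn_square_le_telescope)
      fix x
      show "u x = 0 \<or> u (x + real m *\<^sub>R h) = 0"
      proof (rule ccontr)
        assume "\<not> ?thesis"
        then have "norm x < R" "norm (x + real m *\<^sub>R h) < R" using u0 R by auto
        then have "norm (real m *\<^sub>R h) < 2 * R"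
          using norm_triangle_ineq4[of "x + real m *\<^sub>R h" x] by simp
        moreover have "real m * (1/2) \<le> real m * norm h"
          using h by (intro mult_left_mono) (auto simp: shell_def)
        ultimately show False using m by simp
      qed
    qed measurable
    have "?N * ennreal \<theta> = (\<integral>\<^sup>+h. ?N * indicator (shell 0 :: 'a set) h \<partial>lborel)"
      by (simp add: nn_integral_cmult_indicator \<theta>)
    also have "\<dots> \<le> (\<integral>\<^sup>+h. ennreal ((real m)\<^sup>2) * (ennreal (kernel_k h) * ?D h) \<partial>lborel)"
    proof (rule nn_integral_mono)
      fix h :: 'a
      show "?N * indicator (shell 0) h \<le> ennreal ((real m)\<^sup>2) * (ennreal (kernel_k h) * ?D h)"
      proof (cases "h \<in> shell 0")
        case True
        then have "1 \<le> kernel_k h" using kernel_k_shell(1)[of h 0] by simp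
        then have "1 * ?D h \<le> ennreal (kernel_k h) * ?D h"
          by (intro mult_right_mono) (auto simp: ennreal_ge_1)
        then have "ennreal ((real m)\<^sup>2) * ?D h \<le> ennreal ((real m)\<^sup>2) * (ennreal (kernel_k h) * ?D h)"
          by (intro mult_left_mono) auto
        then show ?thesis using *[OF True] True by (auto intro: order_trans)
      qed simp
    qed
    also have "\<dots> = ennreal ((real m)\<^sup>2) * (\<integral>\<^sup>+z. ennreal ((weighted_diff u z)\<^sup>2) \<partial>(lborel \<Otimes>\<^sub>M lborel))"
      by (subst nn_integral_cmult) (auto simp: translation_energy)
    finally have "?N * ennreal \<theta> * ennreal (1 / \<theta>)
      \<le> ennreal ((real m)\<^sup>2) * (\<integral>\<^sup>+z. ennreal ((weighted_diff u z)\<^sup>2) \<partial>(lborel \<Otimes>\<^sub>M lborel)) * ennreal (1 / \<theta>)"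
      by (rule mult_right_mono) simp
    moreover have "?N * ennreal \<theta> * ennreal (1 / \<theta>) = ?N"
      using \<theta>(1) by (simp add: mult.assoc ennreal_mult[symmetric])
    moreover have "ennreal ((real m)\<^sup>2 / \<theta>) = ennreal ((real m)\<^sup>2) * ennreal (1 / \<theta>)"
      using \<theta>(1) by (simp add: ennreal_mult[symmetric])
    ultimately show ?thesis by (simp add: ac_simps)
  qed
  moreover have "0 \<le> (real m)\<^sup>2 / \<theta>" using \<theta>(1) by simp
  ultimately show ?thesis by blast
qed

lemma Poincare:
  fixes \<Omega> :: "'a::euclidean_space set"
  assumes "bounded \<Omega>"
  shows "\<exists>K>0. \<forall>u\<in>H_space \<Omega>. L2.nrm u \<le> K * H.nrm u"
proof -
  obtain C where C: "0 \<le> C" and le: "\<And>u. u \<in> borel_measurable borel \<Longrightarrow> (\<And>x. x \<notin> \<Omega> \<Longrightarrow> u x = 0) \<Longrightarrow>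
    (\<integral>\<^sup>+x. ennreal ((u x)\<^sup>2) \<partial>lborel)
      \<le> ennreal C * (\<integral>\<^sup>+z. ennreal ((weighted_diff u z)\<^sup>2) \<partial>(lborel \<Otimes>\<^sub>M lborel))"
    using Poincare_nn[OF assms] by blast
  define K where "K = sqrt (C * (2 / c_const DIM('a))) + 1"
  have c: "0 < c_const DIM('a)" by (rule c_const_pos)
  have "L2.nrm u \<le> K * H.nrm u" if u: "u \<in> H_space \<Omega>" for u
  proof -
    have e: "0 \<le> energy u u" using H.nonneg[OF u] .
    have "ennreal (ip u u) \<le> ennreal C * ennreal (2 / c_const DIM('a) * energy u u)"
      using le[OF H_spaceD(1,2)[OF u]] by (simp add: nn_integral_weighted_diff[OF u] nn_integral_square[OF H_space_L2[OF u]])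
    also have "\<dots> = ennreal (C * (2 / c_const DIM('a)) * energy u u)"
      using C e c by (simp add: ennreal_mult[symmetric] mult.assoc)
    finally have "ip u u \<le> C * (2 / c_const DIM('a)) * energy u u"
      using C e c by (subst (asm) ennreal_le_iff) auto
    then have "L2.nrm u \<le> sqrt (C * (2 / c_const DIM('a))) * H.nrm u"
      unfolding L2.nrm_def H.nrm_def real_sqrt_mult[symmetric] by (rule real_sqrt_le_mono)
    also have "\<dots> \<le> K * H.nrm u"
      using H.nrm_nonneg[OF u] by (intro mult_right_mono) (auto simp: K_def)
    finally show ?thesis .
  qed
  moreover have "K > 0" using C c by (auto simp: K_def intro!: add_nonneg_pos)
  ultimately show ?thesis by blast
qed

section \<open>Completeness of the energy space\<close>

lemma Fatou_square:
  fixes f :: "nat \<Rightarrow> 'b \<Rightarrow> real"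
  assumes [measurable]: "\<And>i. f i \<in> borel_measurable M"
    and lim: "AE x in M. (\<lambda>i. f i x) \<longlonglongrightarrow> g x"
    and le: "\<And>i. i \<ge> n \<Longrightarrow> (\<integral>\<^sup>+x. ennreal ((f i x)\<^sup>2) \<partial>M) \<le> e"
  shows "(\<integral>\<^sup>+x. ennreal ((g x)\<^sup>2) \<partial>M) \<le> e"
proof -
  have "(\<integral>\<^sup>+x. ennreal ((g x)\<^sup>2) \<partial>M) = (\<integral>\<^sup>+x. liminf (\<lambda>i. ennreal ((f i x)\<^sup>2)) \<partial>M)"
  proof (rule nn_integral_cong_AE)
    show "AE x in M. ennreal ((g x)\<^sup>2) = liminf (\<lambda>i. ennreal ((f i x)\<^sup>2))"
      using lim
    proof eventually_elim
      case (elim x)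
      then have "(\<lambda>i. ennreal ((f i x)\<^sup>2)) \<longlonglongrightarrow> ennreal ((g x)\<^sup>2)"
        by (intro tendsto_ennrealI tendsto_power)
      then show ?case by (rule lim_imp_Liminf[OF sequentially_bot, symmetric])
    qed
  qed
  also have "\<dots> \<le> liminf (\<lambda>i. \<integral>\<^sup>+x. ennreal ((f i x)\<^sup>2) \<partial>M)"
    by (rule nn_integral_liminf) measurable
  also have "\<dots> \<le> limsup (\<lambda>i. \<integral>\<^sup>+x. ennreal ((f i x)\<^sup>2) \<partial>M)"
    by (rule Liminf_le_Limsup) simp
  also have "\<dots> \<le> e"
    using le by (intro Limsup_bounded) (auto simp: eventually_sequentially)
  finally show ?thesis .
qed

lemma abs_L2:
  assumes "u \<in> L2_space \<Omega>"
  shows "(\<lambda>x. \<bar>u x\<bar>) \<in> L2_space \<Omega>" "L2.nrm (\<lambda>x. \<bar>u x\<bar>) = L2.nrm u"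
  using assms by (auto simp: L2_space_def L2.nrm_def ip_def)

locale bounded_open_set =
  fixes \<Omega> :: "'a::euclidean_space set"
  assumes bounded: "bounded \<Omega>" and is_open: "open \<Omega>"
begin

lemma domain_measurable [measurable]: "\<Omega> \<in> sets borel"
  using is_open by simp

lemma finite_measure: "emeasure lborel \<Omega> < \<infinity>"
  using bounded by (rule emeasure_bounded_finite)

lemma indicator_L2: "indicat_real \<Omega> \<in> L2_space \<Omega>"
proof -
  have "(\<lambda>x. (indicat_real \<Omega> x)\<^sup>2) = indicat_real \<Omega>" by (auto simp: indicator_def)
  then show ?thesis using finite_measure by (auto simp: L2_space_def)
qed

lemma L2_integrable: "u \<in> L2_space \<Omega> \<Longrightarrow> integrable lborel u"
proof -
  assume u: "u \<in> L2_space \<Omega>"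
  then have "(\<lambda>x. u x * indicat_real \<Omega> x) = u" by (auto simp: indicator_def fun_eq_iff L2_spaceD(3))
  then show ?thesis using L2_integrable_mult[OF u indicator_L2] by simp
qed

lemma L1_le_L2:
  assumes u: "u \<in> L2_space \<Omega>"
  shows "(LINT x|lborel. \<bar>u x\<bar>) \<le> L2.nrm (indicat_real \<Omega>) * L2.nrm u"
proof -
  have "(\<lambda>x. \<bar>u x\<bar> * indicat_real \<Omega> x) = (\<lambda>x. \<bar>u x\<bar>)"
    using u by (auto simp: indicator_def fun_eq_iff L2_spaceD(3))
  then have "(LINT x|lborel. \<bar>u x\<bar>) = ip (\<lambda>x. \<bar>u x\<bar>) (indicat_real \<Omega>)" by (simp add: ip_def)
  then show ?thesis
    using L2.Cauchy_Schwarz[OF abs_L2(1)[OF u] indicator_L2] abs_L2(2)[OF u] by (simp add: mult.commute)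
qed

text \<open>
  The domain has finite measure, so the increments are summable in \<open>L\<^sup>1\<close> and hence pointwise
  almost everywhere.
\<close>

lemma fast_L2_Cauchy_converges_AE:
  assumes X: "\<And>i. X i \<in> L2_space \<Omega>"
    and fast: "\<And>i. L2.nrm (\<lambda>x. X (Suc i) x - X i x) \<le> (1/2) ^ i"
  shows "AE x in lborel. convergent (\<lambda>i. X i x)"
proof -
  note [measurable] = L2_spaceD(1)[OF X]
  define b where "b = L2.nrm (indicat_real \<Omega>)"
  have b: "0 \<le> b" by (simp add: b_def L2.nrm_nonneg[OF indicator_L2])
  have D: "(\<integral>\<^sup>+x. ennreal \<bar>X (Suc i) x - X i x\<bar> \<partial>lborel) \<le> ennreal (b * (1/2) ^ i)" for i
  proof -
    have m: "(\<lambda>x. X (Suc i) x - X i x) \<in> L2_space \<Omega>" by (rule L2.diff_mem[OF X X])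
    have "(\<integral>\<^sup>+x. ennreal \<bar>X (Suc i) x - X i x\<bar> \<partial>lborel) = ennreal (LINT x|lborel. \<bar>X (Suc i) x - X i x\<bar>)"
      by (rule nn_integral_eq_integral) (use L2_integrable[OF m] in auto)
    also have "\<dots> \<le> ennreal (b * (1/2) ^ i)"
      using L1_le_L2[OF m] mult_left_mono[OF fast b, of i] by (intro ennreal_leI) (simp add: b_def)
    finally show ?thesis .
  qed
  have "(\<integral>\<^sup>+x. (\<Sum>i. ennreal \<bar>X (Suc i) x - X i x\<bar>) \<partial>lborel)
      = (\<Sum>i. \<integral>\<^sup>+x. ennreal \<bar>X (Suc i) x - X i x\<bar> \<partial>lborel)"
    by (rule nn_integral_suminf) measurable
  also have "\<dots> \<le> (\<Sum>i. ennreal (b * (1/2) ^ i))"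
    using D by (intro suminf_le) auto
  also have "\<dots> = ennreal (\<Sum>i. b * (1/2) ^ i)"
    using b by (intro suminf_ennreal2 summable_mult summable_geometric) auto
  finally have "(\<integral>\<^sup>+x. (\<Sum>i. ennreal \<bar>X (Suc i) x - X i x\<bar>) \<partial>lborel) \<noteq> \<infinity>"
    by (auto simp: top_unique)
  then have "AE x in lborel. (\<Sum>i. ennreal \<bar>X (Suc i) x - X i x\<bar>) \<noteq> \<infinity>"
    by (rule nn_integral_PInf_AE[rotated]) measurable
  then show ?thesis
  proof eventually_elim
    case (elim x)
    then have "summable (\<lambda>i. \<bar>X (Suc i) x - X i x\<bar>)"
      by (intro summable_suminf_not_top) auto
    then have "summable (\<lambda>i. X (Suc i) x - X i x)" by (rule summable_rabs_cancel)
    then have "convergent (\<lambda>n. X n x - X 0 x)"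
      using sum_lessThan_telescope[of "\<lambda>i. X i x"] by (simp add: summable_iff_convergent)
    then have "convergent (\<lambda>n. (X n x - X 0 x) + X 0 x)"
      by (intro convergent_add convergent_const)
    then show ?case by simp
  qed
qed

text \<open>
  An energy Cauchy sequence is Cauchy in \<open>L\<^sup>2\<close> by the Poincare inequality, so a subsequence
  converges almost everywhere. Applied to the differences with a fixed member of the sequence, Fatou's lemma bounds
  both the \<open>L\<^sup>2\<close> norm and the energy of the error.
\<close>

lemma H_complete: "semi_inner_space.complete_space (H_space \<Omega>) energy"
  unfolding H.complete_space_def
proof (intro allI impI)
  fix X :: "nat \<Rightarrow> 'a \<Rightarrow> real"
  assume "\<forall>n. X n \<in> H_space \<Omega>"
    and Cau: "\<forall>e>0. \<exists>M. \<forall>m\<ge>M. \<forall>n\<ge>M. H.nrm (\<lambda>x. X m x - X n x) < e"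
  then have X: "\<And>n. X n \<in> H_space \<Omega>" by simp
  note [measurable] = H_spaceD(1)[OF X]
  define c where "c = c_const DIM('a)"
  have c: "0 < c" unfolding c_def by (rule c_const_pos)
  obtain K where K: "K > 0" "\<And>u. u \<in> H_space \<Omega> \<Longrightarrow> L2.nrm u \<le> K * H.nrm u"
    using Poincare[OF bounded] by blast
  have "\<exists>M. \<forall>m\<ge>M. \<forall>n\<ge>M. H.nrm (\<lambda>x. X m x - X n x) < (1/2) ^ i / K" for i :: nat
    using Cau K(1) by simp
  then obtain M where M: "\<And>i m n. m \<ge> M i \<Longrightarrow> n \<ge> M i \<Longrightarrow> H.nrm (\<lambda>x. X m x - X n x) < (1/2) ^ i / K"
    by metis
  \<comment> \<open>strictly increasing and beyond \<open>M i\<close>, although \<open>M\<close> need not be monotone\<close>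
  define k where "k i = i + (\<Sum>j\<le>i. M j)" for i
  have "M i \<le> (\<Sum>j\<le>i. M j)" for i by (rule member_le_sum) auto
  then have kM: "M i \<le> k i" "M i \<le> k (Suc i)" "i \<le> k i" for i
    by (simp_all add: k_def trans_le_add1 trans_le_add2 le_SucI)
  \<comment> \<open>on the null set of divergence the value is arbitrary, but still measurable; outside \<open>\<Omega>\<close> it is \<open>0\<close>\<close>
  define u where "u x = lim (\<lambda>i. X (k i) x)" for x
  have [measurable]: "u \<in> borel_measurable borel"
    unfolding u_def by measurable
  have u0: "u x = 0" if "x \<notin> \<Omega>" for x
    using H_spaceD(2)[OF X that] by (simp add: u_def)
  have "AE x in lborel. convergent (\<lambda>i. X (k i) x)"
  proof (rule fast_L2_Cauchy_converges_AE)
    fix i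
    have "L2.nrm (\<lambda>x. X (k (Suc i)) x - X (k i) x) \<le> K * H.nrm (\<lambda>x. X (k (Suc i)) x - X (k i) x)"
      by (intro K H.diff_mem X)
    also have "\<dots> \<le> K * ((1/2) ^ i / K)"
      using M[OF kM(2,1)] K(1) by (intro mult_left_mono less_imp_le) auto
    finally show "L2.nrm (\<lambda>x. X (k (Suc i)) x - X (k i) x) \<le> (1/2) ^ i" using K(1) by simp
  qed (rule H_space_L2[OF X])
  then have lim: "AE x in lborel. (\<lambda>i. X (k i) x) \<longlonglongrightarrow> u x"
    by eventually_elim (simp add: u_def convergent_LIMSEQ_iff)
  have main: "(\<lambda>x. u x - X n x) \<in> H_space \<Omega> \<and> H.nrm (\<lambda>x. u x - X n x) \<le> e"
    if e: "e > 0" and N: "\<forall>m\<ge>N. \<forall>n\<ge>N. H.nrm (\<lambda>x. X m x - X n x) < e" and n: "n \<ge> N" for e N n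
  proof -
    let ?f = "\<lambda>i x. X (k i) x - X n x"
    let ?w = "\<lambda>x. u x - X n x"
    have f: "?f i \<in> H_space \<Omega>" for i by (intro H.diff_mem X)
    have fe: "H.nrm (?f i) \<le> e" if "i \<ge> N" for i
      using N n that kM(3)[of i] by (meson less_imp_le order_trans)
    have fen: "energy (?f i) (?f i) \<le> e\<^sup>2" if "i \<ge> N" for i
      using H.nrm_square[OF f[of i]] power_mono[OF fe[OF that] H.nrm_nonneg[OF f], of 2] by simp
    have "(\<integral>\<^sup>+x. ennreal ((?w x)\<^sup>2) \<partial>lborel) \<le> ennreal ((K * e)\<^sup>2)"
    proof (rule Fatou_square)
      show "AE x in lborel. (\<lambda>i. ?f i x) \<longlonglongrightarrow> ?w x"
        using lim by eventually_elim (intro tendsto_intros)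
      fix i assume i: "i \<ge> N"
      have "L2.nrm (?f i) \<le> K * e"
        by (rule order_trans[OF K(2)[OF f] mult_left_mono[OF fe[OF i] less_imp_le[OF K(1)]]])
      then have "ip (?f i) (?f i) \<le> (K * e)\<^sup>2"
        using L2.nrm_square[OF H_space_L2[OF f[of i]]]
          power_mono[OF _ L2.nrm_nonneg[OF H_space_L2[OF f]], of i "K * e" 2] by simp
      then show "(\<integral>\<^sup>+x. ennreal ((?f i x)\<^sup>2) \<partial>lborel) \<le> ennreal ((K * e)\<^sup>2)"
        by (simp add: nn_integral_square[OF H_space_L2[OF f]] ennreal_leI)
    qed measurable
    moreover have we: "(\<integral>\<^sup>+z. ennreal ((weighted_diff ?w z)\<^sup>2) \<partial>(lborel \<Otimes>\<^sub>M lborel)) \<le> ennreal (2 / c * e\<^sup>2)"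
    proof (rule Fatou_square)
      show "AE z in lborel \<Otimes>\<^sub>M lborel. (\<lambda>i. weighted_diff (?f i) z) \<longlonglongrightarrow> weighted_diff ?w z"
        using AE_lborel_pair[OF lim] by eventually_elim (auto simp: weighted_diff_def intro!: tendsto_intros)
      fix i assume i: "i \<ge> N"
      show "(\<integral>\<^sup>+z. ennreal ((weighted_diff (?f i) z)\<^sup>2) \<partial>(lborel \<Otimes>\<^sub>M lborel)) \<le> ennreal (2 / c * e\<^sup>2)"
        unfolding nn_integral_weighted_diff[OF f] c_def[symmetric] using c
        by (intro ennreal_leI mult_left_mono fen[OF i]) auto
    qed measurable
    ultimately have w: "?w \<in> H_space \<Omega>"
      using u0 H_spaceD(2)[OF X] by (intro H_spaceI) (auto simp: le_less_trans[OF _ ennreal_less_top])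
    have "2 / c * energy ?w ?w \<le> 2 / c * e\<^sup>2"
      using we c unfolding nn_integral_weighted_diff[OF w] c_def[symmetric] by (subst (asm) ennreal_le_iff) auto
    then have "energy ?w ?w \<le> e\<^sup>2" using c by (simp add: field_simps)
    then have "H.nrm ?w \<le> e" unfolding H.nrm_def using e by (simp add: real_le_lsqrt)
    then show ?thesis using w by simp
  qed
  obtain N where N: "\<forall>m\<ge>N. \<forall>n\<ge>N. H.nrm (\<lambda>x. X m x - X n x) < 1"
    using Cau by (metis zero_less_one)
  have u: "u \<in> H_space \<Omega>"
    using H.lincomb_mem[OF conjunct1[OF main[OF zero_less_one N order_refl]] X[of N], of 1 1] by simp
  have "(\<lambda>n. H.nrm (\<lambda>x. X n x - u x)) \<longlonglongrightarrow> 0"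
  proof (rule LIMSEQ_I)
    fix e :: real assume "e > 0"
    then have e: "e / 2 > 0" by simp
    then obtain N where N: "\<forall>m\<ge>N. \<forall>n\<ge>N. H.nrm (\<lambda>x. X m x - X n x) < e / 2"
      using Cau by blast
    have "norm (H.nrm (\<lambda>x. X n x - u x) - 0) < e" if "n \<ge> N" for n
    proof -
      have "H.nrm (\<lambda>x. X n x - u x) \<le> e / 2"
        using main[OF e N that] H.nrm_commute[OF u X[of n]] by simp
      then show ?thesis using e H.nrm_nonneg[OF H.diff_mem[OF X u]] by (simp add: abs_of_nonneg)
    qed
    then show "\<exists>N. \<forall>n\<ge>N. norm (H.nrm (\<lambda>x. X n x - u x) - 0) < e" by blast
  qed
  then show "\<exists>u\<in>H_space \<Omega>. (\<lambda>n. H.nrm (\<lambda>x. X n x - u x)) \<longlonglongrightarrow> 0" using u by blast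
qed

end

section \<open>Compact embedding into the Lebesgue space\<close>

definition trunc_kernel :: "nat \<Rightarrow> 'a::euclidean_space \<Rightarrow> real" where
  "trunc_kernel m z = indicator (- ball 0 ((1/2) ^ m)) z * kernel_k z"

lemma trunc_kernel_measurable [measurable]: "trunc_kernel m \<in> borel_measurable borel"
proof -
  have [measurable]: "- ball (0::'a) ((1/2) ^ m) \<in> sets borel" by simp
  show ?thesis unfolding trunc_kernel_def by measurable
qed

lemma trunc_kernel_nonneg: "0 \<le> trunc_kernel m z"
  by (simp add: trunc_kernel_def kernel_k_nonneg)

lemma trunc_kernel_even: "trunc_kernel m (- z) = trunc_kernel m z"
  by (simp add: trunc_kernel_def kernel_k_even indicator_def)

lemma trunc_kernel_le: "trunc_kernel m z \<le> kernel_k z"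
  by (simp add: trunc_kernel_def kernel_k_nonneg indicator_def)

lemma trunc_kernel_bound: "trunc_kernel m (z :: 'a::euclidean_space) \<le> 2 ^ (m * DIM('a))"
proof (cases "(1/2) ^ m \<le> norm z \<and> norm z < 1")
  case True
  have z0: "0 < norm z" using True zero_less_power[of "1/2::real" m] by linarith
  have "1 / norm z \<le> 2 ^ m" using True z0 by (auto simp: field_simps power_divide)
  then have "(1 / norm z) ^ DIM('a) \<le> 2 ^ (m * DIM('a))"
    unfolding power_mult by (intro power_mono) auto
  then show ?thesis using True z0 kernel_k_eq[of z] by (simp add: trunc_kernel_def)
qed (auto simp: trunc_kernel_def kernel_k_def indicator_def)

lemma trunc_kernel_Suc:
  "trunc_kernel (Suc m) z = trunc_kernel m z + indicator (shell m) z * kernel_k z"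
proof -
  have "norm z < (1/2) ^ m" if "norm z < (1/2) ^ Suc m"
    using that by (rule less_le_trans) simp
  then show ?thesis by (auto simp: trunc_kernel_def shell_def indicator_def simp del: power_Suc)
qed

text \<open>
  Each further shell adds the same positive amount of mass: this is the divergence of the integral of
  \<open>|z|\<^sup>-\<^sup>N\<close> at the origin, on which compactness depends.
\<close>

lemma nn_trunc_kernel_ge:
  "(\<integral>\<^sup>+z. ennreal (trunc_kernel m (z :: 'a::euclidean_space)) \<partial>lborel)
    \<ge> ennreal (real m * (unit_ball_vol (real DIM('a)) * (1 - (1/2) ^ DIM('a))))"
proof (induction m)
  case (Suc m)
  let ?\<theta> = "unit_ball_vol (real DIM('a)) * (1 - (1/2) ^ DIM('a))"
  have \<theta>: "0 < ?\<theta>" by (rule shell_constant_pos)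
  have "ennreal ?\<theta> = ennreal (2 ^ (m * DIM('a))) * emeasure lborel (shell m :: 'a set)"
  proof -
    have "2 ^ (m * DIM('a)) * (?\<theta> * ((1/2) ^ m) ^ DIM('a)) = ?\<theta>"
      by (simp add: power_mult[symmetric] power_divide)
    then show ?thesis using \<theta> by (simp add: emeasure_shell ennreal_mult[symmetric] del: ennreal_power)
  qed
  also have "\<dots> = (\<integral>\<^sup>+z. ennreal (2 ^ (m * DIM('a))) * indicator (shell m :: 'a set) z \<partial>lborel)"
    by (simp add: nn_integral_cmult_indicator)
  also have "\<dots> \<le> (\<integral>\<^sup>+z. ennreal (indicator (shell m :: 'a set) z * kernel_k z) \<partial>lborel)"
    using kernel_k_shell(1) by (intro nn_integral_mono) (auto simp: indicator_def intro!: ennreal_leI)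
  finally have "ennreal (real m * ?\<theta>) + ennreal ?\<theta>
    \<le> (\<integral>\<^sup>+z. ennreal (trunc_kernel m (z :: 'a)) \<partial>lborel)
      + (\<integral>\<^sup>+z. ennreal (indicator (shell m :: 'a set) z * kernel_k z) \<partial>lborel)"
    using Suc.IH by (rule add_mono[rotated])
  also have "\<dots> = (\<integral>\<^sup>+z. ennreal (trunc_kernel m (z :: 'a)) + ennreal (indicator (shell m :: 'a set) z * kernel_k z) \<partial>lborel)"
    by (rule nn_integral_add[symmetric]) measurable
  also have "\<dots> = (\<integral>\<^sup>+z. ennreal (trunc_kernel (Suc m) (z :: 'a)) \<partial>lborel)"
    by (intro nn_integral_cong)
      (simp add: trunc_kernel_Suc trunc_kernel_nonneg kernel_k_nonneg ennreal_plus[symmetric] del: ennreal_plus)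
  also have "ennreal (real m * ?\<theta>) + ennreal ?\<theta> = ennreal (real (Suc m) * ?\<theta>)"
    using \<theta> by (simp add: ennreal_plus[symmetric] distrib_right del: ennreal_plus)
  finally show ?case .
qed simp

lemma trunc_kernel_integrable: "integrable lborel (trunc_kernel m :: 'a::euclidean_space \<Rightarrow> real)"
proof (rule Bochner_Integration.integrable_bound)
  show "integrable lborel (\<lambda>z :: 'a. 2 ^ (m * DIM('a)) * indicat_real (ball 0 1) z)"
    by (intro integrable_mult_right integrable_real_indicator emeasure_bounded_finite) auto
  show "AE z :: 'a in lborel. norm (trunc_kernel m z) \<le> norm (2 ^ (m * DIM('a)) * indicat_real (ball 0 1) z)"
  proof (rule AE_I2)
    fix z :: 'a
    show "norm (trunc_kernel m z) \<le> norm (2 ^ (m * DIM('a)) * indicat_real (ball 0 1) z)"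
    proof (cases "norm z < 1")
      case True
      then show ?thesis using trunc_kernel_bound[of m z] trunc_kernel_nonneg[of m z] by simp
    qed (simp add: trunc_kernel_def kernel_k_def)
  qed
qed measurable

text \<open>
  The space occurs as a type argument, because the mass depends on the dimension but on no element.
\<close>

definition trunc_mass :: "nat \<Rightarrow> 'a::euclidean_space itself \<Rightarrow> real" where
  "trunc_mass m _ = (LINT z|lborel. trunc_kernel m (z :: 'a))"

lemma nn_trunc_kernel:
  "(\<integral>\<^sup>+y. ennreal (trunc_kernel m (x - y :: 'a::euclidean_space)) \<partial>lborel)
    = ennreal (trunc_mass m TYPE('a))"
proof -
  have "(\<integral>\<^sup>+y. ennreal (trunc_kernel m (x - y)) \<partial>lborel)
      = (\<integral>\<^sup>+h. ennreal (trunc_kernel m (x - (x + h))) \<partial>lborel)"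
    by (rule nn_integral_lborel_shift[symmetric]) measurable
  also have "\<dots> = (\<integral>\<^sup>+h. ennreal (trunc_kernel m (h :: 'a)) \<partial>lborel)"
    by (simp add: trunc_kernel_even)
  also have "\<dots> = ennreal (trunc_mass m TYPE('a))"
    unfolding trunc_mass_def
    by (rule nn_integral_eq_integral) (auto simp: trunc_kernel_integrable trunc_kernel_nonneg)
  finally show ?thesis .
qed

lemma trunc_mass_nonneg: "0 \<le> trunc_mass m TYPE('a::euclidean_space)"
  by (simp add: trunc_mass_def trunc_kernel_nonneg)

lemma trunc_mass_ge:
  "real m * (unit_ball_vol (real DIM('a)) * (1 - (1/2) ^ DIM('a))) \<le> trunc_mass m TYPE('a::euclidean_space)"
  using nn_trunc_kernel_ge[of m, where 'a='a] nn_trunc_kernel[of m "0::'a"]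
    nn_integral_lborel_shift[of "\<lambda>z. ennreal (trunc_kernel m (z::'a))"]
  by (simp add: trunc_kernel_even trunc_mass_nonneg)

lemma square_times_kernel:
  fixes u :: "'a::euclidean_space \<Rightarrow> real"
  assumes u: "u \<in> L2_space \<Omega>"
  shows "integrable (lborel \<Otimes>\<^sub>M lborel) (\<lambda>(x, y). (u x)\<^sup>2 * trunc_kernel m (x - y))"
    and "(LINT (x, y)|(lborel \<Otimes>\<^sub>M lborel). (u x)\<^sup>2 * trunc_kernel m (x - y))
      = trunc_mass m TYPE('a) * ip u u"
proof -
  note [measurable] = L2_spaceD(1)[OF u]
  have "(\<integral>\<^sup>+z. ennreal (case z of (x, y) \<Rightarrow> (u x)\<^sup>2 * trunc_kernel m (x - y)) \<partial>(lborel \<Otimes>\<^sub>M lborel))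
      = (\<integral>\<^sup>+x. (\<integral>\<^sup>+y. ennreal ((u x)\<^sup>2 * trunc_kernel m (x - y)) \<partial>lborel) \<partial>lborel)"
    by (subst lborel.nn_integral_fst[symmetric]) auto
  also have "\<dots> = (\<integral>\<^sup>+x. ennreal (trunc_mass m TYPE('a)) * ennreal ((u x)\<^sup>2) \<partial>lborel)"
    by (intro nn_integral_cong)
      (simp add: ennreal_mult trunc_kernel_nonneg nn_integral_cmult nn_trunc_kernel mult.commute[of _ "ennreal (trunc_mass _ _)"])
  also have "\<dots> = ennreal (trunc_mass m TYPE('a)) * ennreal (ip u u)"
    unfolding nn_integral_square[OF u, symmetric] by (rule nn_integral_cmult) measurable
  also have "\<dots> = ennreal (trunc_mass m TYPE('a) * ip u u)"
    by (simp add: ennreal_mult trunc_mass_nonneg L2.nonneg[OF u])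
  finally have eq: "(\<integral>\<^sup>+z. ennreal (case z of (x, y) \<Rightarrow> (u x)\<^sup>2 * trunc_kernel m (x - y)) \<partial>(lborel \<Otimes>\<^sub>M lborel))
      = ennreal (trunc_mass m TYPE('a) * ip u u)" .
  have nonneg: "0 \<le> (case z of (x, y) \<Rightarrow> (u x)\<^sup>2 * trunc_kernel m (x - y))" for z
    by (auto simp: trunc_kernel_nonneg split: prod.split)
  show "integrable (lborel \<Otimes>\<^sub>M lborel) (\<lambda>(x, y). (u x)\<^sup>2 * trunc_kernel m (x - y))"
    by (rule integrableI_nonneg) (use nonneg eq in auto)
  show "(LINT (x, y)|(lborel \<Otimes>\<^sub>M lborel). (u x)\<^sup>2 * trunc_kernel m (x - y)) = trunc_mass m TYPE('a) * ip u u"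
    by (subst integral_eq_nn_integral)
      (use nonneg in \<open>auto simp: eq trunc_mass_nonneg L2.nonneg[OF u]\<close>)
qed

definition trunc_conv :: "nat \<Rightarrow> ('a::euclidean_space \<Rightarrow> real) \<Rightarrow> 'a \<Rightarrow> real" where
  "trunc_conv m u x = (LINT y|lborel. u y * trunc_kernel m (x - y))"

lemma trunc_conv_measurable [measurable]:
  assumes [measurable]: "u \<in> borel_measurable borel"
  shows "trunc_conv m u \<in> borel_measurable borel"
proof -
  have "(\<lambda>x. LINT y|lborel. u y * trunc_kernel m (x - y)) \<in> borel_measurable borel"
    by (rule lborel.borel_measurable_lebesgue_integral) measurable
  then show ?thesis unfolding trunc_conv_def .
qed

text \<open>
  Expanding the square \<open>(u x - u y)\<^sup>2\<close> against the truncated kernel, which is integrable, separates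
  the mass from the convolution; the full kernel can only increase the left-hand side.
\<close>

lemma truncated_energy_inequality:
  fixes u :: "'a::euclidean_space \<Rightarrow> real"
  assumes u: "u \<in> H_space \<Omega>"
  shows "trunc_mass m TYPE('a) * ip u u \<le> energy u u / c_const DIM('a) + ip u (trunc_conv m u)"
proof -
  note [measurable] = H_spaceD(1)[OF u]
  note L = H_space_L2[OF u]
  let ?M = "lborel \<Otimes>\<^sub>M lborel :: ('a \<times> 'a) measure"
  let ?K = "\<lambda>x y. trunc_kernel m (x - y)"
  have i1: "integrable ?M (\<lambda>(x, y). (u x)\<^sup>2 * ?K x y)" by (rule square_times_kernel(1)[OF L])
  have sw: "(\<lambda>(x, y). (u y)\<^sup>2 * ?K x y) = (\<lambda>(x, y). case (y, x) of (x, y) \<Rightarrow> (u x)\<^sup>2 * ?K x y)"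
    by (auto simp: fun_eq_iff) (metis trunc_kernel_even minus_diff_eq)
  have i2: "integrable ?M (\<lambda>(x, y). (u y)\<^sup>2 * ?K x y)"
    unfolding sw by (rule lborel_pair.integrable_product_swap[OF i1])
  have e2: "(LINT (x, y)|?M. (u y)\<^sup>2 * ?K x y) = trunc_mass m TYPE('a) * ip u u"
    unfolding sw by (subst lborel_pair.integral_product_swap) (auto simp: square_times_kernel(2)[OF L])
  have "integrable ?M (\<lambda>z. (u (fst z) * sqrt (?K (fst z) (snd z))) * (u (snd z) * sqrt (?K (fst z) (snd z))))"
    by (rule integrable_mult_of_squares)
      (use i1 i2 in \<open>simp_all add: power_mult_distrib trunc_kernel_nonneg case_prod_unfold\<close>)
  then have i3: "integrable ?M (\<lambda>(x, y). u x * u y * ?K x y)"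
    by (simp add: case_prod_unfold trunc_kernel_nonneg mult.assoc mult.left_commute[of "sqrt _"])
  have e3: "(LINT (x, y)|?M. u x * u y * ?K x y) = ip u (trunc_conv m u)"
    using lborel_pair.integral_fst[OF i3] by (simp add: ip_def trunc_conv_def mult.assoc)
  have "2 * (trunc_mass m TYPE('a) * ip u u) - 2 * ip u (trunc_conv m u)
      = (LINT (x, y)|?M. (u x)\<^sup>2 * ?K x y) + (LINT (x, y)|?M. (u y)\<^sup>2 * ?K x y)
        - 2 * (LINT (x, y)|?M. u x * u y * ?K x y)"
    by (simp add: e2 e3 square_times_kernel(2)[OF L])
  also have "\<dots> = (LINT z|?M. (case z of (x, y) \<Rightarrow> (u x)\<^sup>2 * ?K x y) + (case z of (x, y) \<Rightarrow> (u y)\<^sup>2 * ?K x y)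
        - 2 * (case z of (x, y) \<Rightarrow> u x * u y * ?K x y))"
    using i1 i2 i3 by simp
  also have "\<dots> \<le> (LINT z|?M. (weighted_diff u z)\<^sup>2)"
  proof (rule integral_mono)
    show "integrable ?M (\<lambda>z. (weighted_diff u z)\<^sup>2)" by (rule H_spaceD(4)[OF u])
    show "integrable ?M (\<lambda>z. (case z of (x, y) \<Rightarrow> (u x)\<^sup>2 * ?K x y) + (case z of (x, y) \<Rightarrow> (u y)\<^sup>2 * ?K x y)
        - 2 * (case z of (x, y) \<Rightarrow> u x * u y * ?K x y))"
      using i1 i2 i3 by simp
    fix z :: "'a \<times> 'a"
    obtain x y where z: "z = (x, y)" by (cases z)
    have "(u x - u y)\<^sup>2 * ?K x y \<le> (u x - u y)\<^sup>2 * kernel_k (x - y)"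
      by (intro mult_left_mono trunc_kernel_le) auto
    then show "(case z of (x, y) \<Rightarrow> (u x)\<^sup>2 * ?K x y) + (case z of (x, y) \<Rightarrow> (u y)\<^sup>2 * ?K x y)
        - 2 * (case z of (x, y) \<Rightarrow> u x * u y * ?K x y) \<le> (weighted_diff u z)\<^sup>2"
      by (simp add: z weighted_diff_def power_mult_distrib kernel_k_nonneg power2_diff algebra_simps)
  qed
  also have "\<dots> = 2 * (energy u u / c_const DIM('a))"
    using c_const_pos[where 'a='a] by (simp add: energy_weighted_diff power2_eq_square)
  finally show ?thesis by simp
qed

context bounded_open_set begin

lemma bounded_L2:
  assumes [measurable]: "f \<in> borel_measurable borel" and b: "\<And>x. \<bar>f x\<bar> \<le> B"
  shows "(\<lambda>x. indicat_real \<Omega> x * f x) \<in> L2_space \<Omega>"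
proof -
  have "integrable lborel (\<lambda>x. (indicat_real \<Omega> x * f x)\<^sup>2)"
  proof (rule Bochner_Integration.integrable_bound)
    show "integrable lborel (\<lambda>x. B\<^sup>2 * indicat_real \<Omega> x)"
      using finite_measure by (intro integrable_mult_right) simp
    have "(f x)\<^sup>2 \<le> B\<^sup>2" for x using power_mono[OF b, of x 2] by simp
    then show "AE x in lborel. norm ((indicat_real \<Omega> x * f x)\<^sup>2) \<le> norm (B\<^sup>2 * indicat_real \<Omega> x)"
      by (auto simp: indicator_def)
  qed measurable
  then show ?thesis by (auto simp: L2_space_def)
qed

text \<open>
  By the Poincare inequality, testing against \<open>f\<close> in \<open>L\<^sup>2\<close> is a bounded functional on the energy space,
  hence the energy product with some element.
\<close>

lemma weak_H_imp_weak_L2: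
  assumes X: "\<And>n. X n \<in> H_space \<Omega>" and w: "\<And>v. v \<in> H_space \<Omega> \<Longrightarrow> (\<lambda>n. energy (X n) v) \<longlonglongrightarrow> 0"
    and f: "f \<in> L2_space \<Omega>"
  shows "(\<lambda>n. ip (X n) f) \<longlonglongrightarrow> 0"
proof -
  obtain K where K: "K > 0" "\<And>u. u \<in> H_space \<Omega> \<Longrightarrow> L2.nrm u \<le> K * H.nrm u"
    using Poincare[OF bounded] by blast
  have "\<exists>g\<in>H_space \<Omega>. \<forall>v\<in>H_space \<Omega>. energy g v = ip f v"
  proof (rule H.Riesz_representation[OF H_complete])
    show "ip f (\<lambda>x. a * u x + b * v x) = a * ip f u + b * ip f v"
      if "u \<in> H_space \<Omega>" "v \<in> H_space \<Omega>" for u v a b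
      using that by (intro L2.lincomb_right[of _ \<Omega>] H_space_L2 f)
    show "\<bar>ip f u\<bar> \<le> (L2.nrm f * K) * H.nrm u" if u: "u \<in> H_space \<Omega>" for u
      using L2.Cauchy_Schwarz[OF f H_space_L2[OF u]]
        mult_left_mono[OF K(2)[OF u] L2.nrm_nonneg[OF f]] by (simp add: mult.assoc)
  qed
  then obtain g where g: "g \<in> H_space \<Omega>" "\<And>v. v \<in> H_space \<Omega> \<Longrightarrow> energy g v = ip f v" by blast
  have "ip (X n) f = energy (X n) g" for n
    using g(2)[OF X] H.sym[OF g(1) X] L2.sym[OF f H_space_L2[OF X]] by simp
  then show ?thesis using w[OF g(1)] by simp
qed

text \<open>
  For a fixed truncation \<open>m\<close> the convolution with the bounded truncated kernel turns weak convergence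
  into pointwise and, by domination, strong convergence, so the convolution term tends to \<open>0\<close>. What
  remains of the truncated energy inequality bounds the limit superior of the squared norms by a constant
  divided by the mass, and the mass tends to infinity with \<open>m\<close>.
\<close>

lemma compact_embedding:
  assumes X: "\<And>n. X n \<in> H_space \<Omega>" and w: "\<And>v. v \<in> H_space \<Omega> \<Longrightarrow> (\<lambda>n. energy (X n) v) \<longlonglongrightarrow> 0"
    and C: "\<And>n. H.nrm (X n) \<le> C"
  shows "(\<lambda>n. L2.nrm (X n)) \<longlonglongrightarrow> 0"
proof -
  note L = H_space_L2[OF X]
  note [measurable] = H_spaceD(1)[OF X]
  obtain K where K: "K > 0" "\<And>u. u \<in> H_space \<Omega> \<Longrightarrow> L2.nrm u \<le> K * H.nrm u"
    using Poincare[OF bounded] by blast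
  have LC: "L2.nrm (X n) \<le> K * C" for n
    by (rule order_trans[OF K(2)[OF X] mult_left_mono[OF C less_imp_le[OF K(1)]]])
  define b where "b = L2.nrm (indicat_real \<Omega>)"
  have b: "0 \<le> b" by (simp add: b_def L2.nrm_nonneg[OF indicator_L2])
  have conv: "(\<lambda>n. ip (X n) (trunc_conv m (X n))) \<longlonglongrightarrow> 0" for m
  proof -
    define h where "h n = (\<lambda>x. indicat_real \<Omega> x * trunc_conv m (X n) x)" for n
    define B where "B = 2 ^ (m * DIM('a)) * (b * (K * C))"
    have bd: "\<bar>trunc_conv m (X n) x\<bar> \<le> B" for n x
    proof -
      have "\<bar>trunc_conv m (X n) x\<bar> \<le> (LINT y|lborel. \<bar>X n y * trunc_kernel m (x - y)\<bar>)"
        unfolding trunc_conv_def using integral_norm_bound[of lborel "\<lambda>y. X n y * trunc_kernel m (x - y)"] by simp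
      also have "\<dots> \<le> (LINT y|lborel. 2 ^ (m * DIM('a)) * \<bar>X n y\<bar>)"
      proof (rule integral_mono')
        show "integrable lborel (\<lambda>y. 2 ^ (m * DIM('a)) * \<bar>X n y\<bar>)"
          using L2_integrable[OF L] by auto
        fix y show "\<bar>X n y * trunc_kernel m (x - y)\<bar> \<le> 2 ^ (m * DIM('a)) * \<bar>X n y\<bar>"
          using mult_left_mono[OF trunc_kernel_bound[of m "x - y"] abs_ge_zero[of "X n y"]]
          by (simp add: abs_mult trunc_kernel_nonneg mult.commute)
      qed simp
      also have "\<dots> = 2 ^ (m * DIM('a)) * (LINT y|lborel. \<bar>X n y\<bar>)" by simp
      also have "\<dots> \<le> B"
        unfolding B_def using order_trans[OF L1_le_L2[OF L[of n]], of "b * (K * C)"]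
          mult_left_mono[OF LC[of n] b] by (intro mult_left_mono) (auto simp: b_def)
      finally show ?thesis .
    qed
    have hL: "h n \<in> L2_space \<Omega>" for n
      unfolding h_def by (rule bounded_L2[OF _ bd]) measurable
    have hx: "(\<lambda>n. h n x) \<longlonglongrightarrow> 0" for x
    proof -
      have "(\<lambda>y. indicat_real \<Omega> y * trunc_kernel m (x - y)) \<in> L2_space \<Omega>"
        using trunc_kernel_bound[where 'a='a] trunc_kernel_nonneg[where 'a='a]
        by (intro bounded_L2[of _ "2 ^ (m * DIM('a))"]) auto
      from weak_H_imp_weak_L2[OF X w this]
      have "(\<lambda>n. ip (X n) (\<lambda>y. indicat_real \<Omega> y * trunc_kernel m (x - y))) \<longlonglongrightarrow> 0" .
      moreover have "ip (X n) (\<lambda>y. indicat_real \<Omega> y * trunc_kernel m (x - y)) = trunc_conv m (X n) x" for n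
        unfolding ip_def trunc_conv_def
        by (intro Bochner_Integration.integral_cong) (auto simp: indicator_def H_spaceD(2)[OF X])
      ultimately have "(\<lambda>n. trunc_conv m (X n) x) \<longlonglongrightarrow> 0" by simp
      then show ?thesis unfolding h_def using tendsto_mult_left[of _ 0 _ "indicat_real \<Omega> x"] by simp
    qed
    have "(\<lambda>n. LINT x|lborel. (h n x)\<^sup>2) \<longlonglongrightarrow> (LINT x|(lborel :: 'a measure). 0 :: real)"
    proof (rule integral_dominated_convergence[where w="\<lambda>x. B\<^sup>2 * indicat_real \<Omega> x"])
      show "integrable lborel (\<lambda>x. B\<^sup>2 * indicat_real \<Omega> x)"
        using finite_measure by (intro integrable_mult_right) simp
      show "AE x in lborel. norm ((h n x)\<^sup>2) \<le> B\<^sup>2 * indicat_real \<Omega> x" for n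
      proof -
        have "(trunc_conv m (X n) x)\<^sup>2 \<le> B\<^sup>2" for x
          using power_mono[OF bd[of n x] abs_ge_zero, of 2] by simp
        then show ?thesis by (auto simp: h_def indicator_def)
      qed
      show "AE x in lborel. (\<lambda>n. (h n x)\<^sup>2) \<longlonglongrightarrow> 0"
      proof (rule AE_I2)
        show "(\<lambda>n. (h n x)\<^sup>2) \<longlonglongrightarrow> 0" for x using tendsto_power[OF hx[of x], of 2] by simp
      qed
      show "(\<lambda>x. (h n x)\<^sup>2) \<in> borel_measurable lborel" for n
        using L2_spaceD(1)[OF hL] by measurable
    qed simp
    then have "(\<lambda>n. sqrt (ip (h n) (h n))) \<longlonglongrightarrow> sqrt 0"
      by (intro tendsto_real_sqrt) (simp add: ip_def power2_eq_square)
    then have hn: "(\<lambda>n. K * C * L2.nrm (h n)) \<longlonglongrightarrow> 0"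
      using tendsto_mult_left[of _ 0 _ "K * C"] by (simp add: L2.nrm_def)
    have "norm (ip (X n) (trunc_conv m (X n))) \<le> K * C * L2.nrm (h n)" for n
    proof -
      have "ip (X n) (trunc_conv m (X n)) = ip (X n) (h n)"
        unfolding ip_def h_def
        by (intro Bochner_Integration.integral_cong) (auto simp: indicator_def H_spaceD(2)[OF X])
      then show ?thesis
        using order_trans[OF L2.Cauchy_Schwarz[OF L hL] mult_right_mono[OF LC L2.nrm_nonneg[OF hL]]] by simp
    qed
    then show ?thesis by (intro Lim_null_comparison[OF _ hn]) auto
  qed
  define \<theta> where "\<theta> = unit_ball_vol (real DIM('a)) * (1 - (1/2) ^ DIM('a))"
  have \<theta>: "0 < \<theta>" unfolding \<theta>_def by (rule shell_constant_pos)
  define c where "c = c_const DIM('a)"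
  have c: "0 < c" unfolding c_def by (rule c_const_pos)
  have main: "real m * \<theta> * (L2.nrm (X n))\<^sup>2 \<le> C\<^sup>2 / c + ip (X n) (trunc_conv m (X n))" for m n
  proof -
    have "real m * \<theta> * (L2.nrm (X n))\<^sup>2 \<le> trunc_mass m TYPE('a) * ip (X n) (X n)"
      unfolding L2.nrm_square[OF L] \<theta>_def
      by (intro mult_right_mono trunc_mass_ge L2.nonneg[OF L])
    also have "\<dots> \<le> energy (X n) (X n) / c + ip (X n) (trunc_conv m (X n))"
      unfolding c_def by (rule truncated_energy_inequality[OF X])
    also have "energy (X n) (X n) \<le> C\<^sup>2"
      using power_mono[OF C[of n] H.nrm_nonneg[OF X], of 2] H.nrm_square[OF X] by simp
    finally show ?thesis using c by (simp add: divide_right_mono)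
  qed
  show ?thesis
  proof (rule LIMSEQ_I)
    fix e :: real assume e: "e > 0"
    obtain m where m: "(C\<^sup>2 / c + 1) / (\<theta> * e\<^sup>2) < real m" using reals_Archimedean2 by blast
    then have m': "C\<^sup>2 / c + 1 < real m * \<theta> * e\<^sup>2" using \<theta> e by (simp add: field_simps)
    have "0 \<le> C\<^sup>2 / c" using c by simp
    then have "0 < real m * \<theta> * e\<^sup>2" using m' by linarith
    then have mp: "0 < real m * \<theta>" by (rule zero_less_mult_pos2) (use e in simp)
    obtain N where N: "\<And>n. n \<ge> N \<Longrightarrow> norm (ip (X n) (trunc_conv m (X n)) - 0) < 1"
      using LIMSEQ_D[OF conv zero_less_one] by blast
    have "norm (L2.nrm (X n) - 0) < e" if "n \<ge> N" for n
    proof -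
      have "real m * \<theta> * (L2.nrm (X n))\<^sup>2 < real m * \<theta> * e\<^sup>2"
        using main[of m n] N[OF that] m' by simp
      then have "(L2.nrm (X n))\<^sup>2 < e\<^sup>2" using mult_less_cancel_left_pos[OF mp] by blast
      then have "L2.nrm (X n) < e" by (rule power2_less_imp_less) (use e in simp)
      then show ?thesis using L2.nrm_nonneg[OF L] by simp
    qed
    then show "\<exists>N. \<forall>n\<ge>N. norm (L2.nrm (X n) - 0) < e" by blast
  qed
qed

end

section \<open>The part of the form that is bounded on the Lebesgue space\<close>

lemma kernel_j_le: "kernel_j z \<le> 1"
proof (cases "norm z < 1")
  case False
  then have "1 \<le> norm z powr real DIM('a)" by (intro ge_one_powr_ge_zero) auto
  then have "norm z powr (- real DIM('a)) \<le> 1" by (simp add: powr_minus inverse_le_1_iff)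
  then show ?thesis by (simp add: kernel_j_def indicator_def)
qed (simp add: kernel_j_def)

lemma kernel_j_nonneg: "0 \<le> kernel_j z"
  by (simp add: kernel_j_def)

definition tail_form :: "('a::euclidean_space \<Rightarrow> real) \<Rightarrow> ('a \<Rightarrow> real) \<Rightarrow> real" where
  "tail_form u v = (LINT (x, y)|(lborel \<Otimes>\<^sub>M lborel). u x * v y * kernel_j (x - y))"

definition lower_form :: "('a::euclidean_space \<Rightarrow> real) \<Rightarrow> ('a \<Rightarrow> real) \<Rightarrow> real" where
  "lower_form u v = rho_const DIM('a) * ip u v - c_const DIM('a) * tail_form u v"

lemma energy_L_eq: "energy_L u v = energy u v + lower_form u v"
  by (simp add: energy_L_def lower_form_def tail_form_def ip_def)

context bounded_open_set begin

lemma product_integrable: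
  assumes u: "u \<in> L2_space \<Omega>" and v: "v \<in> L2_space \<Omega>"
  shows "integrable (lborel \<Otimes>\<^sub>M lborel) (\<lambda>(x, y). \<bar>u x\<bar> * \<bar>v y\<bar>)"
proof (rule lborel_pair.Fubini_integrable)
  note [measurable] = L2_spaceD(1)[OF u] L2_spaceD(1)[OF v]
  show "(\<lambda>(x, y). \<bar>u x\<bar> * \<bar>v y\<bar>) \<in> borel_measurable (lborel \<Otimes>\<^sub>M lborel)" by measurable
  show "integrable lborel (\<lambda>x. LINT y|lborel. norm (case (x, y) of (x, y) \<Rightarrow> \<bar>u x\<bar> * \<bar>v y\<bar>))"
    using L2_integrable[OF u] by (simp add: abs_mult)
  show "AE x in lborel. integrable lborel (\<lambda>y. case (x, y) of (x, y) \<Rightarrow> \<bar>u x\<bar> * \<bar>v y\<bar>)"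
    using L2_integrable[OF v] by simp
qed

lemma tail_form_integrable:
  assumes u: "u \<in> L2_space \<Omega>" and v: "v \<in> L2_space \<Omega>"
  shows "integrable (lborel \<Otimes>\<^sub>M lborel) (\<lambda>(x, y). u x * v y * kernel_j (x - y))"
proof (rule Bochner_Integration.integrable_bound[OF product_integrable[OF u v]])
  note [measurable] = L2_spaceD(1)[OF u] L2_spaceD(1)[OF v]
  show "(\<lambda>(x, y). u x * v y * kernel_j (x - y)) \<in> borel_measurable (lborel \<Otimes>\<^sub>M lborel)" by measurable
  show "AE z in lborel \<Otimes>\<^sub>M lborel. norm (case z of (x, y) \<Rightarrow> u x * v y * kernel_j (x - y))
      \<le> norm (case z of (x, y) \<Rightarrow> \<bar>u x\<bar> * \<bar>v y\<bar>)"
    by (auto simp: abs_mult kernel_j_nonneg kernel_j_le intro!: AE_I2 mult_left_le)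
qed

lemma tail_form_bound:
  assumes u: "u \<in> L2_space \<Omega>" and v: "v \<in> L2_space \<Omega>"
  shows "\<bar>tail_form u v\<bar> \<le> (L2.nrm (indicat_real \<Omega>))\<^sup>2 * (L2.nrm u * L2.nrm v)"
proof -
  have "\<bar>tail_form u v\<bar> \<le> (LINT z|(lborel \<Otimes>\<^sub>M lborel). norm (case z of (x, y) \<Rightarrow> u x * v y * kernel_j (x - y)))"
    unfolding tail_form_def
    using integral_norm_bound[of "lborel \<Otimes>\<^sub>M lborel" "\<lambda>(x, y). u x * v y * kernel_j (x - y)"] by simp
  also have "\<dots> \<le> (LINT (x, y)|(lborel \<Otimes>\<^sub>M lborel). \<bar>u x\<bar> * \<bar>v y\<bar>)"
  proof (rule integral_mono[OF integrable_norm[OF tail_form_integrable[OF u v]] product_integrable[OF u v]])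
    show "norm (case z of (x, y) \<Rightarrow> u x * v y * kernel_j (x - y)) \<le> (case z of (x, y) \<Rightarrow> \<bar>u x\<bar> * \<bar>v y\<bar>)" for z
      by (auto simp: abs_mult kernel_j_nonneg kernel_j_le intro!: mult_left_le split: prod.split)
  qed
  also have "\<dots> = (LINT x|lborel. \<bar>u x\<bar>) * (LINT y|lborel. \<bar>v y\<bar>)"
    by (subst lborel_pair.integral_fst[OF product_integrable[OF u v], symmetric]) simp
  also have "\<dots> \<le> (L2.nrm (indicat_real \<Omega>) * L2.nrm u) * (L2.nrm (indicat_real \<Omega>) * L2.nrm v)"
    using L1_le_L2[OF u] L1_le_L2[OF v] L2.nrm_nonneg[OF indicator_L2] L2.nrm_nonneg[OF u]
    by (intro mult_mono) auto
  finally show ?thesis by (simp add: power2_eq_square ac_simps)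
qed

lemma tail_form_sym:
  assumes u: "u \<in> L2_space \<Omega>" and v: "v \<in> L2_space \<Omega>"
  shows "tail_form u v = tail_form v u"
proof -
  note [measurable] = L2_spaceD(1)[OF u] L2_spaceD(1)[OF v]
  have "tail_form u v = (LINT (x, y)|(lborel \<Otimes>\<^sub>M lborel). (case (y, x) of (x, y) \<Rightarrow> u x * v y * kernel_j (x - y)))"
    unfolding tail_form_def by (subst lborel_pair.integral_product_swap) measurable
  also have "\<dots> = tail_form v u"
    unfolding tail_form_def
    by (intro Bochner_Integration.integral_cong) (auto simp: mult.commute, metis kernel_j_even minus_diff_eq)
  finally show ?thesis .
qed

lemma lower_form_sym: "u \<in> L2_space \<Omega> \<Longrightarrow> v \<in> L2_space \<Omega> \<Longrightarrow> lower_form u v = lower_form v u"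
  by (simp add: lower_form_def tail_form_sym L2.sym[of u \<Omega> v])

lemma lower_form_lincomb_left:
  assumes u: "u \<in> L2_space \<Omega>" and v: "v \<in> L2_space \<Omega>" and w: "w \<in> L2_space \<Omega>"
  shows "lower_form (\<lambda>x. a * u x + b * v x) w = a * lower_form u w + b * lower_form v w"
proof -
  have "tail_form (\<lambda>x. a * u x + b * v x) w
      = (LINT z|(lborel \<Otimes>\<^sub>M lborel). a * (case z of (x, y) \<Rightarrow> u x * w y * kernel_j (x - y))
          + b * (case z of (x, y) \<Rightarrow> v x * w y * kernel_j (x - y)))"
    unfolding tail_form_def by (intro Bochner_Integration.integral_cong) (auto simp: algebra_simps)
  also have "\<dots> = a * tail_form u w + b * tail_form v w"
    unfolding tail_form_def using tail_form_integrable[OF u w] tail_form_integrable[OF v w] by simp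
  finally show ?thesis
    by (simp add: lower_form_def L2.lincomb_left[OF u v w] algebra_simps)
qed

lemma lower_form_bound:
  obtains M where "0 \<le> M"
    "\<And>u v. u \<in> L2_space \<Omega> \<Longrightarrow> v \<in> L2_space \<Omega> \<Longrightarrow> \<bar>lower_form u v\<bar> \<le> M * (L2.nrm u * L2.nrm v)"
proof
  define c \<rho> b where "c = c_const DIM('a)" and "\<rho> = rho_const DIM('a)" and "b = (L2.nrm (indicat_real \<Omega>))\<^sup>2"
  have c: "0 < c" unfolding c_def by (rule c_const_pos)
  show "0 \<le> \<bar>\<rho>\<bar> + c * b" using c by (simp add: b_def)
  show "\<bar>lower_form u v\<bar> \<le> (\<bar>\<rho>\<bar> + c * b) * (L2.nrm u * L2.nrm v)"
    if u: "u \<in> L2_space \<Omega>" and v: "v \<in> L2_space \<Omega>" for u v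
  proof -
    have "\<bar>\<rho> * ip u v\<bar> \<le> \<bar>\<rho>\<bar> * (L2.nrm u * L2.nrm v)"
      unfolding abs_mult by (intro mult_left_mono L2.Cauchy_Schwarz[OF u v]) auto
    moreover have "\<bar>c * tail_form u v\<bar> \<le> c * (b * (L2.nrm u * L2.nrm v))"
      unfolding abs_mult b_def using c tail_form_bound[OF u v] by (auto intro!: mult_left_mono)
    ultimately show ?thesis
      by (simp add: lower_form_def c_def[symmetric] \<rho>_def[symmetric] algebra_simps)
  qed
qed

end

lemma pos_part_L2:
  assumes "u \<in> L2_space \<Omega>"
  shows "(\<lambda>x. max (u x) 0) \<in> L2_space \<Omega>"
proof -
  note [measurable] = L2_spaceD(1)[OF assms]
  have "integrable lborel (\<lambda>x. (max (u x) 0)\<^sup>2)"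
    by (rule Bochner_Integration.integrable_bound[OF L2_spaceD(4)[OF assms]]) (auto simp: max_def)
  then show ?thesis using assms by (auto simp: L2_space_def)
qed

section \<open>A function independent of the first eigenfunction\<close>

lemma shells_cover:
  assumes "z \<noteq> 0" "norm z < 1"
  shows "\<exists>k. z \<in> shell k"
proof -
  have "\<exists>n. (1/2 :: real) ^ n \<le> norm z"
    using real_arch_pow_inv[of "norm z" "1/2"] assms(1) less_imp_le by auto
  then obtain n where n: "(1/2 :: real) ^ n \<le> norm z" "\<And>i. i < n \<Longrightarrow> \<not> (1/2 :: real) ^ i \<le> norm z"
    using exists_least_iff[of "\<lambda>n. (1/2 :: real) ^ n \<le> norm z"] by blast
  then have "n \<noteq> 0" using assms(2) by (intro notI) simp
  then obtain k where "n = Suc k" using not0_implies_Suc by blast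
  then have "z \<in> shell k" using n(1) n(2)[of k] by (auto simp: shell_def)
  then show ?thesis ..
qed

text \<open>
  On the shell \<open>k\<close> the integrand is at most a multiple of \<open>4\<^sup>-\<^sup>k\<close> times the inverse volume of the shell,
  so the shells contribute a geometric series.
\<close>

lemma second_moment_finite:
  "(\<integral>\<^sup>+h. ennreal (kernel_k h * (norm (h :: 'a::euclidean_space))\<^sup>2) \<partial>lborel) < \<infinity>"
proof -
  let ?\<theta> = "unit_ball_vol (real DIM('a)) * (1 - (1/2) ^ DIM('a))"
  have \<theta>: "0 < ?\<theta>" by (rule shell_constant_pos)
  define a :: "nat \<Rightarrow> real" where "a k = 2 ^ (Suc k * DIM('a)) * (1/4) ^ k" for k
  have a: "0 \<le> a k" for k by (simp add: a_def)
  have "ennreal (kernel_k h * (norm h)\<^sup>2) \<le> (\<Sum>k. ennreal (a k) * indicator (shell k) h)" for h :: 'a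
  proof (cases "h \<noteq> 0 \<and> norm h < 1")
    case True
    then obtain k where k: "h \<in> shell k" using shells_cover by blast
    have "(norm h)\<^sup>2 \<le> ((1/2) ^ k)\<^sup>2" using k by (intro power_mono) (auto simp: shell_def)
    also have "\<dots> = (1/4) ^ k" by (simp add: power_mult[symmetric] mult.commute[of k]) (simp add: power_mult power_divide)
    finally have "kernel_k h * (norm h)\<^sup>2 \<le> a k"
      unfolding a_def using kernel_k_shell(2)[OF k] by (intro mult_mono) auto
    then have "ennreal (kernel_k h * (norm h)\<^sup>2) \<le> (\<Sum>i\<in>{k}. ennreal (a i) * indicator (shell i) h)"
      using k by (simp add: ennreal_leI)
    also have "\<dots> \<le> (\<Sum>i. ennreal (a i) * indicator (shell i) h)"
      by (rule sum_le_suminf) auto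
    finally show ?thesis .
  qed (auto simp: kernel_k_def)
  then have "(\<integral>\<^sup>+h. ennreal (kernel_k h * (norm (h :: 'a))\<^sup>2) \<partial>lborel)
      \<le> (\<integral>\<^sup>+h. (\<Sum>k. ennreal (a k) * indicator (shell k) (h :: 'a)) \<partial>lborel)"
    by (intro nn_integral_mono) auto
  also have "\<dots> = (\<Sum>k. \<integral>\<^sup>+h. ennreal (a k) * indicator (shell k) (h :: 'a) \<partial>lborel)"
    by (rule nn_integral_suminf) measurable
  also have "\<dots> = (\<Sum>k. ennreal (2 ^ DIM('a) * ?\<theta> * (1/4) ^ k))"
  proof (rule suminf_cong)
    fix k
    have "(2 ^ k) ^ DIM('a) * ((1/2) ^ k) ^ DIM('a) = (1 :: real)"
      by (simp add: power_mult_distrib[symmetric])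
    moreover have "a k * (?\<theta> * ((1/2) ^ k) ^ DIM('a))
        = 2 ^ DIM('a) * ?\<theta> * (1/4) ^ k * ((2 ^ k) ^ DIM('a) * ((1/2) ^ k) ^ DIM('a))"
      by (simp add: a_def power_add power_mult[symmetric] ac_simps)
    ultimately have "a k * (?\<theta> * ((1/2) ^ k) ^ DIM('a)) = 2 ^ DIM('a) * ?\<theta> * (1/4) ^ k" by simp
    then show "(\<integral>\<^sup>+h. ennreal (a k) * indicator (shell k) (h :: 'a) \<partial>lborel) = ennreal (2 ^ DIM('a) * ?\<theta> * (1/4) ^ k)"
      using a \<theta> by (simp add: nn_integral_cmult_indicator emeasure_shell ennreal_mult[symmetric] del: ennreal_power)
  qed
  also have "\<dots> = ennreal (\<Sum>k. 2 ^ DIM('a) * ?\<theta> * (1/4) ^ k)"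
    using \<theta> by (intro suminf_ennreal2 summable_mult summable_geometric) auto
  also have "\<dots> < \<infinity>" by simp
  finally show ?thesis .
qed

definition bump :: "'a::euclidean_space \<Rightarrow> real \<Rightarrow> 'a \<Rightarrow> real" where
  "bump x0 \<rho> x = max 0 (\<rho> - dist x0 x)"

lemma bump_Lipschitz: "\<bar>bump x0 \<rho> x - bump x0 \<rho> y\<bar> \<le> dist x y"
  using dist_triangle[of x0 x y] dist_triangle[of x0 y x] dist_commute[of x y]
  unfolding bump_def by linarith

lemma bump_outside: "x \<notin> ball x0 \<rho> \<Longrightarrow> bump x0 \<rho> x = 0"
  by (simp add: bump_def)

lemma bump_measurable [measurable]: "bump x0 \<rho> \<in> borel_measurable borel"
  unfolding bump_def by measurable

text \<open>
  A Lipschitz function of bounded support has finite energy: its translation by \<open>h\<close> costs at most \<open>|h|\<^sup>2\<close> times a volume.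
\<close>

lemma bump_in_H_space:
  assumes "ball x0 \<rho> \<subseteq> \<Omega>"
  shows "bump x0 \<rho> \<in> H_space \<Omega>"
proof (rule H_spaceI)
  let ?b = "bump x0 \<rho>"
  show "?b x = 0" if "x \<notin> \<Omega>" for x using that assms bump_outside by blast
  have "(\<integral>\<^sup>+x. ennreal ((?b x)\<^sup>2) \<partial>lborel) \<le> (\<integral>\<^sup>+x. ennreal (\<rho>\<^sup>2) * indicator (ball x0 \<rho>) x \<partial>lborel)"
  proof (rule nn_integral_mono)
    show "ennreal ((?b x)\<^sup>2) \<le> ennreal (\<rho>\<^sup>2) * indicator (ball x0 \<rho>) x" for x
    proof (cases "x \<in> ball x0 \<rho>")
      case True
      then have "(?b x)\<^sup>2 \<le> \<rho>\<^sup>2" by (intro power_mono) (auto simp: bump_def)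
      then show ?thesis using True by (simp add: ennreal_leI)
    qed (simp add: bump_outside)
  qed
  also have "\<dots> < \<infinity>"
    using emeasure_bounded_finite[OF bounded_ball, of x0 \<rho>]
    by (simp add: nn_integral_cmult_indicator ennreal_mult_less_top)
  finally show "(\<integral>\<^sup>+x. ennreal ((?b x)\<^sup>2) \<partial>lborel) < \<infinity>" .
  let ?V = "emeasure lborel (ball x0 (\<rho> + 1))"
  have "(\<integral>\<^sup>+z. ennreal ((weighted_diff ?b z)\<^sup>2) \<partial>(lborel \<Otimes>\<^sub>M lborel))
      = (\<integral>\<^sup>+h. ennreal (kernel_k h) * (\<integral>\<^sup>+x. ennreal ((?b x - ?b (x + h))\<^sup>2) \<partial>lborel) \<partial>lborel)"
    by (rule translation_energy[symmetric]) measurable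
  also have "\<dots> \<le> (\<integral>\<^sup>+h. ?V * ennreal (kernel_k h * (norm (h :: 'a))\<^sup>2) \<partial>lborel)"
  proof (rule nn_integral_mono)
    fix h :: 'a
    show "ennreal (kernel_k h) * (\<integral>\<^sup>+x. ennreal ((?b x - ?b (x + h))\<^sup>2) \<partial>lborel)
        \<le> ?V * ennreal (kernel_k h * (norm h)\<^sup>2)"
    proof (cases "norm h < 1")
      case True
      have "(\<integral>\<^sup>+x. ennreal ((?b x - ?b (x + h))\<^sup>2) \<partial>lborel)
          \<le> (\<integral>\<^sup>+x. ennreal ((norm h)\<^sup>2) * indicator (ball x0 (\<rho> + 1)) x \<partial>lborel)"
      proof (rule nn_integral_mono)
        fix x
        show "ennreal ((?b x - ?b (x + h))\<^sup>2) \<le> ennreal ((norm h)\<^sup>2) * indicator (ball x0 (\<rho> + 1)) x"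
        proof (cases "x \<in> ball x0 (\<rho> + 1)")
          case True
          have "\<bar>?b x - ?b (x + h)\<bar>\<^sup>2 \<le> (norm h)\<^sup>2"
            using bump_Lipschitz[of x0 \<rho> x "x + h"] by (intro power_mono) (auto simp: dist_norm)
          then show ?thesis using True by (simp add: ennreal_leI)
        next
          case False
          then have "\<rho> + 1 \<le> dist x0 x" by simp
          moreover have "dist x0 x \<le> dist x0 (x + h) + norm h"
            using dist_triangle[of x0 x "x + h"] by (simp add: dist_norm)
          ultimately have "?b x = 0" "?b (x + h) = 0"
            using True by (auto simp: bump_def)
          then show ?thesis by simp
        qed
      qed
      also have "\<dots> = ennreal ((norm h)\<^sup>2) * ?V" by (simp add: nn_integral_cmult_indicator)
      finally have "ennreal (kernel_k h) * (\<integral>\<^sup>+x. ennreal ((?b x - ?b (x + h))\<^sup>2) \<partial>lborel)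
          \<le> ennreal (kernel_k h) * (ennreal ((norm h)\<^sup>2) * ?V)" by (rule mult_left_mono) simp
      also have "\<dots> = ?V * ennreal (kernel_k h * (norm h)\<^sup>2)"
        by (simp add: ennreal_mult kernel_k_nonneg ac_simps)
      finally show ?thesis .
    qed (simp add: kernel_k_def)
  qed
  also have "\<dots> = ?V * (\<integral>\<^sup>+h. ennreal (kernel_k h * (norm (h :: 'a))\<^sup>2) \<partial>lborel)"
    by (rule nn_integral_cmult) measurable
  also have "\<dots> < \<infinity>"
    using second_moment_finite[where 'a='a] emeasure_bounded_finite[OF bounded_ball, of x0 "\<rho> + 1"]
    by (simp add: ennreal_mult_less_top)
  finally show "(\<integral>\<^sup>+z. ennreal ((weighted_diff ?b z)\<^sup>2) \<partial>(lborel \<Otimes>\<^sub>M lborel)) < \<infinity>" .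
qed measurable

text \<open>
  A bump supported in a small ball vanishes on part of \<open>\<Omega>\<close> of positive measure, where \<open>\<phi>\<close> is positive.
\<close>

lemma (in bounded_open_set) exists_independent:
  assumes ne: "\<Omega> \<noteq> {}" and pos: "AE x in lborel. x \<in> \<Omega> \<longrightarrow> \<phi> x > (0 :: real)"
  shows "\<exists>\<psi>\<in>H_space \<Omega>. \<forall>a b. (AE x in lborel. a * \<phi> x + b * \<psi> x = 0) \<longrightarrow> a = 0 \<and> b = 0"
proof -
  obtain x0 d where d: "d > 0" "ball x0 d \<subseteq> \<Omega>"
    using ne is_open by (meson ex_in_conv open_contains_ball)
  define \<rho> where "\<rho> = d / 2"
  have \<rho>: "\<rho> > 0" "\<rho> < d" "ball x0 \<rho> \<subseteq> \<Omega>" using d by (auto simp: \<rho>_def intro: subset_trans[rotated])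
  let ?\<omega> = "unit_ball_vol (real DIM('a))"
  have \<omega>: "?\<omega> > 0" by simp
  have "a = 0 \<and> b = 0" if ab: "AE x in lborel. a * \<phi> x + b * bump x0 \<rho> x = 0" for a b
  proof
    show a0: "a = 0"
    proof (rule ccontr)
      assume a: "a \<noteq> 0"
      \<comment> \<open>otherwise \<open>\<phi>\<close> would vanish on the larger ball outside the smaller one, and the balls would have equal volume\<close>
      have "AE x in lborel. x \<in> ball x0 d \<longleftrightarrow> x \<in> ball x0 \<rho>"
        using ab pos
      proof eventually_elim
        case (elim x)
        show ?case
        proof (cases "x \<in> ball x0 \<rho>")
          case False
          then have "a * \<phi> x = 0" using elim bump_outside[OF False] by simp
          then show ?thesis using a elim(2) d(2) False by auto
        qed (use \<rho> in auto)
      qed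
      then have "emeasure lborel (ball x0 d) = emeasure lborel (ball x0 \<rho>)"
        by (rule emeasure_eq_AE) auto
      then have "?\<omega> * d ^ DIM('a) = ?\<omega> * \<rho> ^ DIM('a)"
        using d \<rho> by (simp add: emeasure_ball)
      then have "d ^ DIM('a) = \<rho> ^ DIM('a)" using \<omega> by (metis less_irrefl mult_left_cancel)
      then show False using power_strict_mono[of \<rho> d "DIM('a)"] \<rho> by simp
    qed
    show "b = 0"
    proof (rule ccontr)
      assume b: "b \<noteq> 0"
      have "AE x in lborel. x \<in> ball x0 \<rho> \<longleftrightarrow> x \<in> {}"
        using ab by eventually_elim (use a0 b in \<open>auto simp: bump_def max_def split: if_splits\<close>)
      then have "emeasure lborel (ball x0 \<rho>) = emeasure lborel ({} :: 'a set)"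
        by (rule emeasure_eq_AE) auto
      then have "?\<omega> * \<rho> ^ DIM('a) = 0"
        using \<rho> by (simp add: emeasure_ball)
      then show False using \<omega> \<rho> by (metis less_irrefl mult_pos_pos zero_less_power)
    qed
  qed
  then show ?thesis using bump_in_H_space[OF \<rho>(3)] by blast
qed

section \<open>Null functions, positive parts and the sphere\<close>

lemma ip_self_zero_AE:
  assumes "u \<in> L2_space \<Omega>" "ip u u = 0"
  shows "AE x in lborel. u x = 0"
proof -
  have "AE x in lborel. (u x)\<^sup>2 = 0"
    using assms(2) integral_nonneg_eq_0_iff_AE[OF L2_spaceD(4)[OF assms(1)]]
    by (simp add: ip_def power2_eq_square)
  then show ?thesis by simp
qed

lemma L2_nrm_AE_zero:
  assumes "AE x in lborel. u x = 0"
  shows "L2.nrm u = 0"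
proof -
  have "AE x in lborel. u x * u x = 0" using assms by eventually_elim simp
  then have "ip u u = 0" unfolding ip_def by (rule integral_eq_zero_AE)
  then show ?thesis by (simp add: L2.nrm_def)
qed

lemma energy_null:
  fixes u v :: "'a::euclidean_space \<Rightarrow> real"
  assumes "AE x in lborel. u x = 0"
  shows "energy u v = 0"
proof -
  have "AE z in lborel \<Otimes>\<^sub>M lborel. weighted_diff u z * weighted_diff v z = 0"
    using AE_lborel_pair[OF assms] by eventually_elim (auto simp: weighted_diff_def)
  then show ?thesis by (simp add: energy_weighted_diff integral_eq_zero_AE)
qed

abbreviation pos_part :: "('a \<Rightarrow> real) \<Rightarrow> 'a \<Rightarrow> real" where
  "pos_part u \<equiv> (\<lambda>x. max (u x) 0)"

lemma L2_nrm_mono: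
  assumes u: "u \<in> L2_space \<Omega>" and v: "v \<in> L2_space \<Omega>" and le: "\<And>x. \<bar>u x\<bar> \<le> \<bar>v x\<bar>"
  shows "L2.nrm u \<le> L2.nrm v"
proof -
  have "u x * u x \<le> v x * v x" for x
    using abs_le_square_iff[THEN iffD1, OF le[of x]] by (simp add: power2_eq_square)
  then have "ip u u \<le> ip v v"
    unfolding ip_def by (intro integral_mono L2_integrable_mult[OF u u] L2_integrable_mult[OF v v]) auto
  then show ?thesis by (simp add: L2.nrm_def)
qed

lemma pos_part_diff_le:
  assumes u: "u \<in> L2_space \<Omega>" and v: "v \<in> L2_space \<Omega>"
  shows "L2.nrm (\<lambda>x. pos_part u x - pos_part v x) \<le> L2.nrm (\<lambda>x. u x - v x)"
  by (rule L2_nrm_mono[of _ \<Omega>]) (auto intro!: L2.diff_mem pos_part_L2 u v)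

lemma pos_part_le:
  assumes u: "u \<in> L2_space \<Omega>"
  shows "L2.nrm (pos_part u) \<le> L2.nrm u"
  by (rule L2_nrm_mono[OF pos_part_L2[OF u] u]) auto

lemma ip_pos_part: "ip (pos_part u) u = ip (pos_part u) (pos_part u)"
  unfolding ip_def by (rule Bochner_Integration.integral_cong) (auto simp: max_def)

lemma set_integral_eq_ip:
  assumes "\<And>x. x \<notin> \<Omega> \<Longrightarrow> u x = 0 \<or> v x = 0"
  shows "(LINT x:\<Omega>|lborel. u x * v x) = ip u v"
  unfolding set_lebesgue_integral_def ip_def
  by (rule Bochner_Integration.integral_cong) (use assms in \<open>force simp: indicator_def\<close>)+

definition normalize :: "('a::euclidean_space \<Rightarrow> real) \<Rightarrow> 'a \<Rightarrow> real" where
  "normalize u = (\<lambda>x. 1 / L2.nrm u * u x)"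

lemma L2_sphere_iff: "u \<in> L2_sphere \<Omega> \<longleftrightarrow> u \<in> H_space \<Omega> \<and> L2.nrm u = 1"
proof -
  have "(LINT x:\<Omega>|lborel. (u x)\<^sup>2) = ip u u" if "u \<in> H_space \<Omega>"
    using set_integral_eq_ip[of \<Omega> u u] H_spaceD(2)[OF that] by (simp add: power2_eq_square)
  then show ?thesis by (auto simp: L2_sphere_def L2.nrm_def)
qed

lemma normalize_sphere:
  assumes "u \<in> H_space \<Omega>" "L2.nrm u \<noteq> 0"
  shows "normalize u \<in> L2_sphere \<Omega>"
proof -
  have "L2.nrm (normalize u) = \<bar>1 / L2.nrm u\<bar> * L2.nrm u"
    unfolding normalize_def by (rule L2.nrm_scale[OF H_space_L2[OF assms(1)]])
  then have "L2.nrm (normalize u) = 1"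
    using assms(2) L2.nrm_nonneg[OF H_space_L2[OF assms(1)]] by simp
  moreover have "normalize u \<in> H_space \<Omega>" unfolding normalize_def by (rule H.scale_mem[OF assms(1)])
  ultimately show ?thesis by (simp add: L2_sphere_iff)
qed

section \<open>The descent step\<close>

text \<open>
  The constants of the Poincare inequality and of the bound for the lower order form are fixed once,
  since the length of the descent step depends on them.
\<close>

locale fucik_setting = bounded_open_set \<Omega> for \<Omega> :: "'a::euclidean_space set" +
  fixes r K M :: real
  assumes r: "0 \<le> r" and K: "0 < K" and M: "0 \<le> M"
    and Poincare_K: "\<And>u. u \<in> H_space \<Omega> \<Longrightarrow> L2.nrm u \<le> K * H.nrm u"
    and lower_M: "\<And>u v. u \<in> L2_space \<Omega> \<Longrightarrow> v \<in> L2_space \<Omega> \<Longrightarrow> \<bar>lower_form u v\<bar> \<le> M * (L2.nrm u * L2.nrm v)"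
begin

abbreviation J where "J \<equiv> E_functional \<Omega> r"
abbreviation "P \<equiv> L2_sphere \<Omega>"

lemma sphereD:
  assumes "u \<in> P"
  shows "u \<in> H_space \<Omega>" "u \<in> L2_space \<Omega>" "L2.nrm u = 1" "ip u u = 1"
  using assms L2.nrm_square[of u \<Omega>] by (auto simp: L2_sphere_iff H_space_L2)

lemma J_eq:
  assumes "u \<in> H_space \<Omega>"
  shows "J u = energy u u + lower_form u u - r * ip (pos_part u) (pos_part u)"
  using set_integral_eq_ip[of \<Omega> "pos_part u" "pos_part u"] H_spaceD(2)[OF assms]
  by (simp add: E_functional_def energy_L_eq power2_eq_square)

lemma lower_form_scale: "u \<in> L2_space \<Omega> \<Longrightarrow> v \<in> L2_space \<Omega> \<Longrightarrow> lower_form (\<lambda>x. a * u x) v = a * lower_form u v"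
  using lower_form_lincomb_left[of u u v a 0] by simp

lemma lower_form_diff:
  "u \<in> L2_space \<Omega> \<Longrightarrow> v \<in> L2_space \<Omega> \<Longrightarrow> w \<in> L2_space \<Omega> \<Longrightarrow>
    lower_form (\<lambda>x. u x - v x) w = lower_form u w - lower_form v w"
  using lower_form_lincomb_left[of u v w 1 "-1"] by simp

lemma lower_form_lincomb_right:
  "u \<in> L2_space \<Omega> \<Longrightarrow> v \<in> L2_space \<Omega> \<Longrightarrow> w \<in> L2_space \<Omega> \<Longrightarrow>
    lower_form w (\<lambda>x. a * u x + b * v x) = a * lower_form w u + b * lower_form w v"
  using lower_form_lincomb_left[of u v w a b] L2.lincomb_mem[of u \<Omega> v a b] by (simp add: lower_form_sym[of w])

lemma lower_form_square:
  assumes u: "u \<in> L2_space \<Omega>" and v: "v \<in> L2_space \<Omega>"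
  shows "lower_form (\<lambda>x. a * u x + b * v x) (\<lambda>x. a * u x + b * v x)
    = a\<^sup>2 * lower_form u u + 2 * a * b * lower_form u v + b\<^sup>2 * lower_form v v"
proof -
  have "lower_form (\<lambda>x. a * u x + b * v x) (\<lambda>x. a * u x + b * v x)
      = a * lower_form u (\<lambda>x. a * u x + b * v x) + b * lower_form v (\<lambda>x. a * u x + b * v x)"
    by (rule lower_form_lincomb_left[OF u v L2.lincomb_mem[OF u v]])
  then show ?thesis
    unfolding lower_form_lincomb_right[OF u v u] lower_form_lincomb_right[OF u v v]
    using lower_form_sym[OF u v] by (simp add: power2_eq_square algebra_simps)
qed

lemma J_scale:
  assumes u: "u \<in> H_space \<Omega>" and a: "0 \<le> a"
  shows "J (\<lambda>x. a * u x) = a\<^sup>2 * J u"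
proof -
  have p: "pos_part (\<lambda>x. a * u x) = (\<lambda>x. a * pos_part u x)"
    using a by (auto simp: fun_eq_iff max_def mult_le_0_iff)
  have "energy (\<lambda>x. a * u x) (\<lambda>x. a * u x) = a\<^sup>2 * energy u u"
    using H.lincomb_square[OF u u, of a 0] by simp
  moreover have "lower_form (\<lambda>x. a * u x) (\<lambda>x. a * u x) = a\<^sup>2 * lower_form u u"
    using lower_form_square[OF H_space_L2[OF u] H_space_L2[OF u], of a 0] by simp
  moreover have "ip (\<lambda>x. a * pos_part u x) (\<lambda>x. a * pos_part u x) = a\<^sup>2 * ip (pos_part u) (pos_part u)"
    using L2.lincomb_square[OF pos_part_L2[OF H_space_L2[OF u]] pos_part_L2[OF H_space_L2[OF u]], of a 0] by simp
  moreover have "J (\<lambda>x. a * u x) = energy (\<lambda>x. a * u x) (\<lambda>x. a * u x)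
      + lower_form (\<lambda>x. a * u x) (\<lambda>x. a * u x) - r * ip (\<lambda>x. a * pos_part u x) (\<lambda>x. a * pos_part u x)"
    using J_eq[OF H.scale_mem[OF u, of a]] unfolding p .
  ultimately show ?thesis by (simp add: J_eq[OF u] algebra_simps)
qed

lemma ip_pos_part_le: "u \<in> P \<Longrightarrow> ip (pos_part u) (pos_part u) \<le> 1"
  using power_mono[OF pos_part_le[OF sphereD(2)] L2.nrm_nonneg[OF pos_part_L2[OF sphereD(2)]], of u 2]
  by (simp add: L2.nrm_square[OF pos_part_L2[OF sphereD(2)]] sphereD(3))

lemma lower_form_sphere: "u \<in> P \<Longrightarrow> \<bar>lower_form u u\<bar> \<le> M"
  using lower_M[OF sphereD(2) sphereD(2), of u u] by (simp add: sphereD(3))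

lemma J_ge: "u \<in> P \<Longrightarrow> - M - r \<le> J u"
  using J_eq[OF sphereD(1)] H.nonneg[OF sphereD(1)] lower_form_sphere[of u] mult_left_mono[OF ip_pos_part_le r]
  by fastforce

lemma energy_le_J: "u \<in> P \<Longrightarrow> energy u u \<le> J u + M + r"
  using J_eq[OF sphereD(1), of u] lower_form_sphere[of u] mult_left_mono[OF ip_pos_part_le[of u] r] by simp

text \<open>
  Half of the derivative of \<open>J(w) - J(u) \<integral> w\<^sup>2\<close> with respect to \<open>w\<close>, at \<open>w = u\<close> in direction \<open>v\<close>. As
  \<open>J\<close> is positively homogeneous of degree two, the Lagrange multiplier at a critical point is the value \<open>J(u)\<close>.
\<close>

definition half_deriv :: "('a \<Rightarrow> real) \<Rightarrow> ('a \<Rightarrow> real) \<Rightarrow> real" where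
  "half_deriv u v = energy u v + lower_form u v - r * ip (pos_part u) v - J u * ip u v"

lemma half_deriv_self: "u \<in> P \<Longrightarrow> half_deriv u u = 0"
  by (simp add: half_deriv_def J_eq sphereD ip_pos_part)

lemma half_deriv_lincomb:
  assumes u: "u \<in> P" and v: "v \<in> H_space \<Omega>" and w: "w \<in> H_space \<Omega>"
  shows "half_deriv u (\<lambda>x. a * v x + b * w x) = a * half_deriv u v + b * half_deriv u w"
  unfolding half_deriv_def H.lincomb_right[OF v w sphereD(1)[OF u]]
    lower_form_lincomb_right[OF H_space_L2[OF v] H_space_L2[OF w] sphereD(2)[OF u]]
    L2.lincomb_right[OF H_space_L2[OF v] H_space_L2[OF w] sphereD(2)[OF u]]
    L2.lincomb_right[OF H_space_L2[OF v] H_space_L2[OF w] pos_part_L2[OF sphereD(2)[OF u]]]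
  by (simp add: algebra_simps)

lemma ip_H_bound:
  assumes u: "u \<in> L2_space \<Omega>" and v: "v \<in> H_space \<Omega>"
  shows "\<bar>ip u v\<bar> \<le> L2.nrm u * K * H.nrm v"
  using order_trans[OF L2.Cauchy_Schwarz[OF u H_space_L2[OF v]]
    mult_left_mono[OF Poincare_K[OF v] L2.nrm_nonneg[OF u]]] by (simp add: mult.assoc)

lemma lower_H_bound:
  assumes u: "u \<in> L2_space \<Omega>" and v: "v \<in> H_space \<Omega>"
  shows "\<bar>lower_form u v\<bar> \<le> M * L2.nrm u * K * H.nrm v"
proof -
  have "L2.nrm u * L2.nrm v \<le> L2.nrm u * (K * H.nrm v)"
    by (rule mult_left_mono[OF Poincare_K[OF v] L2.nrm_nonneg[OF u]])
  from order_trans[OF lower_M[OF u H_space_L2[OF v]] mult_left_mono[OF this M]]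
  show ?thesis by (simp add: mult.assoc)
qed

lemma half_deriv_representable:
  assumes u: "u \<in> P"
  shows "\<exists>g\<in>H_space \<Omega>. \<forall>v\<in>H_space \<Omega>. energy g v = half_deriv u v"
proof (rule H.Riesz_representation[OF H_complete])
  fix v assume v: "v \<in> H_space \<Omega>"
  have "\<bar>r * ip (pos_part u) v\<bar> \<le> r * (L2.nrm (pos_part u) * K * H.nrm v)"
    using ip_H_bound[OF pos_part_L2[OF sphereD(2)[OF u]] v] r by (simp add: abs_mult mult_left_mono)
  moreover have "\<bar>J u * ip u v\<bar> \<le> \<bar>J u\<bar> * (L2.nrm u * K * H.nrm v)"
    using ip_H_bound[OF sphereD(2)[OF u] v] by (simp add: abs_mult mult_left_mono)
  ultimately show "\<bar>half_deriv u v\<bar> \<le> (H.nrm u + M * L2.nrm u * K + r * (L2.nrm (pos_part u) * K)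
      + \<bar>J u\<bar> * (L2.nrm u * K)) * H.nrm v"
    using H.Cauchy_Schwarz[OF sphereD(1)[OF u] v] lower_H_bound[OF sphereD(2)[OF u] v]
    unfolding half_deriv_def distrib_right by (simp add: mult.assoc)
qed (rule half_deriv_lincomb[OF u])

definition grad :: "('a \<Rightarrow> real) \<Rightarrow> 'a \<Rightarrow> real" where
  "grad u = (SOME g. g \<in> H_space \<Omega> \<and> (\<forall>v\<in>H_space \<Omega>. energy g v = half_deriv u v))"

lemma grad:
  assumes "u \<in> P"
  shows "grad u \<in> H_space \<Omega>" "\<And>v. v \<in> H_space \<Omega> \<Longrightarrow> energy (grad u) v = half_deriv u v"
  using someI_ex[of "\<lambda>g. g \<in> H_space \<Omega> \<and> (\<forall>v\<in>H_space \<Omega>. energy g v = half_deriv u v)"]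
    half_deriv_representable[OF assms] unfolding grad_def[symmetric] by blast+

text \<open>
  The reciprocal of a bound for the quadratic form \<open>\<E>\<^sub>L(g, g) - J(u) \<integral> g\<^sup>2\<close> in terms of the energy of \<open>g\<close>,
  for all \<open>u\<close> on the sphere: only a lower bound for \<open>J(u)\<close> enters, so one step length serves the whole sphere.
\<close>

definition step :: real where
  "step = 1 / (1 + (2 * M + r) * K\<^sup>2)"

lemma step_pos: "0 < step"
  using r M by (auto simp: step_def intro!: add_pos_nonneg)

text \<open>
  The coefficients are written out so that the rules for linear combinations apply.
\<close>

definition descent_step :: "('a \<Rightarrow> real) \<Rightarrow> 'a \<Rightarrow> real" where
  "descent_step u = (\<lambda>x. 1 * u x + (- step) * grad u x)"

lemma descent_step_H: "u \<in> P \<Longrightarrow> descent_step u \<in> H_space \<Omega>"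
  unfolding descent_step_def by (intro H.lincomb_mem sphereD(1) grad(1))

lemma ip_descent_step:
  assumes "u \<in> P"
  shows "ip (descent_step u) (descent_step u) = 1 - 2 * step * ip u (grad u) + step\<^sup>2 * ip (grad u) (grad u)"
  unfolding descent_step_def L2.lincomb_square[OF sphereD(2)[OF assms] H_space_L2[OF grad(1)[OF assms]]]
  by (simp add: sphereD(4)[OF assms])

text \<open>
  The function \<open>t \<mapsto> (t\<^sup>+)\<^sup>2\<close> is convex and \<open>r \<ge> 0\<close>, so the nonquadratic part of \<open>J\<close> lies below its
  linearisation at \<open>u\<close>. The linear terms add up to \<open>- 2 s\<close> times the energy of the gradient, and by the choice of \<open>s\<close> the
  quadratic terms consume at most half of this.
\<close>

lemma J_descent_step:
  assumes u: "u \<in> P"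
  shows "J (descent_step u) \<le> J u * ip (descent_step u) (descent_step u) - step * energy (grad u) (grad u)"
proof -
  define g where "g = grad u"
  define w where "w = descent_step u"
  note uH = sphereD(1)[OF u] and uL = sphereD(2)[OF u]
  have gH: "g \<in> H_space \<Omega>" unfolding g_def by (rule grad(1)[OF u])
  note gL = H_space_L2[OF gH]
  have wH: "w \<in> H_space \<Omega>" unfolding w_def by (rule descent_step_H[OF u])
  have pp: "ip (pos_part u) (pos_part u) - 2 * step * ip (pos_part u) g \<le> ip (pos_part w) (pos_part w)"
  proof -
    note p = pos_part_L2[OF uL]
    have *: "a * a - 2 * step * (a * g x) \<le> b * b" if "a = pos_part u x" "b = pos_part w x" for a b x
    proof (cases "u x \<le> 0")
      case False
      then have a: "a = u x" "a > 0" using that by auto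
      have "a * (u x - step * g x) \<le> a * b"
        using a by (intro mult_left_mono) (auto simp: that w_def descent_step_def g_def)
      moreover have "0 \<le> (a - b) * (a - b)" by simp
      ultimately show ?thesis using a by (simp add: algebra_simps)
    qed (use that in simp)
    have "(LINT x|lborel. pos_part u x * pos_part u x - 2 * step * (pos_part u x * g x))
        \<le> (LINT x|lborel. pos_part w x * pos_part w x)"
      using L2_integrable_mult[OF p p] L2_integrable_mult[OF p gL]
        L2_integrable_mult[OF pos_part_L2[OF H_space_L2[OF wH]] pos_part_L2[OF H_space_L2[OF wH]]] *
      by (intro integral_mono) auto
    then show ?thesis
      using L2_integrable_mult[OF p p] L2_integrable_mult[OF p gL] by (simp add: ip_def)
  qed
  have Jw: "J w = energy w w + lower_form w w - r * ip (pos_part w) (pos_part w)" by (rule J_eq[OF wH])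
  have Ju: "energy u u = J u - lower_form u u + r * ip (pos_part u) (pos_part u)"
    using J_eq[OF uH] by simp
  have ew: "energy w w = energy u u - 2 * step * energy u g + step\<^sup>2 * energy g g"
    unfolding w_def descent_step_def g_def[symmetric] H.lincomb_square[OF uH gH] by simp
  have lw: "lower_form w w = lower_form u u - 2 * step * lower_form u g + step\<^sup>2 * lower_form g g"
    unfolding w_def descent_step_def g_def[symmetric] lower_form_square[OF uL gL] by simp
  have iw: "ip w w = 1 - 2 * step * ip u g + step\<^sup>2 * ip g g"
    unfolding w_def g_def by (rule ip_descent_step[OF u])
  have dg: "energy g g = energy u g + lower_form u g - r * ip (pos_part u) g - J u * ip u g"
    using grad(2)[OF u gH] by (simp add: g_def half_deriv_def)
  have rp: "r * (ip (pos_part u) (pos_part u) - 2 * step * ip (pos_part u) g) \<le> r * ip (pos_part w) (pos_part w)"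
    by (rule mult_left_mono[OF pp r])
  have "J w - J u * ip w w \<le> - 2 * step * energy g g + step\<^sup>2 * (energy g g + lower_form g g - J u * ip g g)"
    using rp unfolding Jw ew lw iw dg Ju by (simp add: algebra_simps)
  also have "\<dots> \<le> - 2 * step * energy g g + step\<^sup>2 * ((1 + (2 * M + r) * K\<^sup>2) * energy g g)"
  proof -
    have "lower_form g g \<le> M * ip g g"
      using lower_M[OF gL gL] L2.nrm_square[OF gL] by (simp add: power2_eq_square)
    moreover have "- J u * ip g g \<le> (M + r) * ip g g"
      using J_ge[OF u] L2.nonneg[OF gL] by (intro mult_right_mono) auto
    moreover have "(2 * M + r) * ip g g \<le> (2 * M + r) * (K\<^sup>2 * energy g g)"
      using power_mono[OF Poincare_K[OF gH] L2.nrm_nonneg[OF gL], of 2] M r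
      by (intro mult_left_mono) (auto simp: L2.nrm_square[OF gL] power_mult_distrib H.nrm_square[OF gH])
    ultimately have "energy g g + lower_form g g - J u * ip g g \<le> (1 + (2 * M + r) * K\<^sup>2) * energy g g"
      by (simp add: algebra_simps)
    then show ?thesis by (intro add_left_mono mult_left_mono) auto
  qed
  also have "\<dots> = - step * energy g g"
  proof -
    have "step * (1 + (2 * M + r) * K\<^sup>2) = 1"
      using step_pos by (simp add: step_def)
    then have "step\<^sup>2 * ((1 + (2 * M + r) * K\<^sup>2) * energy g g) = step * energy g g"
      by (metis mult.assoc mult.left_commute mult_1 power2_eq_square)
    then show ?thesis by simp
  qed
  finally show ?thesis by (simp add: g_def w_def)
qed

text \<open>
  By homogeneity the derivative vanishes in the direction \<open>u\<close> itself, so the gradient is energy orthogonal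
  to \<open>u\<close>, and the step cannot cancel \<open>u\<close>.
\<close>

lemma nrm_descent_step_pos:
  assumes u: "u \<in> P"
  shows "0 < L2.nrm (descent_step u)"
proof (rule ccontr)
  note wH = descent_step_H[OF u]
  assume "\<not> ?thesis"
  then have "L2.nrm (descent_step u) = 0" using L2.nrm_nonneg[OF H_space_L2[OF wH]] by simp
  then have "ip (descent_step u) (descent_step u) = 0" using L2.nrm_square[OF H_space_L2[OF wH]] by simp
  then have "energy (descent_step u) u = 0"
    by (intro energy_null ip_self_zero_AE[OF H_space_L2[OF wH]])
  moreover have "energy (descent_step u) u = energy u u"
    unfolding descent_step_def H.lincomb_left[OF sphereD(1)[OF u] grad(1)[OF u] sphereD(1)[OF u]]
    by (simp add: grad(2)[OF u sphereD(1)[OF u]] half_deriv_self[OF u])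
  ultimately have "H.nrm u = 0" by (simp add: H.nrm_def)
  then show False using Poincare_K[OF sphereD(1)[OF u]] sphereD(3)[OF u] by simp
qed

definition descent_map :: "('a \<Rightarrow> real) \<Rightarrow> 'a \<Rightarrow> real" where
  "descent_map u = normalize (descent_step u)"

lemma descent_map_P: "u \<in> P \<Longrightarrow> descent_map u \<in> P"
  unfolding descent_map_def using nrm_descent_step_pos[of u] by (intro normalize_sphere descent_step_H) auto

lemma J_descent_map:
  assumes u: "u \<in> P"
  shows "J (descent_map u) \<le> J u - step * energy (grad u) (grad u) / ip (descent_step u) (descent_step u)"
proof -
  let ?w = "descent_step u"
  have n: "0 < L2.nrm ?w" by (rule nrm_descent_step_pos[OF u])
  have i: "(L2.nrm ?w)\<^sup>2 = ip ?w ?w" by (rule L2.nrm_square[OF H_space_L2[OF descent_step_H[OF u]]])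
  then have ip: "0 < ip ?w ?w" using n by (metis zero_less_power)
  have "J (descent_map u) = J ?w / ip ?w ?w"
    unfolding descent_map_def normalize_def using J_scale[OF descent_step_H[OF u], of "1 / L2.nrm ?w"] n i
    by (simp add: power_divide)
  also have "\<dots> \<le> (J u * ip ?w ?w - step * energy (grad u) (grad u)) / ip ?w ?w"
    using J_descent_step[OF u] ip by (intro divide_right_mono) auto
  also have "\<dots> = J u - step * energy (grad u) (grad u) / ip ?w ?w"
    using ip by (simp add: diff_divide_distrib)
  finally show ?thesis .
qed

lemma ip_descent_step_le:
  assumes u: "u \<in> P"
  shows "ip (descent_step u) (descent_step u) \<le> 2 + 2 * step\<^sup>2 * K\<^sup>2 * energy (grad u) (grad u)"
proof -
  note gH = grad(1)[OF u]
  note gL = H_space_L2[OF gH]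
  have "0 \<le> ip (\<lambda>x. 1 * u x + step * grad u x) (\<lambda>x. 1 * u x + step * grad u x)"
    by (intro L2.nonneg[of _ \<Omega>] L2.lincomb_mem sphereD(2) u gL)
  then have "0 \<le> 1 + 2 * step * ip u (grad u) + step\<^sup>2 * ip (grad u) (grad u)"
    unfolding L2.lincomb_square[OF sphereD(2)[OF u] gL] by (simp add: sphereD(4)[OF u])
  then have "ip (descent_step u) (descent_step u) \<le> 2 + 2 * (step\<^sup>2 * ip (grad u) (grad u))"
    unfolding ip_descent_step[OF u] by simp
  also have "ip (grad u) (grad u) \<le> K\<^sup>2 * energy (grad u) (grad u)"
    using power_mono[OF Poincare_K[OF gH] L2.nrm_nonneg[OF gL], of 2]
    by (simp add: L2.nrm_square[OF gL] power_mult_distrib H.nrm_square[OF gH])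
  finally show ?thesis by (simp add: mult.assoc mult_left_mono)
qed

text \<open>
  This is what keeps the endpoints of a path in place.
\<close>

lemma descent_map_fixes_critical:
  assumes u: "u \<in> P" and crit: "\<And>v. v \<in> H_space \<Omega> \<Longrightarrow> half_deriv u v = 0"
  shows "AE x in lborel. descent_map u x = u x"
proof -
  note gH = grad(1)[OF u]
  note gL = H_space_L2[OF gH]
  have "energy (grad u) (grad u) = 0" using grad(2)[OF u gH] crit[OF gH] by simp
  then have "L2.nrm (grad u) = 0"
    using Poincare_K[OF gH] L2.nrm_nonneg[OF gL] by (simp add: H.nrm_def)
  then have g0: "ip (grad u) (grad u) = 0" using L2.nrm_square[OF gL] by simp
  then have "\<bar>ip u (grad u)\<bar> \<le> 0" using L2.Cauchy_Schwarz[OF sphereD(2)[OF u] gL] by (simp add: L2.nrm_def)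
  then have "L2.nrm (descent_step u) = 1" by (simp add: L2.nrm_def ip_descent_step[OF u] g0)
  then show ?thesis
    using ip_self_zero_AE[OF gL g0] by (simp add: descent_map_def normalize_def descent_step_def)
qed

section \<open>Continuity of the descent map and admissible paths\<close>

lemma lower_form_diff_bound:
  assumes X: "X \<in> P" and u: "u \<in> P"
  shows "\<bar>lower_form X X - lower_form u u\<bar> \<le> 2 * M * L2.nrm (\<lambda>x. X x - u x)"
proof -
  note XL = sphereD(2)[OF X] and uL = sphereD(2)[OF u]
  note dL = L2.diff_mem[OF XL uL]
  have "lower_form X X - lower_form u u = lower_form (\<lambda>x. X x - u x) X + lower_form (\<lambda>x. X x - u x) u"
    using lower_form_diff[OF XL uL XL] lower_form_diff[OF XL uL uL] lower_form_sym[OF XL uL] by simp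
  then show ?thesis
    using lower_M[OF dL XL] lower_M[OF dL uL] sphereD(3)[OF X] sphereD(3)[OF u] by simp
qed

lemma ip_pos_part_diff_bound:
  assumes X: "X \<in> P" and u: "u \<in> P"
  shows "\<bar>ip (pos_part X) (pos_part X) - ip (pos_part u) (pos_part u)\<bar> \<le> 2 * L2.nrm (\<lambda>x. X x - u x)"
proof -
  note XL = sphereD(2)[OF X] and uL = sphereD(2)[OF u]
  note pX = pos_part_L2[OF XL] and pu = pos_part_L2[OF uL]
  note dL = L2.diff_mem[OF pX pu]
  have n: "L2.nrm (pos_part X) \<le> 1" "L2.nrm (pos_part u) \<le> 1"
    using pos_part_le[OF XL] pos_part_le[OF uL] sphereD(3)[OF X] sphereD(3)[OF u] by auto
  have b: "\<bar>ip (\<lambda>x. pos_part X x - pos_part u x) w\<bar> \<le> L2.nrm (\<lambda>x. X x - u x)"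
    if w: "w \<in> L2_space \<Omega>" "L2.nrm w \<le> 1" for w
  proof -
    have "\<bar>ip (\<lambda>x. pos_part X x - pos_part u x) w\<bar> \<le> L2.nrm (\<lambda>x. pos_part X x - pos_part u x) * L2.nrm w"
      by (rule L2.Cauchy_Schwarz[OF dL w(1)])
    also have "\<dots> \<le> L2.nrm (\<lambda>x. X x - u x) * 1"
      using pos_part_diff_le[OF XL uL] w(2) L2.nrm_nonneg[OF w(1)] L2.nrm_nonneg[OF L2.diff_mem[OF XL uL]]
      by (intro mult_mono) auto
    finally show ?thesis by simp
  qed
  have "ip (pos_part X) (pos_part X) - ip (pos_part u) (pos_part u)
      = ip (\<lambda>x. pos_part X x - pos_part u x) (pos_part X) + ip (\<lambda>x. pos_part X x - pos_part u x) (pos_part u)"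
    using L2.diff_left[OF pX pu pX] L2.diff_left[OF pX pu pu] L2.sym[OF pX pu] by simp
  then show ?thesis using b[OF pX n(1)] b[OF pu n(2)] by simp
qed

lemma L2_convergence:
  assumes X: "\<And>n. X n \<in> H_space \<Omega>" and u: "u \<in> H_space \<Omega>"
    and lim: "(\<lambda>n. H.nrm (\<lambda>x. X n x - u x)) \<longlonglongrightarrow> 0"
  shows "(\<lambda>n. L2.nrm (\<lambda>x. X n x - u x)) \<longlonglongrightarrow> 0"
proof (rule Lim_null_comparison)
  show "(\<lambda>n. K * H.nrm (\<lambda>x. X n x - u x)) \<longlonglongrightarrow> 0"
    using tendsto_mult_left[OF lim, of K] by simp
  show "\<forall>\<^sub>F n in sequentially. norm (L2.nrm (\<lambda>x. X n x - u x)) \<le> K * H.nrm (\<lambda>x. X n x - u x)"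
    using Poincare_K[OF H.diff_mem[OF X u]] L2.nrm_nonneg[OF H_space_L2[OF H.diff_mem[OF X u]]] by simp
qed

lemma nrm_convergence:
  assumes X: "\<And>n. X n \<in> H_space \<Omega>" and u: "u \<in> H_space \<Omega>"
    and lim: "(\<lambda>n. H.nrm (\<lambda>x. X n x - u x)) \<longlonglongrightarrow> 0"
  shows "(\<lambda>n. H.nrm (X n)) \<longlonglongrightarrow> H.nrm u" "(\<lambda>n. L2.nrm (X n)) \<longlonglongrightarrow> L2.nrm u"
proof -
  have "(\<lambda>n. H.nrm (X n) - H.nrm u) \<longlonglongrightarrow> 0"
    by (rule Lim_null_comparison[OF _ lim]) (use H.nrm_diff_le[OF X u] in simp)
  then show "(\<lambda>n. H.nrm (X n)) \<longlonglongrightarrow> H.nrm u" by (simp add: LIM_zero_iff)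
  have "(\<lambda>n. L2.nrm (X n) - L2.nrm u) \<longlonglongrightarrow> 0"
    by (rule Lim_null_comparison[OF _ L2_convergence[OF X u lim]])
      (use L2.nrm_diff_le[OF H_space_L2[OF X] H_space_L2[OF u]] in simp)
  then show "(\<lambda>n. L2.nrm (X n)) \<longlonglongrightarrow> L2.nrm u" by (simp add: LIM_zero_iff)
qed

lemma J_convergence:
  assumes X: "\<And>n. X n \<in> P" and u: "u \<in> P"
    and lim: "(\<lambda>n. H.nrm (\<lambda>x. X n x - u x)) \<longlonglongrightarrow> 0"
  shows "(\<lambda>n. J (X n)) \<longlonglongrightarrow> J u"
proof -
  note L2 = L2_convergence[OF sphereD(1)[OF X] sphereD(1)[OF u] lim]
  have "(\<lambda>n. (H.nrm (X n))\<^sup>2) \<longlonglongrightarrow> (H.nrm u)\<^sup>2"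
    by (intro tendsto_power nrm_convergence(1) sphereD(1) X u lim)
  then have 1: "(\<lambda>n. energy (X n) (X n)) \<longlonglongrightarrow> energy u u"
    by (simp add: H.nrm_square[OF sphereD(1)[OF X]] H.nrm_square[OF sphereD(1)[OF u]])
  have "(\<lambda>n. lower_form (X n) (X n) - lower_form u u) \<longlonglongrightarrow> 0"
    by (rule Lim_null_comparison[where g = "\<lambda>n. 2 * M * L2.nrm (\<lambda>x. X n x - u x)"])
      (use lower_form_diff_bound[OF X u] tendsto_mult_left[OF L2, of "2 * M"] in simp_all)
  then have 2: "(\<lambda>n. lower_form (X n) (X n)) \<longlonglongrightarrow> lower_form u u" by (simp add: LIM_zero_iff)
  have "(\<lambda>n. ip (pos_part (X n)) (pos_part (X n)) - ip (pos_part u) (pos_part u)) \<longlonglongrightarrow> 0"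
    by (rule Lim_null_comparison[where g = "\<lambda>n. 2 * L2.nrm (\<lambda>x. X n x - u x)"])
      (use ip_pos_part_diff_bound[OF X u] tendsto_mult_left[OF L2, of "2"] in simp_all)
  then have 3: "(\<lambda>n. ip (pos_part (X n)) (pos_part (X n))) \<longlonglongrightarrow> ip (pos_part u) (pos_part u)"
    by (simp add: LIM_zero_iff)
  show ?thesis
    unfolding J_eq[OF sphereD(1)[OF X]] J_eq[OF sphereD(1)[OF u]] by (intro tendsto_intros 1 2 3)
qed

text \<open>
  Testing the difference of the two representing equations with the difference \<open>h\<close> of the gradients gives
  an estimate of the squared norm of \<open>h\<close> that is linear in its norm.
\<close>

lemma grad_diff_bound:
  assumes X: "X \<in> P" and u: "u \<in> P"
  defines "d \<equiv> H.nrm (\<lambda>x. X x - u x)"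
  shows "H.nrm (\<lambda>x. grad X x - grad u x)
    \<le> d + M * (K * d) * K + r * (K * d * K) + \<bar>J X\<bar> * (K * d * K) + \<bar>J X - J u\<bar> * K"
    (is "_ \<le> ?a")
proof -
  note XH = sphereD(1)[OF X] and uH = sphereD(1)[OF u] and XL = sphereD(2)[OF X] and uL = sphereD(2)[OF u]
  note gX = grad[OF X] and gu = grad[OF u]
  let ?h = "\<lambda>x. grad X x - grad u x"
  let ?D = "\<lambda>x. X x - u x"
  let ?Q = "\<lambda>x. pos_part X x - pos_part u x"
  have hH: "?h \<in> H_space \<Omega>" by (intro H.diff_mem gX(1) gu(1))
  note hL = H_space_L2[OF hH]
  have DH: "?D \<in> H_space \<Omega>" by (intro H.diff_mem XH uH)
  note DL = H_space_L2[OF DH]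
  have QL: "?Q \<in> L2_space \<Omega>" by (intro L2.diff_mem pos_part_L2 XL uL)
  have h0: "0 \<le> H.nrm ?h" by (rule H.nrm_nonneg[OF hH])
  have d0: "0 \<le> d" unfolding d_def by (rule H.nrm_nonneg[OF DH])
  have Dd: "L2.nrm ?D \<le> K * d" unfolding d_def by (rule Poincare_K[OF DH])
  have Qd: "L2.nrm ?Q \<le> K * d" using pos_part_diff_le[OF XL uL] Dd by simp
  have e: "(H.nrm ?h)\<^sup>2 = half_deriv X ?h - half_deriv u ?h"
    using H.nrm_square[OF hH] H.diff_left[OF gX(1) gu(1) hH] gX(2)[OF hH] gu(2)[OF hH] by simp
  also have "\<dots> = energy ?D ?h + lower_form ?D ?h - r * ip ?Q ?h - J X * ip ?D ?h - (J X - J u) * ip u ?h"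
    unfolding half_deriv_def H.diff_left[OF XH uH hH] lower_form_diff[OF XL uL hL] L2.diff_left[OF XL uL hL]
      L2.diff_left[OF pos_part_L2[OF XL] pos_part_L2[OF uL] hL]
    by (simp add: algebra_simps)
  also have "\<dots> \<le> d * H.nrm ?h + M * (K * d) * K * H.nrm ?h + r * (K * d * K * H.nrm ?h)
      + \<bar>J X\<bar> * (K * d * K * H.nrm ?h) + \<bar>J X - J u\<bar> * (K * H.nrm ?h)"
  proof -
    have 1: "energy ?D ?h \<le> d * H.nrm ?h"
      unfolding d_def using H.Cauchy_Schwarz[OF DH hH] by simp
    have 2: "lower_form ?D ?h \<le> M * (K * d) * K * H.nrm ?h"
    proof -
      have "M * L2.nrm ?D * K * H.nrm ?h \<le> M * (K * d) * K * H.nrm ?h"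
        using Dd M K h0 by (intro mult_right_mono mult_left_mono) auto
      then show ?thesis using lower_H_bound[OF DL hH] by simp
    qed
    have Kb: "\<bar>ip w ?h\<bar> \<le> B * K * H.nrm ?h" if "w \<in> L2_space \<Omega>" "L2.nrm w \<le> B" for w B
    proof -
      have "L2.nrm w * K * H.nrm ?h \<le> B * K * H.nrm ?h"
        using that(2) K h0 by (intro mult_right_mono) auto
      then show ?thesis using ip_H_bound[OF that(1) hH] by simp
    qed
    have 3: "- (r * ip ?Q ?h) \<le> r * (K * d * K * H.nrm ?h)"
      using mult_left_mono[OF Kb[OF QL Qd] r] r abs_ge_minus_self[of "r * ip ?Q ?h"] by (simp add: abs_mult)
    have 4: "- (J X * ip ?D ?h) \<le> \<bar>J X\<bar> * (K * d * K * H.nrm ?h)"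
      using mult_left_mono[OF Kb[OF DL Dd] abs_ge_zero[of "J X"]] abs_ge_minus_self[of "J X * ip ?D ?h"]
      by (simp add: abs_mult)
    have 5: "- ((J X - J u) * ip u ?h) \<le> \<bar>J X - J u\<bar> * (K * H.nrm ?h)"
      using mult_left_mono[OF Kb[OF uL, of 1] abs_ge_zero[of "J X - J u"]] sphereD(3)[OF u]
        abs_ge_minus_self[of "(J X - J u) * ip u ?h"]
      by (simp add: abs_mult)
    show ?thesis using 1 2 3 4 5 by linarith
  qed
  also have "\<dots> = ?a * H.nrm ?h" by (simp add: algebra_simps)
  finally have "H.nrm ?h * H.nrm ?h \<le> ?a * H.nrm ?h" by (simp add: power2_eq_square)
  moreover have "0 \<le> ?a" using d0 M K r by simp
  ultimately show ?thesis using h0 by (cases "H.nrm ?h = 0") auto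
qed

lemma normalize_convergence:
  assumes X: "\<And>n. X n \<in> H_space \<Omega>" and u: "u \<in> H_space \<Omega>" "L2.nrm u \<noteq> 0"
    and lim: "(\<lambda>n. H.nrm (\<lambda>x. X n x - u x)) \<longlonglongrightarrow> 0"
  shows "(\<lambda>n. H.nrm (\<lambda>x. normalize (X n) x - normalize u x)) \<longlonglongrightarrow> 0"
proof -
  let ?c = "\<lambda>n. 1 / L2.nrm (X n)" and ?b = "1 / L2.nrm u"
  have c: "?c \<longlonglongrightarrow> ?b"
    using nrm_convergence(2)[OF X u(1) lim] u(2) by (intro tendsto_intros)
  show ?thesis
  proof (rule Lim_null_comparison)
    have "(\<lambda>n. \<bar>?c n\<bar> * H.nrm (\<lambda>x. X n x - u x) + \<bar>?c n - ?b\<bar> * H.nrm u)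
        \<longlonglongrightarrow> \<bar>?b\<bar> * 0 + \<bar>?b - ?b\<bar> * H.nrm u"
      by (intro tendsto_intros c lim)
    then show "(\<lambda>n. \<bar>?c n\<bar> * H.nrm (\<lambda>x. X n x - u x) + \<bar>?c n - ?b\<bar> * H.nrm u) \<longlonglongrightarrow> 0"
      by simp
    have "H.nrm (\<lambda>x. normalize (X n) x - normalize u x)
        \<le> \<bar>?c n\<bar> * H.nrm (\<lambda>x. X n x - u x) + \<bar>?c n - ?b\<bar> * H.nrm u" for n
    proof -
      have "(\<lambda>x. normalize (X n) x - normalize u x) = (\<lambda>x. ?c n * (X n x - u x) + (?c n - ?b) * u x)"
        by (simp add: normalize_def fun_eq_iff algebra_simps diff_divide_distrib)
      then show ?thesis using H.nrm_lincomb_le[OF H.diff_mem[OF X[of n] u(1)] u(1), of "?c n" "?c n - ?b"] by simp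
    qed
    then show "\<forall>\<^sub>F n in sequentially. norm (H.nrm (\<lambda>x. normalize (X n) x - normalize u x))
        \<le> \<bar>?c n\<bar> * H.nrm (\<lambda>x. X n x - u x) + \<bar>?c n - ?b\<bar> * H.nrm u"
    proof -
      have "normalize (X n) \<in> H_space \<Omega>" "normalize u \<in> H_space \<Omega>" for n
        unfolding normalize_def by (intro H.scale_mem X u)+
      from H.nrm_nonneg[OF H.diff_mem[OF this]]
      have "0 \<le> H.nrm (\<lambda>x. normalize (X n) x - normalize u x)" for n .
      then show ?thesis
        using \<open>\<And>n. H.nrm (\<lambda>x. normalize (X n) x - normalize u x)
          \<le> \<bar>?c n\<bar> * H.nrm (\<lambda>x. X n x - u x) + \<bar>?c n - ?b\<bar> * H.nrm u\<close> by simp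
    qed
  qed
qed

lemma descent_map_convergence:
  assumes X: "\<And>n. X n \<in> P" and u: "u \<in> P"
    and lim: "(\<lambda>n. H.nrm (\<lambda>x. X n x - u x)) \<longlonglongrightarrow> 0"
  shows "(\<lambda>n. H.nrm (\<lambda>x. descent_map (X n) x - descent_map u x)) \<longlonglongrightarrow> 0"
  unfolding descent_map_def
proof (rule normalize_convergence)
  show "L2.nrm (descent_step u) \<noteq> 0" using nrm_descent_step_pos[OF u] by simp
  let ?d = "\<lambda>n. H.nrm (\<lambda>x. X n x - u x)"
  let ?e = "\<lambda>n. H.nrm (\<lambda>x. grad (X n) x - grad u x)"
  let ?a = "\<lambda>n. ?d n + M * (K * ?d n) * K + r * (K * ?d n * K) + \<bar>J (X n)\<bar> * (K * ?d n * K) + \<bar>J (X n) - J u\<bar> * K"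
  have "?a \<longlonglongrightarrow> 0 + M * (K * 0) * K + r * (K * 0 * K) + \<bar>J u\<bar> * (K * 0 * K) + \<bar>J u - J u\<bar> * K"
    by (intro tendsto_intros lim J_convergence[OF X u lim])
  then have a: "?a \<longlonglongrightarrow> 0" by simp
  have e0: "0 \<le> ?e n" for n by (rule H.nrm_nonneg[OF H.diff_mem[OF grad(1)[OF X] grad(1)[OF u]]])
  have e: "?e \<longlonglongrightarrow> 0"
    by (rule Lim_null_comparison[OF _ a]) (use e0 grad_diff_bound[OF X u] in simp)
  show "(\<lambda>n. H.nrm (\<lambda>x. descent_step (X n) x - descent_step u x)) \<longlonglongrightarrow> 0"
  proof (rule Lim_null_comparison)
    show "(\<lambda>n. ?d n + step * ?e n) \<longlonglongrightarrow> 0"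
      using tendsto_add[OF lim tendsto_mult_left[OF e, of step]] by simp
    have "norm (H.nrm (\<lambda>x. descent_step (X n) x - descent_step u x)) \<le> ?d n + step * ?e n" for n
    proof -
      have "(\<lambda>x. descent_step (X n) x - descent_step u x)
          = (\<lambda>x. 1 * (X n x - u x) + (- step) * (grad (X n) x - grad u x))"
        by (simp add: descent_step_def fun_eq_iff algebra_simps)
      moreover have "H.nrm (\<lambda>x. 1 * (X n x - u x) + (- step) * (grad (X n) x - grad u x))
          \<le> \<bar>1\<bar> * ?d n + \<bar>- step\<bar> * ?e n"
        by (intro H.nrm_lincomb_le[of _ \<Omega>] H.diff_mem sphereD(1) X u grad(1))
      moreover have "0 \<le> H.nrm (\<lambda>x. descent_step (X n) x - descent_step u x)"
        by (rule H.nrm_nonneg[OF H.diff_mem[OF descent_step_H[OF X] descent_step_H[OF u]]])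
      ultimately show ?thesis using step_pos by simp
    qed
    then show "\<forall>\<^sub>F n in sequentially. norm (H.nrm (\<lambda>x. descent_step (X n) x - descent_step u x)) \<le> ?d n + step * ?e n"
      by simp
  qed
qed (intro descent_step_H X u)+

text \<open>
  Sequences within the parameter interval stay on the sphere for all indices, which the convergence
  lemmas ask for; the filter version would hold only eventually.
\<close>

lemma path_continuous_iff:
  fixes p :: "real \<Rightarrow> 'a \<Rightarrow> real"
  shows "((\<lambda>t. H_norm (\<lambda>x. p t x - p s x)) \<longlongrightarrow> 0) (at s within T) \<longleftrightarrow>
    (\<forall>X. (\<forall>i. X i \<in> T - {s}) \<longrightarrow> X \<longlonglongrightarrow> s \<longrightarrow> (\<lambda>i. H.nrm (\<lambda>x. p (X i) x - p s x)) \<longlonglongrightarrow> 0)"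
  unfolding tendsto_at_iff_sequentially H_norm_eq_nrm comp_def ..

lemma descent_map_path:
  assumes p: "p \<in> admissible_paths \<Omega> \<phi>"
    and crit: "\<And>u v. u \<in> P \<Longrightarrow> (AE x in lborel. u x = \<phi> x) \<or> (AE x in lborel. u x = - \<phi> x)
      \<Longrightarrow> v \<in> H_space \<Omega> \<Longrightarrow> half_deriv u v = 0"
  shows "(\<lambda>t. descent_map (p t)) \<in> admissible_paths \<Omega> \<phi>"
proof -
  have pP: "\<And>t. t \<in> {-1..1} \<Longrightarrow> p t \<in> P"
    and cont: "\<And>s. s \<in> {-1..1} \<Longrightarrow> ((\<lambda>t. H_norm (\<lambda>x. p t x - p s x)) \<longlongrightarrow> 0) (at s within {-1..1})"
    and ends: "AE x in lborel. p (-1) x = - \<phi> x" "AE x in lborel. p 1 x = \<phi> x"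
    using p by (auto simp: admissible_paths_def)
  have "((\<lambda>t. H_norm (\<lambda>x. descent_map (p t) x - descent_map (p s) x)) \<longlongrightarrow> 0) (at s within {-1..1})"
    if s: "s \<in> {-1..1}" for s
    using cont[OF s] unfolding path_continuous_iff[where p = p] path_continuous_iff[where p = "\<lambda>t. descent_map (p t)"]
    using pP s by (auto intro!: descent_map_convergence)
  moreover have "AE x in lborel. descent_map (p (-1)) x = - \<phi> x"
  proof -
    have "AE x in lborel. descent_map (p (-1)) x = p (-1) x"
      by (rule descent_map_fixes_critical[OF pP]) (use pP ends(1) in \<open>auto intro!: crit\<close>)
    then show ?thesis using ends(1) by eventually_elim simp
  qed
  moreover have "AE x in lborel. descent_map (p 1) x = \<phi> x"
  proof -
    have "AE x in lborel. descent_map (p 1) x = p 1 x"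
      by (rule descent_map_fixes_critical[OF pP]) (use pP ends(2) in \<open>auto intro!: crit\<close>)
    then show ?thesis using ends(2) by eventually_elim simp
  qed
  ultimately show ?thesis
    using pP descent_map_P by (simp add: admissible_paths_def)
qed

lemma J_bdd_above_path:
  assumes p: "p \<in> admissible_paths \<Omega> \<phi>"
  shows "bdd_above (J ` p ` {-1..1})"
proof -
  have pP: "\<And>t. t \<in> {-1..1} \<Longrightarrow> p t \<in> P"
    and cont: "\<And>s. s \<in> {-1..1} \<Longrightarrow> ((\<lambda>t. H_norm (\<lambda>x. p t x - p s x)) \<longlongrightarrow> 0) (at s within {-1..1})"
    using p by (auto simp: admissible_paths_def)
  have "continuous_on {-1..1} (\<lambda>t. J (p t))"
    unfolding continuous_on_def
  proof
    fix s :: real assume s: "s \<in> {-1..1}"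
    show "((\<lambda>t. J (p t)) \<longlongrightarrow> J (p s)) (at s within {-1..1})"
      unfolding tendsto_at_iff_sequentially comp_def
      using cont[OF s] unfolding path_continuous_iff
      using pP s by (auto intro!: J_convergence)
  qed
  then have "compact ((\<lambda>t. J (p t)) ` {-1..1})"
    by (rule compact_continuous_image) simp
  then show ?thesis by (simp add: image_image bounded_imp_bdd_above compact_imp_bounded)
qed

lemma path_sup_ge:
  assumes p: "p \<in> admissible_paths \<Omega> \<phi>"
  shows "- M - r \<le> (SUP u\<in>p ` {-1..1}. J u)"
proof -
  have "p 1 \<in> P" using p by (auto simp: admissible_paths_def)
  then have "- M - r \<le> J (p 1)" by (rule J_ge)
  also have "\<dots> \<le> (SUP u\<in>p ` {-1..1}. J u)"
    by (intro cSUP_upper J_bdd_above_path[OF p]) auto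
  finally show ?thesis .
qed

text \<open>
  Compare an almost optimal path with its image under the descent map, whose supremum is still at least \<open>c\<close>.
  At a point where the image is almost at that height, the descent was short.
\<close>

lemma almost_critical_point:
  assumes ne: "admissible_paths \<Omega> \<phi> \<noteq> {}"
    and crit: "\<And>u v. u \<in> P \<Longrightarrow> (AE x in lborel. u x = \<phi> x) \<or> (AE x in lborel. u x = - \<phi> x)
      \<Longrightarrow> v \<in> H_space \<Omega> \<Longrightarrow> half_deriv u v = 0"
    and e: "0 < e" "8 * e * step * K\<^sup>2 \<le> 1"
  defines "c \<equiv> minimax_level \<Omega> \<phi> r"
  shows "\<exists>u\<in>P. \<bar>J u - c\<bar> < e \<and> energy (grad u) (grad u) \<le> 8 * e / step"
proof -
  let ?\<Gamma> = "admissible_paths \<Omega> \<phi>"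
  let ?S = "\<lambda>p. SUP u\<in>p ` {-1..1}. J u"
  have c: "c = (INF p\<in>?\<Gamma>. ?S p)" by (simp add: c_def minimax_level_def)
  have "Inf (?S ` ?\<Gamma>) < c + e" using e by (simp add: c)
  then obtain p where p: "p \<in> ?\<Gamma>" "?S p < c + e"
    using ne cInf_lessD[of "?S ` ?\<Gamma>"] by blast
  define q where "q = (\<lambda>t. descent_map (p t))"
  have q: "q \<in> ?\<Gamma>" unfolding q_def by (rule descent_map_path[OF p(1) crit])
  have "c \<le> ?S q"
    unfolding c by (rule cINF_lower[OF bdd_belowI2[of _ "- M - r"] q]) (rule path_sup_ge)
  then have "c - e < ?S q" using e by simp
  then obtain t where t: "t \<in> {-1..1}" "c - e < J (q t)"
    using less_cSUP_iff[of "q ` {-1..1}" J "c - e"] J_bdd_above_path[OF q] by auto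
  define u where "u = p t"
  have u: "u \<in> P" using p(1) t(1) by (auto simp: admissible_paths_def u_def)
  have "J u \<le> ?S p"
    unfolding u_def using t(1) by (intro cSUP_upper J_bdd_above_path[OF p(1)]) auto
  then have Ju: "J u < c + e" using p(2) by simp
  define G W where "G = energy (grad u) (grad u)" and "W = ip (descent_step u) (descent_step u)"
  have G: "0 \<le> G" unfolding G_def by (rule H.nonneg[OF grad(1)[OF u]])
  have W: "0 < W"
    using nrm_descent_step_pos[OF u] L2.nrm_square[OF H_space_L2[OF descent_step_H[OF u]]]
    by (metis W_def zero_less_power)
  have J1: "c - e < J u - step * G / W"
    using t(2) J_descent_map[OF u] by (simp add: q_def u_def[symmetric] G_def W_def)
  have GW: "0 \<le> step * G / W" using step_pos G W by simp
  have "step * G / W < 2 * e" using J1 Ju by simp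
  then have "step * G \<le> 2 * e * W" using W by (simp add: field_simps)
  also have "\<dots> \<le> 2 * e * (2 + 2 * step\<^sup>2 * K\<^sup>2 * G)"
    using ip_descent_step_le[OF u] e by (intro mult_left_mono) (auto simp: G_def W_def)
  \<comment> \<open>normalisation divides by \<open>W\<close>, which itself grows with \<open>G\<close>; for small \<open>e\<close> that growth is absorbed\<close>
  also have "\<dots> = 4 * e + (8 * e * step * K\<^sup>2) * (step * G / 2)"
    by (simp add: power2_eq_square algebra_simps)
  also have "\<dots> \<le> 4 * e + 1 * (step * G / 2)"
    using e(2) step_pos G by (intro add_left_mono mult_right_mono) auto
  finally have "step * G \<le> 8 * e" by simp
  then have "G \<le> 8 * e / step" using step_pos by (simp add: field_simps)
  then show ?thesis using u Ju J1 GW unfolding G_def by (intro bexI[of _ u]) auto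
qed

section \<open>Critical points at the minimax level\<close>

lemma forms_AE_cong:
  assumes u: "u \<in> H_space \<Omega>" and w: "w \<in> H_space \<Omega>" and v: "v \<in> H_space \<Omega>"
    and ae: "AE x in lborel. u x = w x"
  shows "energy u v = energy w v" "lower_form u v = lower_form w v" "ip u v = ip w v"
proof -
  have d: "AE x in lborel. u x - w x = 0" using ae by eventually_elim simp
  show "energy u v = energy w v" using energy_null[OF d, of v] H.diff_left[OF u w v] by simp
  note L = H_space_L2[OF u] H_space_L2[OF w] H_space_L2[OF v]
  have "\<bar>lower_form (\<lambda>x. u x - w x) v\<bar> \<le> 0" "\<bar>ip (\<lambda>x. u x - w x) v\<bar> \<le> 0"
    using lower_M[OF L2.diff_mem[OF L(1,2)] L(3)] L2.Cauchy_Schwarz[OF L2.diff_mem[OF L(1,2)] L(3)]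
      L2_nrm_AE_zero[OF d] by simp_all
  then show "lower_form u v = lower_form w v" "ip u v = ip w v"
    using lower_form_diff[OF L] L2.diff_left[OF L] by simp_all
qed

text \<open>
  For a function of one sign, taking the positive part acts as multiplication by \<open>a = 1\<close> or \<open>a = 0\<close>, and
  the term with \<open>r\<close> only shifts the eigenvalue.
\<close>

lemma one_sided_eigenfunction_critical:
  assumes u: "u \<in> P"
    and eig: "\<And>v. v \<in> H_space \<Omega> \<Longrightarrow> energy u v + lower_form u v = l * ip u v"
    and pos: "\<And>v. v \<in> L2_space \<Omega> \<Longrightarrow> ip (pos_part u) v = a * ip u v"
    and v: "v \<in> H_space \<Omega>"
  shows "half_deriv u v = 0"
proof -
  have Ju: "J u = l - r * a"
    using J_eq[OF sphereD(1)[OF u]] eig[OF sphereD(1)[OF u]] pos[OF sphereD(2)[OF u]] sphereD(4)[OF u] ip_pos_part[of u]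
    by simp
  have "J u * ip u v = l * ip u v - r * (a * ip u v)" unfolding Ju by (simp add: algebra_simps)
  then show ?thesis using eig[OF v] pos[OF H_space_L2[OF v]] by (simp add: half_deriv_def)
qed

lemma eigenfunction_critical:
  assumes \<phi>: "first_eigenfunction \<Omega> \<phi>"
    and u: "u \<in> P" and ae: "(AE x in lborel. u x = \<phi> x) \<or> (AE x in lborel. u x = - \<phi> x)"
    and v: "v \<in> H_space \<Omega>"
  shows "half_deriv u v = 0"
proof -
  define l where "l = first_eigenvalue \<Omega>"
  have \<phi>P: "\<phi> \<in> P" and pos: "AE x in lborel. x \<in> \<Omega> \<longrightarrow> \<phi> x > 0"
    using \<phi> by (auto simp: first_eigenfunction_def)
  note \<phi>H = sphereD(1)[OF \<phi>P]
  have e: "energy \<phi> v + lower_form \<phi> v = l * ip \<phi> v" if "v \<in> H_space \<Omega>" for v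
  proof -
    have "(LINT x:\<Omega>|lborel. \<phi> x * v x) = ip \<phi> v"
      by (rule set_integral_eq_ip) (use H_spaceD(2)[OF \<phi>H] in auto)
    then show ?thesis using \<phi> that by (auto simp: first_eigenfunction_def energy_L_eq l_def)
  qed
  have nonneg: "AE x in lborel. 0 \<le> \<phi> x"
    using pos by eventually_elim (use H_spaceD(2)[OF \<phi>H] in fastforce)
  from ae show ?thesis
  proof
    assume ae: "AE x in lborel. u x = \<phi> x"
    show ?thesis
    proof (rule one_sided_eigenfunction_critical[OF u _ _ v])
      show "energy u v + lower_form u v = l * ip u v" if "v \<in> H_space \<Omega>" for v
        using e[OF that] forms_AE_cong[OF sphereD(1)[OF u] \<phi>H that ae] by simp
      show "ip (pos_part u) v = 1 * ip u v" if "v \<in> L2_space \<Omega>" for v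
      proof -
        have "ip (pos_part u) v = ip u v" unfolding ip_def
        proof (rule integral_cong_AE)
          show "AE x in lborel. pos_part u x * v x = u x * v x"
            using ae nonneg by eventually_elim simp
        qed (use L2_spaceD(1)[OF sphereD(2)[OF u]] L2_spaceD(1)[OF that] in measurable)
        then show ?thesis by simp
      qed
    qed
  next
    assume "AE x in lborel. u x = - \<phi> x"
    then have ae: "AE x in lborel. u x = -1 * \<phi> x" by simp
    show ?thesis
    proof (rule one_sided_eigenfunction_critical[OF u _ _ v])
      show "energy u v + lower_form u v = l * ip u v" if "v \<in> H_space \<Omega>" for v
        using e[OF that] forms_AE_cong[OF sphereD(1)[OF u] H.scale_mem[OF \<phi>H] that ae]
          H.scale_left[OF \<phi>H that, of "-1"] L2.scale_left[OF H_space_L2[OF \<phi>H] H_space_L2[OF that], of "-1"]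
          lower_form_scale[OF H_space_L2[OF \<phi>H] H_space_L2[OF that], of "-1"]
        by simp
      show "ip (pos_part u) v = 0 * ip u v" if "v \<in> L2_space \<Omega>" for v
      proof -
        have "ip (pos_part u) v = 0" unfolding ip_def
        proof (rule integral_eq_zero_AE)
          show "AE x in lborel. pos_part u x * v x = 0"
            using ae nonneg by eventually_elim simp
        qed
        then show ?thesis by simp
      qed
    qed
  qed
qed

text \<open>
  The polygon from \<open>- \<phi>\<close> through \<open>\<psi>\<close> to \<open>\<phi>\<close> avoids the origin by independence, so it can be projected to the
  sphere.
\<close>

lemma admissible_paths_nonempty:
  assumes ne: "\<Omega> \<noteq> {}" and \<phi>: "first_eigenfunction \<Omega> \<phi>"
  shows "admissible_paths \<Omega> \<phi> \<noteq> {}"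
proof -
  have \<phi>P: "\<phi> \<in> P" and pos: "AE x in lborel. x \<in> \<Omega> \<longrightarrow> \<phi> x > 0"
    using \<phi> by (auto simp: first_eigenfunction_def)
  note \<phi>H = sphereD(1)[OF \<phi>P]
  obtain \<psi> where \<psi>: "\<psi> \<in> H_space \<Omega>"
    and indep: "\<And>a b. (AE x in lborel. a * \<phi> x + b * \<psi> x = 0) \<Longrightarrow> a = 0 \<and> b = 0"
    using exists_independent[OF ne pos] by blast
  define q where "q t = (\<lambda>x. t * \<phi> x + (1 - \<bar>t\<bar>) * \<psi> x)" for t :: real
  have qH: "q t \<in> H_space \<Omega>" for t unfolding q_def by (rule H.lincomb_mem[OF \<phi>H \<psi>])
  have q0: "L2.nrm (q t) \<noteq> 0" for t
  proof
    assume "L2.nrm (q t) = 0"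
    then have "ip (q t) (q t) = 0" using L2.nrm_square[OF H_space_L2[OF qH[of t]]] by simp
    then have "AE x in lborel. q t x = 0" by (rule ip_self_zero_AE[OF H_space_L2[OF qH]])
    then show False using indep[of t "1 - \<bar>t\<bar>"] by (auto simp: q_def)
  qed
  have lim: "(\<lambda>i. H.nrm (\<lambda>x. q (X i) x - q s x)) \<longlonglongrightarrow> 0" if X: "X \<longlonglongrightarrow> s" for X s
  proof (rule Lim_null_comparison)
    have "(\<lambda>i. \<bar>X i - s\<bar> * H.nrm \<phi> + \<bar>\<bar>s\<bar> - \<bar>X i\<bar>\<bar> * H.nrm \<psi>)
        \<longlonglongrightarrow> \<bar>s - s\<bar> * H.nrm \<phi> + \<bar>\<bar>s\<bar> - \<bar>s\<bar>\<bar> * H.nrm \<psi>"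
      by (intro tendsto_intros X)
    then show "(\<lambda>i. \<bar>X i - s\<bar> * H.nrm \<phi> + \<bar>\<bar>s\<bar> - \<bar>X i\<bar>\<bar> * H.nrm \<psi>) \<longlonglongrightarrow> 0" by simp
    have "norm (H.nrm (\<lambda>x. q (X i) x - q s x)) \<le> \<bar>X i - s\<bar> * H.nrm \<phi> + \<bar>\<bar>s\<bar> - \<bar>X i\<bar>\<bar> * H.nrm \<psi>" for i
    proof -
      have "(\<lambda>x. q (X i) x - q s x) = (\<lambda>x. (X i - s) * \<phi> x + (\<bar>s\<bar> - \<bar>X i\<bar>) * \<psi> x)"
        by (simp add: q_def fun_eq_iff algebra_simps)
      then show ?thesis
        using H.nrm_lincomb_le[OF \<phi>H \<psi>, of "X i - s" "\<bar>s\<bar> - \<bar>X i\<bar>"] H.nrm_nonneg[OF H.diff_mem[OF qH[of "X i"] qH[of s]]]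
        by simp
    qed
    then show "\<forall>\<^sub>F i in sequentially. norm (H.nrm (\<lambda>x. q (X i) x - q s x))
        \<le> \<bar>X i - s\<bar> * H.nrm \<phi> + \<bar>\<bar>s\<bar> - \<bar>X i\<bar>\<bar> * H.nrm \<psi>" by simp
  qed
  have "((\<lambda>t. H_norm (\<lambda>x. normalize (q t) x - normalize (q s) x)) \<longlongrightarrow> 0) (at s within {-1..1})" for s
    unfolding path_continuous_iff[where p = "\<lambda>t. normalize (q t)"]
    using lim by (auto intro!: normalize_convergence qH q0)
  moreover have "normalize (q 1) = \<phi>" "normalize (q (-1)) = (\<lambda>x. - \<phi> x)"
  proof -
    have q1: "q 1 = \<phi>" "q (-1) = (\<lambda>x. - \<phi> x)" by (simp_all add: q_def fun_eq_iff)
    have "L2.nrm (\<lambda>x. - \<phi> x) = 1"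
      using L2.nrm_scale[OF sphereD(2)[OF \<phi>P], of "-1"] sphereD(3)[OF \<phi>P] by simp
    then show "normalize (q 1) = \<phi>" "normalize (q (-1)) = (\<lambda>x. - \<phi> x)"
      unfolding q1 normalize_def using sphereD(3)[OF \<phi>P] by simp_all
  qed
  ultimately have "(\<lambda>t. normalize (q t)) \<in> admissible_paths \<Omega> \<phi>"
    using normalize_sphere[OF qH q0] by (simp add: admissible_paths_def)
  then show ?thesis by blast
qed

text \<open>
  Weak convergence suffices for the energy term, since it is linear in the approximating functions. All other
  terms, the constraint and the positive part among them, need the convergence in \<open>L\<^sup>2\<close> only.
\<close>

lemma critical_point_at_level:
  assumes approx: "\<And>e. 0 < e \<Longrightarrow> 8 * e * step * K\<^sup>2 \<le> 1 \<Longrightarrow>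
      \<exists>u\<in>P. \<bar>J u - c\<bar> < e \<and> energy (grad u) (grad u) \<le> 8 * e / step"
  shows "\<exists>u\<in>P. \<forall>v\<in>H_space \<Omega>. energy u v + lower_form u v = r * ip (pos_part u) v + c * ip u v"
proof -
  \<comment> \<open>a tolerance for which the hypothesis applies; the summand \<open>1\<close> ensures \<open>e0 \<le> 1\<close>\<close>
  define e0 where "e0 = 1 / (8 * step * K\<^sup>2 + 1)"
  have sK: "0 < 8 * step * K\<^sup>2 + 1" using step_pos by (simp add: add_nonneg_pos)
  have e0: "0 < e0" "8 * e0 * step * K\<^sup>2 \<le> 1" "e0 \<le> 1"
    using sK step_pos by (auto simp: e0_def field_simps)
  define e where "e n = e0 * inverse (real (Suc n))" for n
  have en: "0 < e n" "e n \<le> e0" for n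
  proof -
    have "inverse (real (Suc n)) \<le> 1" by (simp add: inverse_eq_divide)
    then show "e n \<le> e0" using mult_left_mono[of "inverse (real (Suc n))" 1 e0] e0 by (simp add: e_def)
    show "0 < e n" using e0 by (simp add: e_def)
  qed
  have elim: "e \<longlonglongrightarrow> 0"
    unfolding e_def using tendsto_mult_left[OF LIMSEQ_inverse_real_of_nat, of e0] by simp
  have "8 * e n * step * K\<^sup>2 \<le> 1" for n
  proof -
    have "8 * e n * step * K\<^sup>2 \<le> 8 * e0 * step * K\<^sup>2"
      using en(2)[of n] step_pos by (intro mult_right_mono mult_left_mono) auto
    then show ?thesis using e0 by simp
  qed
  then have "\<exists>u\<in>P. \<bar>J u - c\<bar> < e n \<and> energy (grad u) (grad u) \<le> 8 * e n / step" for n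
    by (rule approx[OF en(1)])
  then obtain U where U: "\<And>n. U n \<in> P" "\<And>n. \<bar>J (U n) - c\<bar> < e n"
      "\<And>n. energy (grad (U n)) (grad (U n)) \<le> 8 * e n / step"
    by metis
  define C where "C = sqrt (\<bar>c\<bar> + 1 + M + r)"
  have UC: "H.nrm (U n) \<le> C" for n
  proof -
    have "energy (U n) (U n) \<le> \<bar>c\<bar> + 1 + M + r"
      using energy_le_J[OF U(1)[of n]] U(2)[of n] en(2)[of n] e0(3) by linarith
    then show ?thesis unfolding H.nrm_def C_def by (rule real_sqrt_le_mono)
  qed
  obtain k u where k: "strict_mono (k :: nat \<Rightarrow> nat)" and u: "u \<in> H_space \<Omega>"
    and weak: "\<And>v. v \<in> H_space \<Omega> \<Longrightarrow> (\<lambda>n. energy (U (k n)) v) \<longlonglongrightarrow> energy u v"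
    using H.weak_compactness[where X = U, OF H_complete sphereD(1)[OF U(1)] UC] by blast
  define X where "X n = U (k n)" for n
  have XP: "X n \<in> P" for n by (simp add: X_def U(1))
  note XH = sphereD(1)[OF XP] and XL = sphereD(2)[OF XP]
  note uL = H_space_L2[OF u]
  note dH = H.diff_mem[OF XH u]
  have L2: "(\<lambda>n. L2.nrm (\<lambda>x. X n x - u x)) \<longlonglongrightarrow> 0"
  proof (rule compact_embedding[OF dH])
    show "(\<lambda>n. energy (\<lambda>x. X n x - u x) v) \<longlonglongrightarrow> 0" if v: "v \<in> H_space \<Omega>" for v
      using weak[OF v] unfolding H.diff_left[OF XH u v] by (simp add: X_def LIM_zero_iff)
    show "H.nrm (\<lambda>x. X n x - u x) \<le> C + H.nrm u" for n
      using H.nrm_lincomb_le[OF XH[of n] u, of 1 "-1"] UC[of "k n"] by (simp add: X_def)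
  qed
  have "(\<lambda>n. L2.nrm (X n) - L2.nrm u) \<longlonglongrightarrow> 0"
    by (rule Lim_null_comparison[OF _ L2]) (use L2.nrm_diff_le[OF XL uL] in simp)
  then have "L2.nrm u = 1" using sphereD(3)[OF XP] by (simp add: LIMSEQ_const_iff)
  then have uP: "u \<in> P" using u by (simp add: L2_sphere_iff)
  have Jc: "(\<lambda>n. J (X n)) \<longlonglongrightarrow> c"
  proof -
    have "(\<lambda>n. J (U n) - c) \<longlonglongrightarrow> 0"
      by (rule Lim_null_comparison[OF _ elim]) (use U(2) in \<open>simp add: less_imp_le\<close>)
    then have "(\<lambda>n. J (U n)) \<longlonglongrightarrow> c" by (simp add: LIM_zero_iff)
    then show ?thesis unfolding X_def using LIMSEQ_subseq_LIMSEQ[OF _ k] by (auto simp: comp_def)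
  qed
  have G: "(\<lambda>n. H.nrm (grad (X n))) \<longlonglongrightarrow> 0"
  proof -
    have "(\<lambda>n. sqrt (8 * e n / step)) \<longlonglongrightarrow> sqrt (8 * 0 / step)"
      using step_pos by (intro tendsto_intros elim) auto
    then have s: "(\<lambda>n. sqrt (8 * e n / step)) \<longlonglongrightarrow> 0" by simp
    have "norm (H.nrm (grad (U n))) \<le> sqrt (8 * e n / step)" for n
    proof -
      have "H.nrm (grad (U n)) \<le> sqrt (8 * e n / step)"
        unfolding H.nrm_def by (rule real_sqrt_le_mono[OF U(3)])
      then show ?thesis using H.nrm_nonneg[OF grad(1)[OF U(1)[of n]]] by simp
    qed
    then have "(\<lambda>n. H.nrm (grad (U n))) \<longlonglongrightarrow> 0"
      by (intro Lim_null_comparison[OF _ s]) simp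
    then show ?thesis unfolding X_def using LIMSEQ_subseq_LIMSEQ[OF _ k] by (auto simp: comp_def)
  qed
  have "energy u v + lower_form u v = r * ip (pos_part u) v + c * ip u v" if v: "v \<in> H_space \<Omega>" for v
  proof -
    note vL = H_space_L2[OF v]
    have "(\<lambda>n. half_deriv (X n) v) \<longlonglongrightarrow> 0"
    proof (rule Lim_null_comparison)
      show "(\<lambda>n. H.nrm (grad (X n)) * H.nrm v) \<longlonglongrightarrow> 0"
        using tendsto_mult_right[OF G, of "H.nrm v"] by simp
      show "\<forall>\<^sub>F n in sequentially. norm (half_deriv (X n) v) \<le> H.nrm (grad (X n)) * H.nrm v"
        using H.Cauchy_Schwarz[OF grad(1)[OF XP] v] grad(2)[OF XP v] by simp
    qed
    moreover have "(\<lambda>n. half_deriv (X n) v)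
        \<longlonglongrightarrow> energy u v + lower_form u v - r * ip (pos_part u) v - c * ip u v"
    proof -
      have 1: "(\<lambda>n. energy (X n) v) \<longlonglongrightarrow> energy u v" using weak[OF v] by (simp add: X_def)
      have "(\<lambda>n. lower_form (X n) v - lower_form u v) \<longlonglongrightarrow> 0"
      proof (rule Lim_null_comparison)
        show "(\<lambda>n. M * (L2.nrm (\<lambda>x. X n x - u x) * L2.nrm v)) \<longlonglongrightarrow> 0"
          using tendsto_mult_left[OF tendsto_mult_right[OF L2, of "L2.nrm v"], of M] by simp
        show "\<forall>\<^sub>F n in sequentially. norm (lower_form (X n) v - lower_form u v)
            \<le> M * (L2.nrm (\<lambda>x. X n x - u x) * L2.nrm v)"
          using lower_M[OF L2.diff_mem[OF XL uL] vL] lower_form_diff[OF XL uL vL] by simp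
      qed
      then have 2: "(\<lambda>n. lower_form (X n) v) \<longlonglongrightarrow> lower_form u v" by (simp add: LIM_zero_iff)
      have p0: "norm (L2.nrm (\<lambda>x. pos_part (X n) x - pos_part u x)) \<le> L2.nrm (\<lambda>x. X n x - u x)" for n
        using pos_part_diff_le[OF XL uL, of n]
          L2.nrm_nonneg[OF L2.diff_mem[OF pos_part_L2[OF XL[of n]] pos_part_L2[OF uL]]] by simp
      have "(\<lambda>n. L2.nrm (\<lambda>x. pos_part (X n) x - pos_part u x)) \<longlonglongrightarrow> 0"
        by (rule Lim_null_comparison[OF _ L2]) (use p0 in simp)
      then have 3: "(\<lambda>n. ip (pos_part (X n)) v) \<longlonglongrightarrow> ip (pos_part u) v"
        by (rule L2.tendsto_left[OF pos_part_L2[OF XL] pos_part_L2[OF uL] vL])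
      have 4: "(\<lambda>n. ip (X n) v) \<longlonglongrightarrow> ip u v"
        by (rule L2.tendsto_left[OF XL uL vL L2])
      show ?thesis unfolding half_deriv_def by (intro tendsto_intros 1 2 3 4 Jc)
    qed
    ultimately have "energy u v + lower_form u v - r * ip (pos_part u) v - c * ip u v = 0"
      using LIMSEQ_unique by blast
    then show ?thesis by simp
  qed
  then show ?thesis using uP by blast
qed

end

theorem theorem3p10:
  fixes \<Omega> :: "'a::euclidean_space set" and \<phi>\<^sub>1 :: "'a \<Rightarrow> real" and r :: real
  assumes "bounded_C11_domain \<Omega>"
    and "first_eigenfunction \<Omega> \<phi>\<^sub>1"
    and "r \<ge> 0"
  shows "(r + minimax_level \<Omega> \<phi>\<^sub>1 r, minimax_level \<Omega> \<phi>\<^sub>1 r) \<in> fucik_spectrum \<Omega>"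
proof -
  interpret bounded_open_set \<Omega>
    using assms(1) by unfold_locales (auto simp: bounded_C11_domain_def)
  have ne: "\<Omega> \<noteq> {}" using assms(1) by (simp add: bounded_C11_domain_def)
  obtain K where K: "K > 0" "\<forall>u\<in>H_space \<Omega>. L2.nrm u \<le> K * H.nrm u"
    using Poincare[OF bounded] by blast
  obtain M where M: "0 \<le> M" "\<And>u v. u \<in> L2_space \<Omega> \<Longrightarrow> v \<in> L2_space \<Omega> \<Longrightarrow>
      \<bar>lower_form u v\<bar> \<le> M * (L2.nrm u * L2.nrm v)"
    using lower_form_bound by blast
  interpret fucik_setting \<Omega> r K M
    by unfold_locales (use K M assms(3) in auto)
  define c where "c = minimax_level \<Omega> \<phi>\<^sub>1 r"
  have "\<exists>u\<in>P. \<bar>J u - c\<bar> < e \<and> energy (grad u) (grad u) \<le> 8 * e / step"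
    if "0 < e" "8 * e * step * K\<^sup>2 \<le> 1" for e
    unfolding c_def
    by (rule almost_critical_point[OF admissible_paths_nonempty[OF ne assms(2)]
          eigenfunction_critical[OF assms(2)] that])
  then obtain u where u: "u \<in> P"
    and eq: "\<And>v. v \<in> H_space \<Omega> \<Longrightarrow> energy u v + lower_form u v = r * ip (pos_part u) v + c * ip u v"
    using critical_point_at_level by metis
  have "\<not> (AE x in lborel. u x = 0)"
    using L2_nrm_AE_zero[of u] sphereD(3)[OF u] by auto
  moreover have "energy_L u v = (LINT x:\<Omega>|lborel. ((r + c) * max (u x) 0 - c * max (- u x) 0) * v x)"
    if v: "v \<in> H_space \<Omega>" for v
  proof -
    note vL = H_space_L2[OF v] and uL = sphereD(2)[OF u]
    have "(LINT x:\<Omega>|lborel. ((r + c) * max (u x) 0 - c * max (- u x) 0) * v x)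
        = ip (\<lambda>x. r * pos_part u x + c * u x) v"
    proof -
      \<comment> \<open>as \<open>u = u\<^sup>+ - u\<^sup>-\<close>\<close>
      have "(\<lambda>x. (r + c) * max (u x) 0 - c * max (- u x) 0) = (\<lambda>x. r * pos_part u x + c * u x)"
        by (auto simp: fun_eq_iff max_def algebra_simps)
      then show ?thesis
        using set_integral_eq_ip[of \<Omega> "\<lambda>x. r * pos_part u x + c * u x" v] L2_spaceD(3)[OF vL] by metis
    qed
    also have "\<dots> = r * ip (pos_part u) v + c * ip u v"
      by (rule L2.lincomb_left[OF pos_part_L2[OF uL] uL vL])
    finally show ?thesis using eq[OF v] by (simp add: energy_L_eq)
  qed
  ultimately show ?thesis
    using sphereD(1)[OF u] unfolding fucik_spectrum_def c_def[symmetric] by blast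
qed

end
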